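(* Let $\mathcal{U}_1$ be a Ramsey for $\mathcal{R}_1$ ultrafilter on $[T_1]$ generated by a generic subset of $(\mathcal{R}_1,\le^* )$. If $\mathcal{Y}$ is a p-point ultrafilter Tukey equivalent to $\mathcal{U}_1$, $g$ is a map from the base set of $\mathcal{Y}$ to a set $Y$ with $g(\mathcal{Y})=\mathcal{V}$, and the cut $(S,L)$ associated to $g$ and $\mathcal{Y}$ is proper, then $\mathcal{V}$ is a p-point ultrafilter and $(S,L)$ is the standard cut in $\omega^{Y}/\mathcal{V}$.
   Context: For an ultrafilter $\mathcal{U}$ on a set $X$ and $f:X\to Y$, $f(\mathcal{U})$ is the ultrafilter on $Y$ generated by $\{f''Z: Z\in\mathcal{U}\}$. The ultrapower $\omega^{Y}/\mathcal{V}$ is linearly ordered by $[f]\le[g]$ iff $\{y: f(y)\le g(y)\}\in\mathcal{V}$. A Dedekind cut $(S,L)$ is a partition of this order with no element of $L$ below an element of $S$; it is proper if $L\neq\emptyset$ and $S$ contains the class of every constant map; the standard cut has $S$ equal to the set of classes of constant maps. Cut associated to $g:X\to Y$ and $\mathcal{U}$ on $X$: with $C_A(y)=|A\cap g^{-1}\{y\}|$, $L$ consists of the classes of those $C_A$ with $A\in\mathcal{U}$ and $C_A$ finite-valued, and all larger elements of $\omega^{Y}/g(\mathcal{U})$; $S$ is the complement. A p-point is a nonprincipal ultrafilter $\mathcal{U}$ on a countable set such that for every decreasing sequence $A_0\supseteq A_1\supseteq\cdots$ in $\mathcal{U}$ there is $A\in\mathcal{U}$ with $A\subseteq^* A_i$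 (i.e. $A\setminus A_i$ finite) for all $i$. Tukey: a map $f:\mathcal{U}\to\mathcal{V}$ is Tukey if it sends cofinal subsets of $(\mathcal{U},\supseteq)$ to cofinal subsets of $(\mathcal{V},\supseteq)$; $\mathcal{V}\le_T\mathcal{U}$ if such a map exists; Tukey equivalent means $\le_T$ both ways. The space $\mathcal{R}_1$: $T_1(i)=\{\langle\rangle,\langle i\rangle\}\cup\{\langle i,j\rangle: i(i+1)\le 2j<(i+1)(i+2)\}$, $T_1=\bigcup_iT_1(i)$; $\mathcal{R}_1$ is the set of subtrees $S\subseteq T_1$ for which there is strictly increasing $(k_i)$ with $S\cap T_1(k_i)$ isomorphic to $T_1(i)$ (containing $\langle\rangle,\langle k_i\rangle$ and exactly $i+1$ length-two nodes) and $S\cap T_1(k)\neq\{\langle\rangle\}$ only if $k=k_i$ for some $i$. $S(i)=S\cap T_1(k_i)$, $r_i(S)=\bigcup_{j<i}S(j)$, $\mathcal{AR}_i=\{r_i(S):S\in\mathcal{R}_1\}$, $\mathcal{AR}_i|S=\{s\in\mathcal{AR}_i:s\subseteq S\}$; $[S]$, $[T_1]$ denote sets of length-two nodes. $S\le^*T$ iff $S\setminus r_i(S)\subseteq T$ for some $i$. An ultrafilter $\mathcal{U}$ on $[T_1]$ is generated by $\mathcal{C}\subseteq\mathcal{R}_1$ if $\{[S]:S\in\mathcal{C}\}$ is cofinal in $(\mathcal{U},\supseteq)$; it is Ramsey for $\mathcal{R}_1$ if it is generated by some $\mathcal{C}$ such that for every $i$ and every 2-partition of $\mathcal{AR}_i$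 there is $S\in\mathcal{C}$ with $\mathcal{AR}_i|S$ in one part. "Generated by a generic subset of $(\mathcal{R}_1,\le^* )$" means $\mathcal{U}_1$ is generated by a filter $G\subseteq\mathcal{R}_1$ which is generic (over the ground model) for the forcing partial order $(\mathcal{R}_1,\le^* )$. *)

theory Defs
  imports Main
begin

text \<open>
  The theorem is a statement about a generic extension \<open>V[G]\<close> of the ground model \<open>V\<close> by the
  forcing order \<open>(R\<^sub>1, \<le>\<^sup>*)\<close>.  Here \<open>V\<close> is the universe of HOL: the first part defines
  the order in \<open>V\<close>, the second part its names and its forcing relation, and the third part
  expresses the notions of the theorem in the forcing language, hence as notions of \<open>V[G]\<close>.
  ``It holds in \<open>V[G]\<close> for every generic \<open>G\<close>'' is rendered, as usual, by ``every condition forces it''.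
\<close>

section \<open>The space \<open>R\<^sub>1\<close> in the ground model\<close>

definition T1_tree :: "nat \<Rightarrow> nat list set" where
  "T1_tree i = {[], [i]} \<union> {[i, j] |j. i * (i + 1) \<le> 2 * j \<and> 2 * j < (i + 1) * (i + 2)}"

definition T1 :: "nat list set" where
  "T1 = (\<Union>i. T1_tree i)"

text \<open>\<open>k\<close> is the sequence \<open>(k\<^sub>i)\<close> witnessing that the tree \<open>S\<close> is in \<open>R\<^sub>1\<close>; it is unique,
  since its range is \<open>{m. [m] \<in> S}\<close>.\<close>

definition R1_witness :: "(nat \<Rightarrow> nat) \<Rightarrow> nat list set \<Rightarrow> bool" where
  "R1_witness k S \<longleftrightarrow>
     S \<subseteq> T1 \<and> (\<forall>s\<in>S. \<forall>n. take n s \<in> S) \<and> strict_mono k \<and>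
     (\<forall>i. [] \<in> S \<and> [k i] \<in> S \<and> card {s \<in> S \<inter> T1_tree (k i). length s = 2} = i + 1) \<and>
     (\<forall>m. S \<inter> T1_tree m \<noteq> {[]} \<longrightarrow> (\<exists>i. m = k i))"

definition R1 :: "nat list set set" where
  "R1 = {S. \<exists>k. R1_witness k S}"

definition r_approx :: "(nat \<Rightarrow> nat) \<Rightarrow> nat \<Rightarrow> nat list set \<Rightarrow> nat list set" where
  "r_approx k i S = (\<Union>j<i. S \<inter> T1_tree (k j))"

definition le_star :: "nat list set \<Rightarrow> nat list set \<Rightarrow> bool" where
  "le_star S T \<longleftrightarrow> (\<exists>k i. R1_witness k S \<and> S - r_approx k i S \<subseteq> T)"

lemma T1_tree_hd: "s \<in> T1_tree m \<Longrightarrow> s \<noteq> [] \<Longrightarrow> hd s = m"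
  by (auto simp: T1_tree_def)

lemma le_star_refl: "S \<in> R1 \<Longrightarrow> le_star S S"
  by (auto simp: R1_def le_star_def)

lemma le_star_trans:
  assumes "le_star S T" "le_star T U"
  shows "le_star S U"
proof -
  obtain k i where k: "R1_witness k S" and ST: "S - r_approx k i S \<subseteq> T"
    using assms(1) by (auto simp: le_star_def)
  obtain l j where TU: "T - r_approx l j T \<subseteq> U" and l: "R1_witness l T"
    using assms(2) by (auto simp: le_star_def)
  have monk: "strict_mono k" and monl: "strict_mono l"
    using k l by (auto simp: R1_witness_def)
  define m where "m = max i (Suc (l j))"
  have "s \<in> U" if s: "s \<in> S" and not_r: "s \<notin> r_approx k m S" for s
  proof -
    have "[] \<in> r_approx k m S"
      using k by (force simp: r_approx_def m_def R1_witness_def T1_tree_def)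
    with not_r have ne: "s \<noteq> []" by auto
    obtain a where a: "s \<in> T1_tree a"
      using s k by (auto simp: R1_witness_def T1_def)
    with s ne have "S \<inter> T1_tree a \<noteq> {[]}" by auto
    with k obtain n where n: "a = k n" unfolding R1_witness_def by blast
    have mn: "m \<le> n"
      using not_r s a n by (force simp: r_approx_def)
    have "s \<notin> r_approx k i S"
    proof
      assume "s \<in> r_approx k i S"
      then obtain n' where "n' < i" "s \<in> T1_tree (k n')" by (auto simp: r_approx_def)
      then have "k n' = k n" using T1_tree_hd[OF _ ne] a n by metis
      then have "n' = n" using monk by (simp add: strict_mono_eq)
      with \<open>n' < i\<close> mn show False by (simp add: m_def)
    qed
    with s ST have sT: "s \<in> T" by auto
    have "s \<notin> r_approx l j T"
    proof
      assume "s \<in> r_approx l j T"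
      then obtain j' where j': "j' < j" "s \<in> T1_tree (l j')" by (auto simp: r_approx_def)
      then have "k n = l j'" using T1_tree_hd[OF _ ne] a n by metis
      also have "\<dots> < l j" using monl j'(1) by (simp add: strict_mono_less)
      also have "\<dots> < n" using mn by (simp add: m_def)
      also have "n \<le> k n" using monk by (simp add: strict_mono_imp_increasing)
      finally show False by simp
    qed
    with sT TU show ?thesis by auto
  qed
  then have "S - r_approx k m S \<subseteq> U" by auto
  with k show ?thesis by (auto simp: le_star_def)
qed

lemma T1_in_R1: "T1 \<in> R1"
proof -
  have int: "T1 \<inter> T1_tree m = T1_tree m" for m by (auto simp: T1_def)
  have card: "card {s \<in> T1_tree i. length s = 2} = i + 1" for i
  proof -
    obtain c where c: "i * (i + 1) = 2 * c" by (metis dvdE even_Suc even_mult_iff Suc_eq_plus1)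
    then have c': "(i + 1) * (i + 2) = 2 * (c + i + 1)" by (simp add: algebra_simps)
    have "{s \<in> T1_tree i. length s = 2} = (\<lambda>j. [i, j]) ` {c..<c + i + 1}"
      unfolding T1_tree_def c c' by auto
    then show ?thesis by (simp add: card_image inj_on_def)
  qed
  have "R1_witness id T1"
    unfolding R1_witness_def int card
  proof (intro conjI ballI allI impI)
    fix s n assume "s \<in> T1"
    then obtain i where s: "s \<in> T1_tree i" by (auto simp: T1_def)
    have "take n s \<in> T1_tree i"
      using s unfolding T1_tree_def by (cases n; cases "n - 1") auto
    then show "take n s \<in> T1" by (auto simp: T1_def)
  qed (auto simp: strict_mono_def T1_def T1_tree_def int[unfolded id_def] card)
  then show ?thesis by (auto simp: R1_def)
qed


section \<open>The forcing language\<close>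

typedef cond = R1
  using T1_in_R1 by auto

instantiation cond :: preorder
begin
definition less_eq_cond :: "cond \<Rightarrow> cond \<Rightarrow> bool" where
  "p \<le> q \<longleftrightarrow> le_star (Rep_cond p) (Rep_cond q)"
definition less_cond :: "cond \<Rightarrow> cond \<Rightarrow> bool" where
  "p < q \<longleftrightarrow> p \<le> q \<and> \<not> q \<le> (p :: cond)"
instance
  by standard
    (auto simp: less_eq_cond_def less_cond_def
      intro: le_star_refl le_star_trans Rep_cond)
end

text \<open>A sentence of the forcing language is identified with the set of conditions forcing it:
  \<open>\<phi> p\<close> means \<open>p \<tturnstile> \<phi>\<close>.  A smaller condition is a stronger one.\<close>

type_synonym sentence = "cond \<Rightarrow> bool"

definition lift :: "bool \<Rightarrow> sentence" ("\<^bold>\<langle>_\<^bold>\<rangle>") where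
  "\<^bold>\<langle>b\<^bold>\<rangle> = (\<lambda>p. b)"
definition f_not :: "sentence \<Rightarrow> sentence" ("\<^bold>\<not>_" [40] 40) where
  "(\<^bold>\<not>\<phi>) = (\<lambda>p. \<forall>q\<le>p. \<not> \<phi> q)"
definition f_and :: "sentence \<Rightarrow> sentence \<Rightarrow> sentence" (infixr "\<^bold>\<and>" 35) where
  "(\<phi> \<^bold>\<and> \<psi>) = (\<lambda>p. \<phi> p \<and> \<psi> p)"
definition f_all :: "('n \<Rightarrow> sentence) \<Rightarrow> sentence" (binder "\<^bold>\<forall>" 10) where
  "(\<^bold>\<forall>x. \<phi> x) = (\<lambda>p. \<forall>x. \<phi> x p)"
definition f_or :: "sentence \<Rightarrow> sentence \<Rightarrow> sentence" (infixr "\<^bold>\<or>" 30) where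
  "(\<phi> \<^bold>\<or> \<psi>) = (\<^bold>\<not>(\<^bold>\<not>\<phi> \<^bold>\<and> \<^bold>\<not>\<psi>))"
definition f_imp :: "sentence \<Rightarrow> sentence \<Rightarrow> sentence" (infixr "\<^bold>\<longrightarrow>" 25) where
  "(\<phi> \<^bold>\<longrightarrow> \<psi>) = (\<^bold>\<not>(\<phi> \<^bold>\<and> \<^bold>\<not>\<psi>))"
definition f_iff :: "sentence \<Rightarrow> sentence \<Rightarrow> sentence" (infixr "\<^bold>\<longleftrightarrow>" 25) where
  "(\<phi> \<^bold>\<longleftrightarrow> \<psi>) = ((\<phi> \<^bold>\<longrightarrow> \<psi>) \<^bold>\<and> (\<psi> \<^bold>\<longrightarrow> \<phi>))"
definition f_ex :: "('n \<Rightarrow> sentence) \<Rightarrow> sentence" (binder "\<^bold>\<exists>" 10) where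
  "(\<^bold>\<exists>x. \<phi> x) = (\<^bold>\<not>(\<^bold>\<forall>x. \<^bold>\<not>\<phi> x))"

definition valid :: "sentence \<Rightarrow> bool" ("\<^bold>\<tturnstile> _" [8] 8) where
  "(\<^bold>\<tturnstile> \<phi>) \<longleftrightarrow> (\<forall>p. \<phi> p)"

definition stable :: "sentence \<Rightarrow> bool" where
  "stable \<phi> \<longleftrightarrow> (\<forall>p. \<phi> p \<longleftrightarrow> (\<forall>q\<le>p. \<exists>r\<le>q. \<phi> r))"

text \<open>A type of class \<open>names\<close> is a type of names for elements of \<open>V[G]\<close>, together with the forcing
  relation for equality of the named elements, and quantification over the type is quantification
  over the named elements.  Numbers name themselves; lists and pairs are
  the canonical names for the lists and pairs of the named elements.\<close>

class names =
  fixes f_eq :: "'a \<Rightarrow> 'a \<Rightarrow> sentence"  (infix "\<^bold>=" 50)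
  assumes stable_eq: "stable (x \<^bold>= y)"
    and eq_refl: "(x \<^bold>= x) p"
    and eq_sym: "(x \<^bold>= y) p \<Longrightarrow> (y \<^bold>= x) p"
    and eq_trans: "(x \<^bold>= y) p \<Longrightarrow> (y \<^bold>= z) p \<Longrightarrow> (x \<^bold>= z) p"

lemma stable_mono: "stable \<phi> \<Longrightarrow> \<phi> p \<Longrightarrow> q \<le> p \<Longrightarrow> \<phi> q"
  unfolding stable_def by (meson order_trans)

lemma stable_dense: "stable \<phi> \<Longrightarrow> (\<And>q. q \<le> p \<Longrightarrow> \<exists>r\<le>q. \<phi> r) \<Longrightarrow> \<phi> p"
  unfolding stable_def by blast

lemma stableI:
  assumes "\<And>p q. \<phi> p \<Longrightarrow> q \<le> p \<Longrightarrow> \<phi> q"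
    and "\<And>p. (\<And>q. q \<le> p \<Longrightarrow> \<exists>r\<le>q. \<phi> r) \<Longrightarrow> \<phi> p"
  shows "stable \<phi>"
  unfolding stable_def using assms order_refl by blast

lemma stable_lift: "stable \<^bold>\<langle>b\<^bold>\<rangle>"
  unfolding lift_def by (rule stableI) (auto intro: order_refl)

lemma stable_and:
  assumes "stable \<phi>" "stable \<psi>"
  shows "stable (\<phi> \<^bold>\<and> \<psi>)"
  unfolding f_and_def
proof (rule stableI)
  fix p assume *: "\<And>q. q \<le> p \<Longrightarrow> \<exists>r\<le>q. \<phi> r \<and> \<psi> r"
  have "\<phi> p" by (rule stable_dense[OF assms(1)]) (use * in blast)
  moreover have "\<psi> p" by (rule stable_dense[OF assms(2)]) (use * in blast)
  ultimately show "\<phi> p \<and> \<psi> p" ..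
qed (use assms stable_mono in blast)

lemma stable_all:
  assumes "\<And>x. stable (\<phi> x)"
  shows "stable (\<^bold>\<forall>x. \<phi> x)"
  unfolding f_all_def
proof (rule stableI)
  fix p assume *: "\<And>q. q \<le> p \<Longrightarrow> \<exists>r\<le>q. \<forall>x. \<phi> x r"
  have "\<phi> x p" for x by (rule stable_dense[OF assms]) (use * in blast)
  then show "\<forall>x. \<phi> x p" ..
qed (use assms stable_mono in blast)

lemma stable_not:
  assumes "stable \<phi>"
  shows "stable (\<^bold>\<not>\<phi>)"
  unfolding f_not_def
proof (rule stableI)
  fix p assume *: "\<And>q. q \<le> p \<Longrightarrow> \<exists>r\<le>q. \<forall>s\<le>r. \<not> \<phi> s"
  show "\<forall>q\<le>p. \<not> \<phi> q" using * stable_mono[OF assms] order_refl by blast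
qed (use order_trans in blast)

lemma f_imp_iff:
  assumes "stable \<phi>" "stable \<psi>"
  shows "(\<phi> \<^bold>\<longrightarrow> \<psi>) p \<longleftrightarrow> (\<forall>q\<le>p. \<phi> q \<longrightarrow> \<psi> q)"
proof
  assume imp: "(\<phi> \<^bold>\<longrightarrow> \<psi>) p"
  show "\<forall>q\<le>p. \<phi> q \<longrightarrow> \<psi> q"
  proof (intro allI impI)
    fix q assume q: "q \<le> p" "\<phi> q"
    show "\<psi> q"
    proof (rule stable_dense[OF assms(2)])
      fix r assume r: "r \<le> q"
      then have "r \<le> p" "\<phi> r" using q stable_mono[OF assms(1)] order_trans by blast+
      with imp show "\<exists>s\<le>r. \<psi> s" by (auto simp: f_imp_def f_not_def f_and_def)
    qed
  qed
qed (auto simp: f_imp_def f_not_def f_and_def intro: order_refl)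

instantiation nat :: names
begin
definition f_eq_nat :: "nat \<Rightarrow> nat \<Rightarrow> sentence" where "((m::nat) \<^bold>= n) = \<^bold>\<langle>m = n\<^bold>\<rangle>"
instance
  by standard (auto simp: f_eq_nat_def stable_lift, auto simp: lift_def)
end

instantiation prod :: (names, names) names
begin
definition f_eq_prod :: "'a \<times> 'b \<Rightarrow> 'a \<times> 'b \<Rightarrow> sentence" where
  "((x :: 'a \<times> 'b) \<^bold>= y) = (fst x \<^bold>= fst y \<^bold>\<and> snd x \<^bold>= snd y)"
instance
proof
  fix x y z :: "'a \<times> 'b" and p
  show "stable (x \<^bold>= y)"
    unfolding f_eq_prod_def by (intro stable_and stable_eq)
  show "(x \<^bold>= x) p"
    by (simp add: f_eq_prod_def f_and_def eq_refl)
  show "(x \<^bold>= y) p \<Longrightarrow> (y \<^bold>= x) p"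
    by (simp add: f_eq_prod_def f_and_def eq_sym)
  show "(x \<^bold>= y) p \<Longrightarrow> (y \<^bold>= z) p \<Longrightarrow> (x \<^bold>= z) p"
    unfolding f_eq_prod_def f_and_def by (blast intro: eq_trans)
qed
end

instantiation list :: (names) names
begin
definition f_eq_list :: "'a list \<Rightarrow> 'a list \<Rightarrow> sentence" where
  "((xs :: 'a list) \<^bold>= ys) = (\<lambda>p. list_all2 (\<lambda>x y. (x \<^bold>= y) p) xs ys)"
instance
proof
  fix xs ys zs :: "'a list" and p
  have eq: "(xs \<^bold>= ys) = (\<^bold>\<langle>length xs = length ys\<^bold>\<rangle> \<^bold>\<and>
      (\<^bold>\<forall>i. if i < length xs then xs ! i \<^bold>= ys ! i else \<^bold>\<langle>True\<^bold>\<rangle>))"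
    by (rule ext) (auto simp: f_eq_list_def list_all2_conv_all_nth f_and_def f_all_def lift_def)
  show "stable (xs \<^bold>= ys)"
    unfolding eq by (intro stable_and stable_lift stable_all) (auto intro: stable_eq stable_lift)
  show "(xs \<^bold>= xs) p"
    by (simp add: f_eq_list_def list_all2_refl eq_refl)
  show "(xs \<^bold>= ys) p \<Longrightarrow> (ys \<^bold>= xs) p"
    by (auto simp: f_eq_list_def list_all2_conv_all_nth intro: eq_sym)
  show "(xs \<^bold>= ys) p \<Longrightarrow> (ys \<^bold>= zs) p \<Longrightarrow> (xs \<^bold>= zs) p"
    unfolding f_eq_list_def by (rule list_all2_trans[OF eq_trans])
qed
end

text \<open>Names for the sets (in \<open>V[G]\<close>) of elements named by \<open>'a\<close>: sets of pairs of a name and a condition,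
  with the usual forcing relation for membership and equality.\<close>

datatype 'a setn = Setn (pairs: "('a \<times> cond) set")

definition f_mem :: "'a::names \<Rightarrow> 'a setn \<Rightarrow> sentence"  (infix "\<^bold>\<in>" 50) where
  "(x \<^bold>\<in> A) = (\<lambda>p. \<forall>q\<le>p. \<exists>r\<le>q. \<exists>(y, s)\<in>pairs A. r \<le> s \<and> (x \<^bold>= y) r)"

lemma stable_mem: "stable (x \<^bold>\<in> A)"
  unfolding f_mem_def
proof (rule stableI)
  fix p
  let ?\<phi> = "\<lambda>r. \<exists>(y, s)\<in>pairs A. r \<le> s \<and> (x \<^bold>= y) r"
  assume *: "\<And>q. q \<le> p \<Longrightarrow> \<exists>r\<le>q. \<forall>q\<le>r. \<exists>r\<le>q. ?\<phi> r"
  show "\<forall>q\<le>p. \<exists>r\<le>q. ?\<phi> r"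
  proof (intro allI impI)
    fix q assume "q \<le> p"
    then obtain r where "r \<le> q" "\<exists>s\<le>r. ?\<phi> s" using * order_refl by meson
    then show "\<exists>r\<le>q. ?\<phi> r" using order_trans by meson
  qed
next
  fix p q assume "\<forall>q\<le>p. \<exists>r\<le>q. \<exists>(y, s)\<in>pairs A. r \<le> s \<and> (x \<^bold>= y) r" and "q \<le> p"
  then show "\<forall>q'\<le>q. \<exists>r\<le>q'. \<exists>(y, s)\<in>pairs A. r \<le> s \<and> (x \<^bold>= y) r"
    using order_trans by meson
qed

instantiation setn :: (names) names
begin
definition f_eq_setn :: "'a setn \<Rightarrow> 'a setn \<Rightarrow> sentence" where
  "((A :: 'a setn) \<^bold>= B) = (\<^bold>\<forall>x. x \<^bold>\<in> A \<^bold>\<longleftrightarrow> x \<^bold>\<in> B)"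
instance
proof
  fix A B C :: "'a setn" and p
  show "stable (A \<^bold>= B)"
    unfolding f_eq_setn_def f_iff_def f_imp_def
    by (intro stable_all stable_and stable_not stable_mem)
  have eq: "(A \<^bold>= B) p \<longleftrightarrow> (\<forall>x. \<forall>q\<le>p. (x \<^bold>\<in> A) q \<longleftrightarrow> (x \<^bold>\<in> B) q)" for A B :: "'a setn"
    unfolding f_eq_setn_def f_all_def f_iff_def
    by (auto simp: f_and_def f_imp_iff stable_mem)
  show "(A \<^bold>= A) p" by (simp add: eq)
  show "(A \<^bold>= B) p \<Longrightarrow> (B \<^bold>= A) p" by (simp add: eq)
  show "(A \<^bold>= B) p \<Longrightarrow> (B \<^bold>= C) p \<Longrightarrow> (A \<^bold>= C) p" by (simp add: eq)
qed
end

text \<open>The canonical name for \<open>{x. \<phi> x}\<close>; the lemma \<open>mem_set_of\<close> justifies it.\<close>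

definition set_of :: "('a::names \<Rightarrow> sentence) \<Rightarrow> 'a setn"  (binder "SetOf " 10) where
  "(SetOf x. \<phi> x) = Setn {(x, p). \<phi> x p}"

lemma mem_set_of:
  assumes "\<And>x. stable (\<phi> x)"
    and "\<And>x y p. (x \<^bold>= y) p \<Longrightarrow> \<phi> y p \<Longrightarrow> \<phi> x p"
  shows "(x \<^bold>\<in> (SetOf x. \<phi> x)) p \<longleftrightarrow> \<phi> x p"
proof
  assume *: "(x \<^bold>\<in> (SetOf x. \<phi> x)) p"
  show "\<phi> x p"
  proof (rule stable_dense[OF assms(1)])
    fix q assume "q \<le> p"
    with * obtain r y s where "r \<le> q" "\<phi> y s" "r \<le> s" "(x \<^bold>= y) r"
      unfolding f_mem_def set_of_def by auto
    then show "\<exists>r\<le>q. \<phi> x r" using assms(2) stable_mono[OF assms(1)] by blast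
  qed
next
  assume "\<phi> x p"
  then have "\<forall>q\<le>p. (x, q) \<in> pairs (SetOf x. \<phi> x)"
    using stable_mono[OF assms(1)] by (simp add: set_of_def)
  then show "(x \<^bold>\<in> (SetOf x. \<phi> x)) p"
    unfolding f_mem_def using eq_refl order_refl by blast
qed

definition check :: "'a::names set \<Rightarrow> 'a setn" where
  "check A = (SetOf x. \<^bold>\<langle>x \<in> A\<^bold>\<rangle>)"

text \<open>The canonical name for the generic filter \<open>G \<subseteq> R\<^sub>1\<close>.\<close>

definition generic :: "nat list setn setn" where
  "generic = Setn {(check (Rep_cond p), p) |p. True}"


section \<open>The notions of the theorem in the generic extension\<close>

subsection \<open>Sets and functions\<close>

definition f_subset :: "'a::names setn \<Rightarrow> 'a setn \<Rightarrow> sentence"  (infix "\<^bold>\<subseteq>" 50) where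
  "(A \<^bold>\<subseteq> B) = (\<^bold>\<forall>x. x \<^bold>\<in> A \<^bold>\<longrightarrow> x \<^bold>\<in> B)"

definition f_diff :: "'a::names setn \<Rightarrow> 'a setn \<Rightarrow> 'a setn"  (infixl "\<^bold>-" 65) where
  "A \<^bold>- B = (SetOf x. x \<^bold>\<in> A \<^bold>\<and> \<^bold>\<not>(x \<^bold>\<in> B))"

definition f_inter :: "'a::names setn \<Rightarrow> 'a setn \<Rightarrow> 'a setn"  (infixl "\<^bold>\<inter>" 70) where
  "A \<^bold>\<inter> B = (SetOf x. x \<^bold>\<in> A \<^bold>\<and> x \<^bold>\<in> B)"

definition func :: "('a::names \<times> 'b::names) setn \<Rightarrow> 'a setn \<Rightarrow> 'b setn \<Rightarrow> sentence" where
  "func f A B =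
     ((\<^bold>\<forall>x y. (x, y) \<^bold>\<in> f \<^bold>\<longrightarrow> x \<^bold>\<in> A \<^bold>\<and> y \<^bold>\<in> B) \<^bold>\<and>
      (\<^bold>\<forall>x. x \<^bold>\<in> A \<^bold>\<longrightarrow> (\<^bold>\<exists>y. (x, y) \<^bold>\<in> f)) \<^bold>\<and>
      (\<^bold>\<forall>x y z. (x, y) \<^bold>\<in> f \<^bold>\<and> (x, z) \<^bold>\<in> f \<^bold>\<longrightarrow> y \<^bold>= z))"

definition injective :: "('a::names \<times> 'b::names) setn \<Rightarrow> sentence" where
  "injective f = (\<^bold>\<forall>x y z. (x, z) \<^bold>\<in> f \<^bold>\<and> (y, z) \<^bold>\<in> f \<^bold>\<longrightarrow> x \<^bold>= y)"

definition img :: "('a::names \<times> 'b::names) setn \<Rightarrow> 'a setn \<Rightarrow> 'b setn" where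
  "img f A = (SetOf y. \<^bold>\<exists>x. x \<^bold>\<in> A \<^bold>\<and> (x, y) \<^bold>\<in> f)"

definition omega :: "nat setn" where
  "omega = check UNIV"

definition has_card :: "'a::names setn \<Rightarrow> nat \<Rightarrow> sentence" where
  "has_card A n = (\<^bold>\<exists>f. func f A (check {..<n}) \<^bold>\<and> injective f \<^bold>\<and> img f A \<^bold>= check {..<n})"

definition fin :: "'a::names setn \<Rightarrow> sentence" where
  "fin A = (\<^bold>\<exists>n. has_card A n)"

definition ctbl :: "'a::names setn \<Rightarrow> sentence" where
  "ctbl A = (\<^bold>\<exists>f. func f A omega \<^bold>\<and> injective f)"

subsection \<open>Ultrafilters\<close>

definition ultrafilter :: "'a::names setn \<Rightarrow> 'a setn setn \<Rightarrow> sentence" where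
  "ultrafilter X \<U> =
     ((\<^bold>\<forall>A. A \<^bold>\<in> \<U> \<^bold>\<longrightarrow> A \<^bold>\<subseteq> X) \<^bold>\<and> X \<^bold>\<in> \<U> \<^bold>\<and> \<^bold>\<not>(check {} \<^bold>\<in> \<U>) \<^bold>\<and>
      (\<^bold>\<forall>A B. A \<^bold>\<in> \<U> \<^bold>\<and> A \<^bold>\<subseteq> B \<^bold>\<and> B \<^bold>\<subseteq> X \<^bold>\<longrightarrow> B \<^bold>\<in> \<U>) \<^bold>\<and>
      (\<^bold>\<forall>A B. A \<^bold>\<in> \<U> \<^bold>\<and> B \<^bold>\<in> \<U> \<^bold>\<longrightarrow> A \<^bold>\<inter> B \<^bold>\<in> \<U>) \<^bold>\<and>
      (\<^bold>\<forall>A. A \<^bold>\<subseteq> X \<^bold>\<longrightarrow> A \<^bold>\<in> \<U> \<^bold>\<or> X \<^bold>- A \<^bold>\<in> \<U>))"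

definition nonprincipal :: "'a::names setn setn \<Rightarrow> sentence" where
  "nonprincipal \<U> = (\<^bold>\<forall>x. \<^bold>\<not>((SetOf y. y \<^bold>= x) \<^bold>\<in> \<U>))"

text \<open>The ultrafilter \<open>f(\<U>)\<close> on \<open>Y\<close>.\<close>

definition image_filter ::
  "('a::names \<times> 'b::names) setn \<Rightarrow> 'b setn \<Rightarrow> 'a setn setn \<Rightarrow> 'b setn setn" where
  "image_filter f Y \<U> = (SetOf B. B \<^bold>\<subseteq> Y \<^bold>\<and> (\<^bold>\<exists>Z. Z \<^bold>\<in> \<U> \<^bold>\<and> img f Z \<^bold>\<subseteq> B))"

text \<open>A p-point is an ultrafilter on a countable set.  The image of a p-point in an uncountable set \<open>Y\<close>
  is concentrated on a countable subset only, so the size of the base set is left open here; that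
  such an ultrafilter \<open>\<V>\<close> is a p-point then means that some element of \<open>\<V>\<close> is countable as well.\<close>

definition p_ultrafilter :: "'a::names setn \<Rightarrow> 'a setn setn \<Rightarrow> sentence" where
  "p_ultrafilter X \<U> =
     (ultrafilter X \<U> \<^bold>\<and> nonprincipal \<U> \<^bold>\<and>
      (\<^bold>\<forall>\<A>. func \<A> omega \<U> \<^bold>\<and> (\<^bold>\<forall>i A B. (i, A) \<^bold>\<in> \<A> \<^bold>\<and> (Suc i, B) \<^bold>\<in> \<A> \<^bold>\<longrightarrow> B \<^bold>\<subseteq> A) \<^bold>\<longrightarrow>
         (\<^bold>\<exists>A. A \<^bold>\<in> \<U> \<^bold>\<and> (\<^bold>\<forall>i B. (i, B) \<^bold>\<in> \<A> \<^bold>\<longrightarrow> fin (A \<^bold>- B)))))"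

definition p_point :: "'a::names setn \<Rightarrow> 'a setn setn \<Rightarrow> sentence" where
  "p_point X \<U> = (ctbl X \<^bold>\<and> p_ultrafilter X \<U>)"

definition cofinal :: "'a::names setn setn \<Rightarrow> 'a setn setn \<Rightarrow> sentence" where
  "cofinal \<D> \<U> = (\<D> \<^bold>\<subseteq> \<U> \<^bold>\<and> (\<^bold>\<forall>A. A \<^bold>\<in> \<U> \<^bold>\<longrightarrow> (\<^bold>\<exists>D. D \<^bold>\<in> \<D> \<^bold>\<and> D \<^bold>\<subseteq> A)))"

definition tukey_le :: "'b::names setn setn \<Rightarrow> 'a::names setn setn \<Rightarrow> sentence" where
  "tukey_le \<V> \<U> = (\<^bold>\<exists>f. func f \<U> \<V> \<^bold>\<and> (\<^bold>\<forall>\<D>. cofinal \<D> \<U> \<^bold>\<longrightarrow> cofinal (img f \<D>) \<V>))"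

definition tukey_equiv :: "'b::names setn setn \<Rightarrow> 'a::names setn setn \<Rightarrow> sentence" where
  "tukey_equiv \<V> \<U> = (tukey_le \<V> \<U> \<^bold>\<and> tukey_le \<U> \<V>)"

subsection \<open>Cuts in ultrapowers\<close>

definition power_fun :: "'b::names setn \<Rightarrow> ('b \<times> nat) setn \<Rightarrow> sentence" where
  "power_fun Y h = func h Y omega"

definition ult_eq :: "'b::names setn \<Rightarrow> 'b setn setn \<Rightarrow> ('b \<times> nat) setn \<Rightarrow> ('b \<times> nat) setn \<Rightarrow> sentence" where
  "ult_eq Y \<V> h h' =
     ((SetOf y. y \<^bold>\<in> Y \<^bold>\<and> (\<^bold>\<exists>m n. (y, m) \<^bold>\<in> h \<^bold>\<and> (y, n) \<^bold>\<in> h' \<^bold>\<and> \<^bold>\<langle>m = n\<^bold>\<rangle>)) \<^bold>\<in> \<V>)"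

definition ult_class :: "'b::names setn \<Rightarrow> 'b setn setn \<Rightarrow> ('b \<times> nat) setn \<Rightarrow> ('b \<times> nat) setn setn" where
  "ult_class Y \<V> h = (SetOf h'. power_fun Y h' \<^bold>\<and> ult_eq Y \<V> h h')"

text \<open>The ultrapower \<open>\<omega>\<^sup>Y/\<V>\<close> and its order.\<close>

definition ultrapower :: "'b::names setn \<Rightarrow> 'b setn setn \<Rightarrow> ('b \<times> nat) setn setn setn" where
  "ultrapower Y \<V> = (SetOf c. \<^bold>\<exists>h. power_fun Y h \<^bold>\<and> c \<^bold>= ult_class Y \<V> h)"

definition ult_le ::
  "'b::names setn \<Rightarrow> 'b setn setn \<Rightarrow> ('b \<times> nat) setn setn \<Rightarrow> ('b \<times> nat) setn setn \<Rightarrow> sentence" where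
  "ult_le Y \<V> c d =
     (\<^bold>\<exists>h h'. power_fun Y h \<^bold>\<and> power_fun Y h' \<^bold>\<and>
        c \<^bold>= ult_class Y \<V> h \<^bold>\<and> d \<^bold>= ult_class Y \<V> h' \<^bold>\<and>
        (SetOf y. y \<^bold>\<in> Y \<^bold>\<and> (\<^bold>\<exists>m n. (y, m) \<^bold>\<in> h \<^bold>\<and> (y, n) \<^bold>\<in> h' \<^bold>\<and> \<^bold>\<langle>m \<le> n\<^bold>\<rangle>)) \<^bold>\<in> \<V>)"

definition const_classes :: "'b::names setn \<Rightarrow> 'b setn setn \<Rightarrow> ('b \<times> nat) setn setn setn" where
  "const_classes Y \<V> =
     (SetOf c. \<^bold>\<exists>n. c \<^bold>= ult_class Y \<V> (SetOf z. fst z \<^bold>\<in> Y \<^bold>\<and> \<^bold>\<langle>snd z = n\<^bold>\<rangle>))"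

definition dedekind_cut ::
  "'b::names setn \<Rightarrow> 'b setn setn \<Rightarrow> ('b \<times> nat) setn setn setn \<Rightarrow> ('b \<times> nat) setn setn setn \<Rightarrow> sentence" where
  "dedekind_cut Y \<V> S L =
     (S \<^bold>\<subseteq> ultrapower Y \<V> \<^bold>\<and> L \<^bold>= ultrapower Y \<V> \<^bold>- S \<^bold>\<and>
      (\<^bold>\<forall>l s. l \<^bold>\<in> L \<^bold>\<and> s \<^bold>\<in> S \<^bold>\<longrightarrow> \<^bold>\<not>ult_le Y \<V> l s))"

definition proper_cut ::
  "'b::names setn \<Rightarrow> 'b setn setn \<Rightarrow> ('b \<times> nat) setn setn setn \<Rightarrow> ('b \<times> nat) setn setn setn \<Rightarrow> sentence" where
  "proper_cut Y \<V> S L =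
     (dedekind_cut Y \<V> S L \<^bold>\<and> (\<^bold>\<exists>l. l \<^bold>\<in> L) \<^bold>\<and> const_classes Y \<V> \<^bold>\<subseteq> S)"

definition standard_cut ::
  "'b::names setn \<Rightarrow> 'b setn setn \<Rightarrow> ('b \<times> nat) setn setn setn \<Rightarrow> ('b \<times> nat) setn setn setn \<Rightarrow> sentence" where
  "standard_cut Y \<V> S L = (dedekind_cut Y \<V> S L \<^bold>\<and> S \<^bold>= const_classes Y \<V>)"

definition fibre :: "('a::names \<times> 'b::names) setn \<Rightarrow> 'a setn \<Rightarrow> 'b \<Rightarrow> 'a setn" where
  "fibre g A y = (SetOf x. x \<^bold>\<in> A \<^bold>\<and> (x, y) \<^bold>\<in> g)"

text \<open>The function \<open>C\<^sub>A\<close>; it is total on \<open>Y\<close> iff all fibres of \<open>g\<close> in \<open>A\<close> are finite.\<close>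

definition fibre_count ::
  "('a::names \<times> 'b::names) setn \<Rightarrow> 'b setn \<Rightarrow> 'a setn \<Rightarrow> ('b \<times> nat) setn" where
  "fibre_count g Y A = (SetOf z. fst z \<^bold>\<in> Y \<^bold>\<and> has_card (fibre g A (fst z)) (snd z))"

text \<open>\<open>(S, L)\<close> is the cut in \<open>\<omega>\<^sup>Y/g(\<U>)\<close> associated to \<open>g\<close> and \<open>\<U>\<close>.\<close>

definition associated_cut ::
  "('a::names \<times> 'b::names) setn \<Rightarrow> 'b setn \<Rightarrow> 'a setn setn \<Rightarrow>
   ('b \<times> nat) setn setn setn \<Rightarrow> ('b \<times> nat) setn setn setn \<Rightarrow> sentence" where
  "associated_cut g Y \<U> S L =
     (L \<^bold>= (SetOf c. c \<^bold>\<in> ultrapower Y (image_filter g Y \<U>) \<^bold>\<and>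
             (\<^bold>\<exists>A. A \<^bold>\<in> \<U> \<^bold>\<and> (\<^bold>\<forall>y. y \<^bold>\<in> Y \<^bold>\<longrightarrow> fin (fibre g A y)) \<^bold>\<and>
                  ult_le Y (image_filter g Y \<U>)
                    (ult_class Y (image_filter g Y \<U>) (fibre_count g Y A)) c)) \<^bold>\<and>
      S \<^bold>= ultrapower Y (image_filter g Y \<U>) \<^bold>- L)"

subsection \<open>The space \<open>R\<^sub>1\<close> of the generic extension, and ultrafilters Ramsey for it\<close>

definition f_R1_witness :: "(nat \<times> nat) setn \<Rightarrow> nat list setn \<Rightarrow> sentence" where
  "f_R1_witness k S =
     (S \<^bold>\<subseteq> check T1 \<^bold>\<and> (\<^bold>\<forall>s n. s \<^bold>\<in> S \<^bold>\<longrightarrow> take n s \<^bold>\<in> S) \<^bold>\<and>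
      func k omega omega \<^bold>\<and>
      (\<^bold>\<forall>i j m n. (i, m) \<^bold>\<in> k \<^bold>\<and> (j, n) \<^bold>\<in> k \<^bold>\<and> \<^bold>\<langle>i < j\<^bold>\<rangle> \<^bold>\<longrightarrow> \<^bold>\<langle>m < n\<^bold>\<rangle>) \<^bold>\<and>
      (\<^bold>\<forall>i m. (i, m) \<^bold>\<in> k \<^bold>\<longrightarrow> [] \<^bold>\<in> S \<^bold>\<and> [m] \<^bold>\<in> S \<^bold>\<and>
         has_card (SetOf s. s \<^bold>\<in> S \<^bold>\<inter> check (T1_tree m) \<^bold>\<and> \<^bold>\<langle>length s = 2\<^bold>\<rangle>) (i + 1)) \<^bold>\<and>
      (\<^bold>\<forall>m. \<^bold>\<not>(S \<^bold>\<inter> check (T1_tree m) \<^bold>= check {[]}) \<^bold>\<longrightarrow> (\<^bold>\<exists>i. (i, m) \<^bold>\<in> k)))"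

definition f_R1 :: "nat list setn setn" where
  "f_R1 = (SetOf S. \<^bold>\<exists>k. f_R1_witness k S)"

definition f_r_approx :: "(nat \<times> nat) setn \<Rightarrow> nat \<Rightarrow> nat list setn \<Rightarrow> nat list setn" where
  "f_r_approx k i S =
     (SetOf s. s \<^bold>\<in> S \<^bold>\<and> (\<^bold>\<exists>j m. \<^bold>\<langle>j < i\<^bold>\<rangle> \<^bold>\<and> (j, m) \<^bold>\<in> k \<^bold>\<and> s \<^bold>\<in> check (T1_tree m)))"

definition f_AR :: "nat \<Rightarrow> nat list setn setn" where
  "f_AR i = (SetOf a. \<^bold>\<exists>k S. f_R1_witness k S \<^bold>\<and> a \<^bold>= f_r_approx k i S)"

text \<open>The set \<open>[S]\<close> of the nodes of length two.\<close>

definition tips :: "nat list setn \<Rightarrow> nat list setn" where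
  "tips S = (SetOf s. s \<^bold>\<in> S \<^bold>\<and> \<^bold>\<langle>length s = 2\<^bold>\<rangle>)"

definition generated_by :: "nat list setn setn \<Rightarrow> nat list setn setn \<Rightarrow> sentence" where
  "generated_by \<U> \<C> = (\<C> \<^bold>\<subseteq> f_R1 \<^bold>\<and> cofinal (SetOf A. \<^bold>\<exists>S. S \<^bold>\<in> \<C> \<^bold>\<and> A \<^bold>= tips S) \<U>)"

text \<open>A 2-partition of \<open>AR\<^sub>i\<close> is given by one of its parts \<open>P\<close>.\<close>

definition ramsey_for_R1 :: "nat list setn setn \<Rightarrow> sentence" where
  "ramsey_for_R1 \<U> =
     (ultrafilter (tips (check T1)) \<U> \<^bold>\<and>
      (\<^bold>\<exists>\<C>. generated_by \<U> \<C> \<^bold>\<and>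
        (\<^bold>\<forall>i P. P \<^bold>\<subseteq> f_AR i \<^bold>\<longrightarrow>
          (\<^bold>\<exists>S. S \<^bold>\<in> \<C> \<^bold>\<and>
            ((\<^bold>\<forall>a. a \<^bold>\<in> f_AR i \<^bold>\<and> a \<^bold>\<subseteq> S \<^bold>\<longrightarrow> a \<^bold>\<in> P) \<^bold>\<or>
             (\<^bold>\<forall>a. a \<^bold>\<in> f_AR i \<^bold>\<and> a \<^bold>\<subseteq> S \<^bold>\<longrightarrow> \<^bold>\<not>(a \<^bold>\<in> P)))))))"

end

theory Submission
  imports Defs
begin

text \<open>
  Two properties of the generic ultrafilter \<open>\<U>\<^sub>1\<close> matter: the fusion lemma for \<open>R\<^sub>1\<close>, and that every
  element of \<open>\<U>\<^sub>1\<close> contains the tips of some tree in the generic filter.  Together they say that \<open>\<U>\<^sub>1\<close>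
  is a rapid p-point, and rapidity passes to \<open>\<Y> \<le>\<^sub>T \<U>\<^sub>1\<close>: a Tukey map is monotone
  up to passing to subsets, and by fusion there is a tree \<open>q\<close> such that, for \<open>r \<subseteq> q\<close>, the part of the
  image of \<open>r\<close> in the \<open>n\<close>-th of given finite blocks is controlled by the first \<open>n + 1\<close> levels of \<open>r\<close>.
  These leave at most \<open>2\<^bsup>(n + 1)\<^sup>2\<^esup>\<close> cases.  Selecting one point of the block for each case
  gives a set that meets the image of every \<open>r \<subseteq> q\<close>, hence is in \<open>\<Y>\<close>, and has at most
  \<open>2\<^bsup>(n + 1)\<^sup>2\<^esup>\<close> points in the \<open>n\<close>-th block.

  If \<open>h\<close> is not constant modulo \<open>\<V>\<close>, the p-point property of \<open>\<Y>\<close> makes the sets \<open>{x. h (g x) = m}\<close>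
  finite on a set in \<open>\<Y>\<close>.  Grouping them into blocks sufficiently slowly yields \<open>A \<in> \<Y>\<close> with
  \<open>C\<^sub>A \<le> h\<close>, so the class of \<open>h\<close> is in \<open>L\<close>.
\<close>

section \<open>Fusion in the ground model\<close>

text \<open>No generic filter is ever fixed: an object of \<open>V[G]\<close> enters only through
  its names, and a forced existential has witnesses only at stronger conditions. The combinatorial
  core is therefore stated for an abstract predicate \<open>J q D i\<close> on conditions, sets of
  leaves and indices, about which only two things are known: it is stable in \<open>q\<close> and
  increasing in \<open>D\<close>. A Tukey map need not be monotone; asking for some set of the
  ultrafilter inside \<open>D\<close> whose image meets point \<open>i\<close> makes
  \<open>J\<close> increasing in \<open>D\<close> all the same. The obstacle is that the order sees
  a tree only up to finitely many levels, whereas \<open>J\<close> depends on all leaves. Hence the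
  stems: the finitely many possible initial parts are treated one by one, and the tail is kept
  inside a condition that has settled all of them. The constant comes from the shape of the trees:
  level \<open>i\<close> has \<open>i + 1\<close> leaves, so levels 0 to \<open>n\<close> have at
  most \<open>(n + 1)^2\<close> leaves, and a stem is a subset of these. Indices and blocks must be
  ground-model objects; closure of the order under countable sequences, itself a consequence of
  fusion, provides them.\<close>

definition leaves :: "nat list set" where
  "leaves = {s \<in> T1. length s = 2}"

text \<open>Ground-model counterpart of \<open>tips\<close>. By \<open>le_cond_iff\<close> these
  sets determine the order on conditions, so inner nodes can be forgotten.\<close>

definition ctips :: "cond \<Rightarrow> nat list set" where
  "ctips p = {s \<in> Rep_cond p. length s = 2}"

lemma leaves_hd: "s \<in> leaves \<Longrightarrow> s \<in> T1_tree m \<longleftrightarrow> hd s = m"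
  by (auto simp: leaves_def T1_def T1_tree_def)

lemma finite_leaves_below: "finite {s \<in> leaves. hd s \<le> n}"
proof -
  have "{s \<in> leaves. hd s \<le> n} \<subseteq> (\<lambda>(i, j). [i, j]) ` ({..n} \<times> {..(n + 1) * (n + 2)})"
  proof
    fix s assume "s \<in> {s \<in> leaves. hd s \<le> n}"
    then obtain i j where s: "s = [i, j]" "2 * j < (i + 1) * (i + 2)" "i \<le> n"
      by (auto simp: leaves_def T1_def T1_tree_def)
    have "(i + 1) * (i + 2) \<le> (n + 1) * (n + 2)" using s(3) by (intro mult_le_mono) auto
    with s show "s \<in> (\<lambda>(i, j). [i, j]) ` ({..n} \<times> {..(n + 1) * (n + 2)})" by force
  qed
  then show ?thesis by (rule finite_subset) auto
qed

section \<open>Conditions as sets of leaves\<close>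

lemma R1_witness_cond: "\<exists>k. R1_witness k (Rep_cond p)"
  using Rep_cond[of p] by (simp add: R1_def)

lemma ctips_leaves: "ctips p \<subseteq> leaves"
  using R1_witness_cond[of p] by (auto simp: ctips_def leaves_def R1_witness_def)

lemma R1_witness_level:
  assumes "R1_witness k (Rep_cond p)" "s \<in> ctips p"
  shows "\<exists>i. hd s = k i"
proof -
  have "s \<in> leaves" using assms(2) ctips_leaves by auto
  then have "s \<in> Rep_cond p \<inter> T1_tree (hd s)" "s \<noteq> []"
    using assms(2) leaves_hd by (auto simp: ctips_def)
  then have "Rep_cond p \<inter> T1_tree (hd s) \<noteq> {[]}" by auto
  then show ?thesis using assms(1) by (auto simp: R1_witness_def)
qed

lemma R1_witness_block:
  assumes "R1_witness k (Rep_cond p)"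
  shows "card {s \<in> ctips p. hd s = k i} = i + 1"
proof -
  have "{s \<in> ctips p. hd s = k i} = {s \<in> Rep_cond p \<inter> T1_tree (k i). length s = 2}"
    using ctips_leaves[of p] leaves_hd by (auto simp: ctips_def)
  with assms show ?thesis by (simp add: R1_witness_def)
qed

text \<open>Removing levels by index or by label amounts to the same, since \<open>k\<close> is
  strictly increasing and \<open>n \<le> k n\<close>. An inner node \<open>[k i]\<close> needs its
  own argument: its level carries \<open>i + 1 > 0\<close> leaves, which belong to \<open>p\<close>,
  and trees are closed under initial segments.\<close>

lemma le_cond_iff: "q \<le> p \<longleftrightarrow> (\<exists>n. \<forall>s\<in>ctips q. n < hd s \<longrightarrow> s \<in> ctips p)"
proof
  assume "q \<le> p"
  then obtain k i where k: "R1_witness k (Rep_cond q)"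
    and sub: "Rep_cond q - r_approx k i (Rep_cond q) \<subseteq> Rep_cond p"
    by (auto simp: less_eq_cond_def le_star_def)
  have mono: "strict_mono k" using k by (simp add: R1_witness_def)
  have "s \<in> ctips p" if s: "s \<in> ctips q" "k i < hd s" for s
  proof -
    have "s \<notin> r_approx k i (Rep_cond q)"
    proof
      assume "s \<in> r_approx k i (Rep_cond q)"
      then obtain j where "j < i" "hd s = k j"
        using s ctips_leaves leaves_hd by (force simp: r_approx_def)
      with s(2) mono show False by (simp add: strict_mono_less)
    qed
    with s(1) sub show ?thesis by (auto simp: ctips_def)
  qed
  then show "\<exists>n. \<forall>s\<in>ctips q. n < hd s \<longrightarrow> s \<in> ctips p" by auto
next
  assume "\<exists>n. \<forall>s\<in>ctips q. n < hd s \<longrightarrow> s \<in> ctips p"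
  then obtain n where n: "\<And>s. s \<in> ctips q \<Longrightarrow> n < hd s \<Longrightarrow> s \<in> ctips p" by auto
  obtain k where k: "R1_witness k (Rep_cond q)" using R1_witness_cond by auto
  obtain l where l: "R1_witness l (Rep_cond p)" using R1_witness_cond by auto
  have mono: "strict_mono k" using k by (simp add: R1_witness_def)
  \<comment> \<open>\<open>Suc n\<close> removes the indices 0 to \<open>n\<close>, so a remaining
    index \<open>i\<close> exceeds \<open>n\<close>, and so does its label
    \<open>k i \<ge> i\<close>.\<close>
  have "s \<in> Rep_cond p" if s: "s \<in> Rep_cond q" "s \<notin> r_approx k (Suc n) (Rep_cond q)" for s
  proof -
    obtain m where m: "s \<in> T1_tree m" using k s(1) by (auto simp: R1_witness_def T1_def)
    show ?thesis
    proof (cases "s = []")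
      case True
      then show ?thesis using l by (simp add: R1_witness_def)
    next
      case False
      then have "Rep_cond q \<inter> T1_tree m \<noteq> {[]}" using s m by auto
      then obtain i where i: "m = k i" using k unfolding R1_witness_def by blast
      have "n < i"
        using s m i by (force simp: r_approx_def)
      also have "i \<le> k i" using mono by (simp add: strict_mono_imp_increasing)
      finally have nk: "n < k i" .
      have block: "s' \<in> Rep_cond p" if "s' \<in> ctips q" "hd s' = k i" for s'
        using n[OF that(1)] that(2) nk by (simp add: ctips_def)
      from m False i consider "s = [k i]" | "length s = 2"
        by (auto simp: T1_tree_def)
      then show ?thesis
      proof cases
        case 1
        have "{s \<in> ctips q. hd s = k i} \<noteq> {}"
          using R1_witness_block[OF k, of i] by (metis Suc_eq_plus1 card.empty nat.distinct(1))
        then obtain s' where s': "s' \<in> ctips q" "hd s' = k i" by auto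
        have "take 1 s' \<in> Rep_cond p"
          using block[OF s'] l by (auto simp: R1_witness_def)
        moreover have "take 1 s' = [k i]" using s' by (cases s') (auto simp: ctips_def)
        ultimately show ?thesis using 1 by simp
      next
        case 2
        then show ?thesis
          using block[of s] s m i False T1_tree_hd by (auto simp: ctips_def)
      qed
    qed
  qed
  then show "q \<le> p"
    using k unfolding less_eq_cond_def le_star_def by blast
qed

lemma le_cond_subset: "ctips q \<subseteq> ctips p \<Longrightarrow> q \<le> p"
  unfolding le_cond_iff by auto

text \<open>The only source of new conditions: a choice of \<open>i + 1\<close> leaves over each
  label \<open>k i\<close> becomes a tree of the space once the root and the nodes
  \<open>[k i]\<close> are added.\<close>

lemma cond_of_blocks:
  assumes k: "strict_mono k"
    and b: "\<And>i. b i \<subseteq> {s \<in> leaves. hd s = k i}" "\<And>i. card (b i) = i + 1"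
  shows "\<exists>q. R1_witness k (Rep_cond q) \<and> ctips q = (\<Union>i. b i)"
proof -
  define S where "S = {[]} \<union> range (\<lambda>i. [k i]) \<union> (\<Union>i. b i)"
  have b': "\<exists>j. s = [k i, j] \<and> s \<in> T1_tree (k i)" if "s \<in> b i" for s i
    using b(1)[of i] that by (auto simp: leaves_def T1_def T1_tree_def)
  have two: "{s \<in> S. length s = 2} = (\<Union>i. b i)"
    using b' by (fastforce simp: S_def)
  have "{s \<in> S \<inter> T1_tree (k i). length s = 2} = b i" for i
  proof -
    have "s \<in> b i" if "s \<in> b j" "s \<in> T1_tree (k i)" for s j
    proof -
      have "k j = k i" using b'[OF that(1)] that(2) by (auto simp: T1_tree_def)
      with k have "j = i" by (simp add: strict_mono_eq)
      with that show ?thesis by simp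
    qed
    moreover have "{s \<in> S \<inter> T1_tree (k i). length s = 2} = {s \<in> S. length s = 2} \<inter> T1_tree (k i)"
      by auto
    ultimately show ?thesis unfolding two using b' by auto
  qed
  then have card: "card {s \<in> S \<inter> T1_tree (k i). length s = 2} = i + 1" for i
    using b(2) by simp
  have "R1_witness k S"
    unfolding R1_witness_def card
  proof (intro conjI ballI allI impI)
    show "S \<subseteq> T1"
      using b' by (force simp: S_def T1_def T1_tree_def)
  next
    fix s n assume "s \<in> S"
    then consider "s = []" | i where "s = [k i]" | i where "s \<in> b i"
      by (auto simp: S_def)
    then show "take n s \<in> S"
    proof cases
      case (3 i)
      then obtain j where "s = [k i, j]" using b' by blast
      with 3 show ?thesis by (cases n; cases "n - 1") (auto simp: S_def)
    qed (auto simp: S_def take_Cons')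
  next
    fix m assume "S \<inter> T1_tree m \<noteq> {[]}"
    moreover have "[] \<in> S \<inter> T1_tree m" by (auto simp: S_def T1_tree_def)
    ultimately obtain s where s: "s \<in> S" "s \<in> T1_tree m" "s \<noteq> []" by auto
    then have "hd s = m" using T1_tree_hd by auto
    with s show "\<exists>i. m = k i" using b' by (force simp: S_def)
  qed (use k in \<open>auto simp: S_def\<close>)
  moreover from this have "Rep_cond (Abs_cond S) = S"
    by (intro Abs_cond_inverse) (auto simp: R1_def)
  ultimately have "R1_witness k (Rep_cond (Abs_cond S))" "ctips (Abs_cond S) = {s \<in> S. length s = 2}"
    by (simp_all add: ctips_def)
  with two show ?thesis by blast
qed

text \<open>Level \<open>i\<close> of \<open>q\<close> is cut out of level \<open>i + Suc n\<close>
  of \<open>p\<close>, which has enough leaves and a label above \<open>n\<close>.\<close>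

lemma ctips_above:
  "\<exists>q\<le>p. ctips q \<subseteq> {s \<in> ctips p. n < hd s}"
proof -
  obtain k where k: "R1_witness k (Rep_cond p)" using R1_witness_cond by auto
  have mono: "strict_mono k" using k by (simp add: R1_witness_def)
  have "\<exists>b \<subseteq> {s \<in> ctips p. hd s = k (i + Suc n)}. card b = i + 1" for i
    by (rule obtain_subset_with_card_n[of "i + 1" "{s \<in> ctips p. hd s = k (i + Suc n)}"])
       (auto simp: R1_witness_block[OF k])
  then obtain b where b: "\<And>i. b i \<subseteq> {s \<in> ctips p. hd s = k (i + Suc n)}" "\<And>i. card (b i) = i + 1"
    by metis
  have "\<exists>q. R1_witness (\<lambda>i. k (i + Suc n)) (Rep_cond q) \<and> ctips q = (\<Union>i. b i)"
    by (rule cond_of_blocks)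
       (use mono b ctips_leaves in \<open>fastforce simp: strict_mono_def\<close>)+
  then obtain q where q: "ctips q = (\<Union>i. b i)" by blast
  have "n < k (i + Suc n)" for i
    using strict_mono_imp_increasing[OF mono, of "i + Suc n"] by simp
  then have "ctips q \<subseteq> {s \<in> ctips p. n < hd s}" using b(1) unfolding q by fastforce
  moreover from this have "q \<le> p" by (intro le_cond_subset) auto
  ultimately show ?thesis by blast
qed

text \<open>Turns almost inclusion into inclusion at the price of a stronger condition, as is
  required whenever a predicate depends on the actual leaves.\<close>

lemma ctips_thin:
  assumes "q \<le> p"
  shows "\<exists>r\<le>q. ctips r \<subseteq> ctips q \<inter> ctips p"
proof -
  obtain n where n: "\<And>s. s \<in> ctips q \<Longrightarrow> n < hd s \<Longrightarrow> s \<in> ctips p"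
    using assms by (auto simp: le_cond_iff)
  obtain r where r: "r \<le> q" "ctips r \<subseteq> {s \<in> ctips q. n < hd s}" using ctips_above by blast
  then have "ctips r \<subseteq> ctips q \<inter> ctips p" using n by auto
  with r(1) show ?thesis by auto
qed

section \<open>Fusion and countable closure\<close>

lemma block_below:
  fixes P :: "nat \<Rightarrow> cond"
  assumes dec: "\<And>n. P (Suc n) \<le> P n"
  shows "\<exists>m b. n < m \<and> card b = Suc i \<and> b \<subseteq> {s \<in> leaves. hd s = m} \<and> (\<forall>l\<le>N. b \<subseteq> ctips (P l))"
proof -
  have "P N \<le> P l" if "l \<le> N" for l
    using that by (induction rule: dec_induct) (auto intro: order_refl order_trans dec)
  then have "\<forall>l\<in>{..N}. \<exists>M. \<forall>s\<in>ctips (P N). M < hd s \<longrightarrow> s \<in> ctips (P l)"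
    by (auto simp: le_cond_iff)
  then obtain M where M: "\<And>l s. l \<le> N \<Longrightarrow> s \<in> ctips (P N) \<Longrightarrow> M l < hd s \<Longrightarrow> s \<in> ctips (P l)"
    by (metis atMost_iff)
  define M' where "M' = Max (M ` {..N})"
  obtain k where k: "R1_witness k (Rep_cond (P N))" using R1_witness_cond by auto
  \<comment> \<open>The index is at least \<open>i\<close>, so the level has at least
    \<open>Suc i\<close> leaves; its label exceeds \<open>n\<close> and all bounds
    \<open>M l\<close> for \<open>l \<le> N\<close>, beyond which the leaves of \<open>P N\<close>
    lie in every \<open>P l\<close>.\<close>
  define m where "m = k (i + n + M' + 1)"
  have "i + n + M' + 1 \<le> m"
    unfolding m_def using k by (auto simp: R1_witness_def intro: strict_mono_imp_increasing)
  moreover have "M l \<le> M'" if "l \<le> N" for l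
    unfolding M'_def using that by (intro Max_ge) auto
  ultimately have big: "n < m" "\<And>l. l \<le> N \<Longrightarrow> M l < m"
    by force+
  have "\<exists>b \<subseteq> {s \<in> ctips (P N). hd s = m}. card b = Suc i"
    by (rule obtain_subset_with_card_n[of "Suc i" "{s \<in> ctips (P N). hd s = m}"])
       (auto simp: m_def R1_witness_block[OF k])
  then obtain b where b: "b \<subseteq> {s \<in> ctips (P N). hd s = m}" "card b = Suc i" by blast
  moreover have "b \<subseteq> ctips (P l)" if "l \<le> N" for l
    using b(1) M[OF that] big(2)[OF that] by auto
  moreover have "b \<subseteq> {s \<in> leaves. hd s = m}" using b(1) ctips_leaves by blast
  ultimately show ?thesis using big(1) by blast
qed

text \<open>Block \<open>i + 1\<close> is taken inside all \<open>P l\<close> with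
  \<open>l \<le> Suc (k i)\<close>, where \<open>k i\<close> is the label of the block before.
  Bounding \<open>l\<close> by the label rather than by \<open>i\<close> gives the last conclusion:
  the part of \<open>q\<close> above label \<open>k n\<close> lies in \<open>P (Suc (k n))\<close>,
  the condition which in \<open>rapid_selection\<close> has settled all stems with labels up to
  \<open>k n\<close>.\<close>

lemma fusion:
  fixes P :: "nat \<Rightarrow> cond"
  assumes dec: "\<And>n. P (Suc n) \<le> P n"
  obtains q k where "R1_witness k (Rep_cond q)" "\<And>n. q \<le> P n"
    "\<And>n s. s \<in> ctips q \<Longrightarrow> k n < hd s \<Longrightarrow> s \<in> ctips (P (Suc (k n)))"
proof -
  have "\<exists>f. \<forall>i. (case f i of (m, b) \<Rightarrow> card b = Suc i \<and> b \<subseteq> {s \<in> leaves. hd s = m}) \<and>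
      (case (f i, f (Suc i)) of ((m, b), (m', b')) \<Rightarrow> m < m' \<and> (\<forall>l\<le>Suc m. b' \<subseteq> ctips (P l)))"
  proof (rule dependent_nat_choice)
    show "\<exists>x. case x of (m, b) \<Rightarrow> card b = Suc 0 \<and> b \<subseteq> {s \<in> leaves. hd s = m}"
      using block_below[where P = P and n = 0 and i = 0 and N = 0, OF dec] by fast
  next
    fix x :: "nat \<times> nat list set" and i
    obtain m b where x: "x = (m, b)" by fastforce
    show "\<exists>y. (case y of (m, b) \<Rightarrow> card b = Suc (Suc i) \<and> b \<subseteq> {s \<in> leaves. hd s = m}) \<and>
        (case (x, y) of ((m, b), (m', b')) \<Rightarrow> m < m' \<and> (\<forall>l\<le>Suc m. b' \<subseteq> ctips (P l)))"
      using block_below[where P = P and i = "Suc i" and n = m and N = "Suc m", OF dec]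
      unfolding x by fast
  qed
  then obtain f where f: "\<And>i. case f i of (m, b) \<Rightarrow> card b = Suc i \<and> b \<subseteq> {s \<in> leaves. hd s = m}"
    "\<And>i. case (f i, f (Suc i)) of ((m, b), (m', b')) \<Rightarrow> m < m' \<and> (\<forall>l\<le>Suc m. b' \<subseteq> ctips (P l))"
    by (auto simp only: all_conj_distrib)
  define k b where "k i = fst (f i)" and "b i = snd (f i)" for i
  have b: "card (b i) = i + 1" "b i \<subseteq> {s \<in> leaves. hd s = k i}" for i
    using f(1)[of i] by (auto simp: k_def b_def split: prod.splits)
  have kb: "k i < k (Suc i)" "\<And>l. l \<le> Suc (k i) \<Longrightarrow> b (Suc i) \<subseteq> ctips (P l)" for i
    using f(2)[of i] by (auto simp: k_def b_def split: prod.splits)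
  have mono: "strict_mono k" using kb(1) by (simp add: strict_mono_Suc_iff)
  obtain q where q: "R1_witness k (Rep_cond q)" "ctips q = (\<Union>i. b i)"
    using cond_of_blocks[OF mono b(2) b(1)] by blast
  \<comment> \<open>A leaf above label \<open>k n\<close> is in a block \<open>Suc j'\<close> with
    \<open>n \<le> j'\<close>. That block lies in \<open>P l\<close> for all
    \<open>l \<le> Suc (k j')\<close>, in particular for all
    \<open>l \<le> Suc (k n)\<close>.\<close>
  have above: "s \<in> ctips (P l)" if s: "s \<in> ctips q" "k n < hd s" and l: "l \<le> Suc (k n)" for n s l
  proof -
    obtain j where j: "s \<in> b j" using q(2) s(1) by auto
    then have "k n < k j" using b(2)[of j] s(2) by auto
    then have "n < j" using mono by (simp add: strict_mono_less)
    then obtain j' where j': "j = Suc j'" "n \<le> j'" by (cases j) auto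
    have "k n \<le> k j'" using mono j' by (simp add: strict_mono_less_eq)
    with kb(2)[of l j'] j j' l show ?thesis by auto
  qed
  have "q \<le> P n" for n
    unfolding le_cond_iff
    using above[where n = n and l = n] strict_mono_imp_increasing[OF mono, of n] by auto
  then show ?thesis using that[OF q(1)] above[OF _ _ order_refl] by blast
qed

text \<open>Countable closure of the order, as the meeting of countably many open dense sets by a
  single condition. It brings a function on the natural numbers, whose values are forced one at a
  time, back into the ground model.\<close>

lemma decide_countable:
  fixes \<Theta> :: "nat \<Rightarrow> cond \<Rightarrow> bool"
  assumes mono: "\<And>n p q. \<Theta> n p \<Longrightarrow> q \<le> p \<Longrightarrow> \<Theta> n q"
    and dense: "\<And>n q. q \<le> p \<Longrightarrow> \<exists>r\<le>q. \<Theta> n r"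
  shows "\<exists>q\<le>p. \<forall>n. \<Theta> n q"
proof -
  have "\<exists>P. \<forall>n. P n \<le> p \<and> (P (Suc n) \<le> P n \<and> \<Theta> n (P (Suc n)))"
  proof (rule dependent_nat_choice)
    fix x n assume "x \<le> p"
    with dense obtain r where "r \<le> x" "\<Theta> n r" by blast
    with order_trans[OF \<open>r \<le> x\<close> \<open>x \<le> p\<close>] show "\<exists>y. y \<le> p \<and> (y \<le> x \<and> \<Theta> n y)" by blast
  qed (use order_refl in blast)
  then obtain P where "\<forall>n. P n \<le> p \<and> (P (Suc n) \<le> P n \<and> \<Theta> n (P (Suc n)))" ..
  then have P: "\<And>n. P n \<le> p" "\<And>n. P (Suc n) \<le> P n" "\<And>n. \<Theta> n (P (Suc n))"
    by auto
  obtain q where q: "\<And>n. q \<le> P n" using fusion[where P = P, OF P(2)] by metis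
  then have "q \<le> p" "\<And>n. \<Theta> n q" using order_trans[OF q P(1)] mono[OF P(3) q] by auto
  then show ?thesis by blast
qed

lemma decide_finite:
  fixes \<Theta> :: "'i \<Rightarrow> cond \<Rightarrow> bool"
  assumes "finite I"
    and mono: "\<And>i p q. \<Theta> i p \<Longrightarrow> q \<le> p \<Longrightarrow> \<Theta> i q"
    and dense: "\<And>i q. i \<in> I \<Longrightarrow> q \<le> p \<Longrightarrow> \<exists>r\<le>q. \<Theta> i r"
  shows "\<exists>q\<le>p. \<forall>i\<in>I. \<Theta> i q"
  using assms(1) dense
proof (induction I)
  case empty
  then show ?case using order_refl by blast
next
  case (insert i I)
  then obtain q where q: "q \<le> p" "\<forall>j\<in>I. \<Theta> j q" by auto
  with insert.prems[of i q] obtain r where r: "r \<le> q" "\<Theta> i r" by auto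
  then have "r \<le> p" "\<forall>j\<in>insert i I. \<Theta> j r" using order_trans[OF r(1) q(1)] q(2) mono by auto
  then show ?case by blast
qed

section \<open>Selecting few indices along a fusion\<close>

text \<open>Read \<open>J t A i\<close> as: \<open>t\<close> forces some set of the ultrafilter
  inside \<open>A\<close> to have an image meeting point \<open>i\<close>. If no
  \<open>q \<le> p\<close> excludes this for the stem \<open>s\<close>, then below every
  \<open>r \<le> p\<close> a thinned condition admits some \<open>t\<close> satisfying it, and
  monotonicity carries it over to the leaves of \<open>r\<close>. Such \<open>t\<close> are dense
  below \<open>r\<close>, so stability gives it at \<open>r\<close>. In the second case
  \<open>i\<close> is hit for the stem \<open>s\<close> whatever the tail of the tree is.\<close>

lemma dichotomy:
  fixes J :: "cond \<Rightarrow> nat list set \<Rightarrow> 'i \<Rightarrow> bool"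
  assumes stab: "\<And>A i. stable (\<lambda>q. J q A i)"
    and mono: "\<And>q A A' i. J q A i \<Longrightarrow> A \<subseteq> A' \<Longrightarrow> J q A' i"
  shows "\<exists>q\<le>p. (\<forall>t\<le>q. \<not> J t (s \<union> ctips q) i) \<or> (\<forall>r\<le>q. J r (s \<union> ctips r) i)"
proof (cases "\<exists>q\<le>p. \<forall>t\<le>q. \<not> J t (s \<union> ctips q) i")
  case False
  have "J r (s \<union> ctips r) i" if r: "r \<le> p" for r
  proof (rule stable_dense[OF stab])
    fix r' assume r': "r' \<le> r"
    then obtain r'' where r'': "r'' \<le> r'" "ctips r'' \<subseteq> ctips r" using ctips_thin by blast
    have "r'' \<le> p" using order_trans[OF order_trans[OF r''(1) r'] r] .
    with False obtain t where t: "t \<le> r''" "J t (s \<union> ctips r'') i" by blast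
    then have "J t (s \<union> ctips r) i" using r''(2) by (auto intro: mono)
    with order_trans[OF t(1) r''(1)] show "\<exists>r\<^sub>1\<le>r'. J r\<^sub>1 (s \<union> ctips r) i" by blast
  qed
  then show ?thesis using order_refl by blast
qed blast

text \<open>\<open>f\<close> is the block number of an index. \<open>B\<close> keeps one index for
  each block \<open>n\<close> and each stem \<open>s \<subseteq> K n\<close> for which some index of
  the block satisfies the second case of \<open>dichotomy\<close>. The choice does not depend on
  \<open>r\<close>: if some \<open>t \<le> r\<close> hits any index of the block, the first case
  fails for the stem of \<open>r\<close>, and then the index kept for that stem is hit too, already
  by \<open>r\<close> and not only by \<open>t\<close>.\<close>

lemma rapid_selection:
  fixes J :: "cond \<Rightarrow> nat list set \<Rightarrow> 'i \<Rightarrow> bool" and f :: "'i \<Rightarrow> nat"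
  assumes stab: "\<And>A i. stable (\<lambda>q. J q A i)"
    and mono: "\<And>q A A' i. J q A i \<Longrightarrow> A \<subseteq> A' \<Longrightarrow> J q A' i"
    and fin: "\<And>n. finite {i \<in> I. f i = n}"
  shows "\<exists>q\<le>p. \<exists>B\<subseteq>I. (\<forall>n. card {i \<in> B. f i = n} \<le> 2 ^ (Suc n * Suc n)) \<and>
    (\<forall>r\<le>q. \<forall>t\<le>r. \<forall>i\<in>I. ctips r \<subseteq> ctips q \<longrightarrow> J t (ctips r) i \<longrightarrow> (\<exists>i'\<in>B. J r (ctips r) i'))"
proof -
  define H where "H n = {s \<in> leaves. hd s \<le> n}" for n
  define good where "good s i q \<longleftrightarrow> (\<forall>t\<le>q. \<not> J t (s \<union> ctips q) i) \<or> (\<forall>r\<le>q. J r (s \<union> ctips r) i)" for s i q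
  \<comment> \<open>Exact inclusion of leaves is assumed because the first alternative mentions
    \<open>ctips q\<close>.\<close>
  have good_thin: "good s i q'" if "good s i q" "q' \<le> q" "ctips q' \<subseteq> ctips q" for s i q q'
  proof -
    have "J t (s \<union> ctips q) i" if "J t (s \<union> ctips q') i" for t
      using that by (rule mono) (use \<open>ctips q' \<subseteq> ctips q\<close> in auto)
    moreover have "t \<le> q" if "t \<le> q'" for t using order_trans[OF that \<open>q' \<le> q\<close>] .
    ultimately show ?thesis using \<open>good s i q\<close> unfolding good_def by blast
  qed
  \<comment> \<open>The levels of the final tree are not known yet, so the stems range over all sets
    of leaves with labels up to \<open>n\<close>. Block \<open>n\<close> will be looked up at stage
    \<open>k n\<close>, which may exceed \<open>n\<close>; hence \<open>f i \<le> n\<close> and not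
    \<open>f i = n\<close>.\<close>
  have step: "\<exists>q\<le>p. \<forall>s\<in>Pow (H n). \<forall>i\<in>{i \<in> I. f i \<le> n}. good s i q" for n p
  proof -
    have "{i \<in> I. f i \<le> n} = (\<Union>m\<le>n. {i \<in> I. f i = m})" by auto
    then have "finite (Pow (H n) \<times> {i \<in> I. f i \<le> n})"
      using finite_leaves_below fin by (simp add: H_def)
    then have "\<exists>q\<le>p. \<forall>x\<in>Pow (H n) \<times> {i \<in> I. f i \<le> n}. good (fst x) (snd x) q"
    proof (induction rule: finite_induct)
      case empty
      then show ?case using order_refl by blast
    next
      case (insert x F)
      then obtain q where q: "q \<le> p" "\<forall>x\<in>F. good (fst x) (snd x) q" by blast
      have "\<exists>q'\<le>q. good (fst x) (snd x) q'"
        unfolding good_def by (rule dichotomy) (rule stab, rule mono)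
      then obtain q' where q': "q' \<le> q" "good (fst x) (snd x) q'" by blast
      obtain q'' where q'': "q'' \<le> q'" "ctips q'' \<subseteq> ctips q' \<inter> ctips q" using ctips_thin[OF q'(1)] by blast
      have "q'' \<le> q" using order_trans[OF q''(1) q'(1)] .
      then have "\<forall>y\<in>F. good (fst y) (snd y) q''" using q(2) q''(2) good_thin by blast
      moreover have "good (fst x) (snd x) q''" using q'(2) q'' good_thin by blast
      ultimately have "\<forall>y\<in>insert x F. good (fst y) (snd y) q''" by simp
      moreover have "q'' \<le> p" using order_trans[OF \<open>q'' \<le> q\<close> q(1)] .
      ultimately show ?case by blast
    qed
    then show ?thesis by fastforce
  qed
  have "\<exists>P. \<forall>n. P n \<le> p \<and> (P (Suc n) \<le> P n \<and>
      (\<forall>s\<in>Pow (H n). \<forall>i\<in>{i \<in> I. f i \<le> n}. good s i (P (Suc n))))"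
  proof (rule dependent_nat_choice)
    fix x n assume "x \<le> p"
    moreover obtain y where y: "y \<le> x" "\<forall>s\<in>Pow (H n). \<forall>i\<in>{i \<in> I. f i \<le> n}. good s i y"
      using step by blast
    ultimately have "y \<le> p" using order_trans by metis
    with y show "\<exists>y. y \<le> p \<and> (y \<le> x \<and> (\<forall>s\<in>Pow (H n). \<forall>i\<in>{i \<in> I. f i \<le> n}. good s i y))"
      by blast
  qed (use order_refl in blast)
  then obtain P where P': "\<forall>n. P n \<le> p \<and> (P (Suc n) \<le> P n \<and>
      (\<forall>s\<in>Pow (H n). \<forall>i\<in>{i \<in> I. f i \<le> n}. good s i (P (Suc n))))" ..
  then have P: "\<And>n. P n \<le> p" "\<And>n. P (Suc n) \<le> P n"
    and good: "\<And>n s i. s \<subseteq> H n \<Longrightarrow> i \<in> I \<Longrightarrow> f i \<le> n \<Longrightarrow> good s i (P (Suc n))"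
    by auto
  obtain q k where k: "R1_witness k (Rep_cond q)" and le: "\<And>n. q \<le> P n"
    and above: "\<And>n s. s \<in> ctips q \<Longrightarrow> k n < hd s \<Longrightarrow> s \<in> ctips (P (Suc (k n)))"
    using fusion[where P = P, OF P(2)] by metis
  have mono_k: "strict_mono k" using k by (simp add: R1_witness_def)
  define K where "K n = ctips q \<inter> H (k n)" for n
  have card_K: "finite (K n)" "card (K n) \<le> Suc n * Suc n" for n
  proof -
    show "finite (K n)" using finite_leaves_below by (simp add: K_def H_def)
    have "K n \<subseteq> (\<Union>i\<le>n. {s \<in> ctips q. hd s = k i})"
    proof
      fix s assume s: "s \<in> K n"
      then obtain i where "hd s = k i" using R1_witness_level[OF k] by (auto simp: K_def)
      with s mono_k show "s \<in> (\<Union>i\<le>n. {s \<in> ctips q. hd s = k i})"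
        by (auto simp: K_def H_def strict_mono_less_eq)
    qed
    moreover have "finite (\<Union>i\<le>n. {s \<in> ctips q. hd s = k i})"
      using R1_witness_block[OF k] by (auto intro: card_ge_0_finite)
    ultimately have "card (K n) \<le> card (\<Union>i\<le>n. {s \<in> ctips q. hd s = k i})"
      by (rule card_mono[rotated])
    also have "\<dots> \<le> (\<Sum>i\<le>n. card {s \<in> ctips q. hd s = k i})"
      by (rule card_UN_le) auto
    \<comment> \<open>Level \<open>i\<close> has exactly \<open>i + 1\<close> leaves, rounded up to
      \<open>Suc n\<close>; this is the square in the exponent.\<close>
    also have "\<dots> \<le> (\<Sum>i\<le>n. Suc n)"
      by (rule sum_mono) (simp add: R1_witness_block[OF k])
    finally show "card (K n) \<le> Suc n * Suc n" by simp
  qed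
  define \<Psi> where "\<Psi> n s i \<longleftrightarrow> i \<in> I \<and> f i = n \<and> (\<forall>r\<le>q. J r (s \<union> ctips r) i)" for n s i
  define B where "B = {(SOME i. \<Psi> n s i) |n s. s \<subseteq> K n \<and> (\<exists>i. \<Psi> n s i)}"
  show ?thesis
  proof (intro exI[of _ q] exI[of _ B] conjI allI impI ballI)
    show "q \<le> p" using order_trans[OF le P(1)] .
    show "B \<subseteq> I"
    proof
      fix i assume "i \<in> B"
      then obtain m s where s: "i = (SOME i. \<Psi> m s i)" "\<exists>i. \<Psi> m s i"
        unfolding B_def by blast
      then have "\<Psi> m s i" using someI_ex[OF s(2)] by simp
      then show "i \<in> I" by (simp add: \<Psi>_def)
    qed
  next
    fix n
    have "{i \<in> B. f i = n} \<subseteq> (\<lambda>s. SOME i. \<Psi> n s i) ` Pow (K n)"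
    proof
      fix i assume i: "i \<in> {i \<in> B. f i = n}"
      then obtain m s where s: "i = (SOME i. \<Psi> m s i)" "s \<subseteq> K m" "\<exists>i. \<Psi> m s i"
        unfolding B_def by blast
      then have "\<Psi> m s i" using someI_ex[OF s(3)] by simp
      with i have "m = n" by (simp add: \<Psi>_def)
      with s show "i \<in> (\<lambda>s. SOME i. \<Psi> n s i) ` Pow (K n)" by blast
    qed
    then have "card {i \<in> B. f i = n} \<le> card (Pow (K n))"
      using card_K(1) by (intro surj_card_le) auto
    also have "\<dots> \<le> 2 ^ (Suc n * Suc n)"
      unfolding card_Pow[OF card_K(1)] by (rule power_increasing[OF card_K(2)]) simp
    finally show "card {i \<in> B. f i = n} \<le> 2 ^ (Suc n * Suc n)" .
  next
    fix r t i
    assume r: "r \<le> q" "ctips r \<subseteq> ctips q" and t: "t \<le> r" and i: "i \<in> I" and J: "J t (ctips r) i"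
    define n where "n = f i"
    define s where "s = ctips r \<inter> H (k n)"
    have "n \<le> k n" using mono_k by (rule strict_mono_imp_increasing)
    then have "good s i (P (Suc (k n)))"
      using good[of s "k n" i] i by (auto simp: s_def n_def)
    \<comment> \<open>Leaves of \<open>r\<close> with labels up to \<open>k n\<close> form the stem
      \<open>s\<close>, and the others lie in \<open>P (Suc (k n))\<close> by the fusion. So the hit
      at \<open>t\<close> refutes the first alternative at that condition.\<close>
    moreover have "J t (s \<union> ctips (P (Suc (k n)))) i"
    proof (rule mono[OF J], rule)
      fix u assume u: "u \<in> ctips r"
      show "u \<in> s \<union> ctips (P (Suc (k n)))"
        using u r(2) above[of u n] ctips_leaves[of r] by (cases "k n < hd u") (auto simp: s_def H_def)
    qed
    moreover have "t \<le> P (Suc (k n))" using order_trans[OF order_trans[OF t r(1)] le] .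
    moreover have "u \<le> P (Suc (k n))" if "u \<le> q" for u using order_trans[OF that le] .
    ultimately have "\<forall>r\<le>q. J r (s \<union> ctips r) i"
      unfolding good_def by blast
    then have ex: "\<exists>i. \<Psi> n s i" using i by (auto simp: \<Psi>_def n_def)
    moreover have "s \<subseteq> K n" using r(2) by (auto simp: s_def K_def)
    ultimately have "(SOME i. \<Psi> n s i) \<in> B" unfolding B_def by blast
    moreover have "J r (s \<union> ctips r) (SOME i. \<Psi> n s i)"
      using someI_ex[OF ex] r(1) by (simp add: \<Psi>_def)
    moreover have "s \<union> ctips r = ctips r" by (auto simp: s_def)
    ultimately show "\<exists>i'\<in>B. J r (ctips r) i'" by auto
  qed
qed

section \<open>The forcing relation\<close>

lemma f_and_iff: "(\<phi> \<^bold>\<and> \<psi>) p \<longleftrightarrow> \<phi> p \<and> \<psi> p"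
  by (simp add: f_and_def)

lemma f_not_iff: "(\<^bold>\<not>\<phi>) p \<longleftrightarrow> (\<forall>q\<le>p. \<not> \<phi> q)"
  by (simp add: f_not_def)

lemma f_all_iff: "(\<^bold>\<forall>x. \<phi> x) p \<longleftrightarrow> (\<forall>x. \<phi> x p)"
  by (simp add: f_all_def)

lemma f_or_iff: "(\<phi> \<^bold>\<or> \<psi>) p \<longleftrightarrow> (\<forall>q\<le>p. \<exists>r\<le>q. \<phi> r \<or> \<psi> r)"
  by (auto simp: f_or_def f_not_def f_and_def)

lemma f_ex_iff: "(\<^bold>\<exists>x. \<phi> x) p \<longleftrightarrow> (\<forall>q\<le>p. \<exists>r\<le>q. \<exists>x. \<phi> x r)"
  unfolding f_ex_def f_not_def f_all_def by blast

lemma lift_iff [simp]: "\<^bold>\<langle>b\<^bold>\<rangle> p \<longleftrightarrow> b"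
  by (simp add: lift_def)

lemma f_iff_iff: "stable \<phi> \<Longrightarrow> stable \<psi> \<Longrightarrow> (\<phi> \<^bold>\<longleftrightarrow> \<psi>) p \<longleftrightarrow> (\<forall>q\<le>p. \<phi> q \<longleftrightarrow> \<psi> q)"
  by (auto simp: f_iff_def f_and_iff f_imp_iff)

lemma stable_or: "stable \<phi> \<Longrightarrow> stable \<psi> \<Longrightarrow> stable (\<phi> \<^bold>\<or> \<psi>)"
  unfolding f_or_def by (intro stable_not stable_and)

lemma stable_imp: "stable \<phi> \<Longrightarrow> stable \<psi> \<Longrightarrow> stable (\<phi> \<^bold>\<longrightarrow> \<psi>)"
  unfolding f_imp_def by (intro stable_not stable_and)

lemma stable_ex: "(\<And>x. stable (\<phi> x)) \<Longrightarrow> stable (\<^bold>\<exists>x. \<phi> x)"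
  unfolding f_ex_def by (intro stable_not stable_all)

declare stable_lift [simp] stable_not [simp] stable_and [simp] stable_all [simp] stable_or [simp]
  stable_imp [simp] stable_ex [simp] stable_mem [simp] stable_eq [simp] eq_refl [simp]

lemmas mem_lower = stable_mono[OF stable_mem]
lemmas eq_lower = stable_mono[OF stable_eq]

lemma not_lower: "(\<^bold>\<not>\<phi>) p \<Longrightarrow> q \<le> p \<Longrightarrow> (\<^bold>\<not>\<phi>) q"
  unfolding f_not_def using order_trans by blast

lemma ex_lower: "(\<^bold>\<exists>x. \<phi> x) p \<Longrightarrow> q \<le> p \<Longrightarrow> (\<^bold>\<exists>x. \<phi> x) q"
  unfolding f_ex_def by (rule not_lower)

lemma f_exI: "\<phi> x p \<Longrightarrow> stable (\<phi> x) \<Longrightarrow> (\<^bold>\<exists>x. \<phi> x) p"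
  unfolding f_ex_iff using stable_mono[of "\<phi> x" p] order_refl by blast

text \<open>Witnesses exist only densely below \<open>p\<close>, and no single name is built from
  them. As the goal is stable, it suffices to prove it at the conditions that have a
  witness.\<close>

lemma f_exE:
  assumes "(\<^bold>\<exists>x. \<phi> x) p" "stable \<psi>" "\<And>q x. q \<le> p \<Longrightarrow> \<phi> x q \<Longrightarrow> \<psi> q"
  shows "\<psi> p"
proof (rule stable_dense[OF assms(2)])
  fix q assume q: "q \<le> p"
  then obtain r x where "r \<le> q" "\<phi> x r" using assms(1) unfolding f_ex_iff by blast
  with assms(3)[OF order_trans[OF _ q]] show "\<exists>r\<le>q. \<psi> r" by blast
qed

lemma f_exD: "(\<^bold>\<exists>x. \<phi> x) p \<Longrightarrow> q \<le> p \<Longrightarrow> \<exists>r\<le>q. \<exists>x. \<phi> x r"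
  by (simp add: f_ex_iff)

lemma f_impI:
  "(\<And>q. q \<le> p \<Longrightarrow> \<phi> q \<Longrightarrow> \<psi> q) \<Longrightarrow> stable \<phi> \<Longrightarrow> stable \<psi> \<Longrightarrow> (\<phi> \<^bold>\<longrightarrow> \<psi>) p"
  by (simp add: f_imp_iff)

lemma f_impE: "(\<phi> \<^bold>\<longrightarrow> \<psi>) p \<Longrightarrow> \<phi> p \<Longrightarrow> stable \<phi> \<Longrightarrow> stable \<psi> \<Longrightarrow> \<psi> p"
  using order_refl by (auto simp: f_imp_iff)

lemma f_notI: "(\<And>q. q \<le> p \<Longrightarrow> \<phi> q \<Longrightarrow> False) \<Longrightarrow> (\<^bold>\<not>\<phi>) p"
  by (auto simp: f_not_iff)

lemma f_notE: "(\<^bold>\<not>\<phi>) p \<Longrightarrow> q \<le> p \<Longrightarrow> \<phi> q \<Longrightarrow> False"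
  by (auto simp: f_not_iff)

text \<open>Proof by contradiction inside \<open>V[G]\<close>: a stable sentence that is not forced
  has its negation forced by some stronger condition.\<close>

lemma f_ccontr:
  assumes "stable \<phi>" "\<And>q. q \<le> p \<Longrightarrow> (\<^bold>\<not>\<phi>) q \<Longrightarrow> False"
  shows "\<phi> p"
  using assms(1) by (rule stable_dense) (use assms(2) in \<open>auto simp: f_not_iff\<close>)

lemma f_orE:
  assumes "(\<phi> \<^bold>\<or> \<chi>) p" "stable \<psi>" "\<And>q. q \<le> p \<Longrightarrow> \<phi> q \<Longrightarrow> \<psi> q" "\<And>q. q \<le> p \<Longrightarrow> \<chi> q \<Longrightarrow> \<psi> q"
  shows "\<psi> p"
proof (rule stable_dense[OF assms(2)])
  fix q assume q: "q \<le> p"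
  then obtain r where r: "r \<le> q" "\<phi> r \<or> \<chi> r" using assms(1) unfolding f_or_iff by blast
  with assms(3,4)[OF order_trans[OF r(1) q]] show "\<exists>r\<le>q. \<psi> r" by blast
qed

subsection \<open>Equal names\<close>

text \<open>Equivalence forced by \<open>p\<close>, kept as a HOL predicate so that the rules below
  form a congruence calculus for the simplifier. Equality of sentences would be too strong, because
  \<open>p\<close> forces two names to be equal only below itself.\<close>

definition eqv :: "cond \<Rightarrow> sentence \<Rightarrow> sentence \<Rightarrow> bool" where
  "eqv p \<phi> \<psi> \<longleftrightarrow> (\<forall>q\<le>p. \<phi> q \<longleftrightarrow> \<psi> q)"

text \<open>The extensionality that \<open>mem_set_of\<close> demands of the formula inside a set
  name.\<close>

definition extn :: "('a::names \<Rightarrow> sentence) \<Rightarrow> bool" where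
  "extn \<phi> \<longleftrightarrow> (\<forall>x y p. (x \<^bold>= y) p \<longrightarrow> eqv p (\<phi> x) (\<phi> y))"

lemma eqvD: "eqv p \<phi> \<psi> \<Longrightarrow> \<phi> p \<longleftrightarrow> \<psi> p"
  using order_refl by (auto simp: eqv_def)

lemma eqv_refl [simp]: "eqv p \<phi> \<phi>"
  by (simp add: eqv_def)

lemma eqv_and [simp]: "eqv p \<phi> \<phi>' \<Longrightarrow> eqv p \<psi> \<psi>' \<Longrightarrow> eqv p (\<phi> \<^bold>\<and> \<psi>) (\<phi>' \<^bold>\<and> \<psi>')"
  by (simp add: eqv_def f_and_iff)

lemma eqv_not [simp]: "eqv p \<phi> \<phi>' \<Longrightarrow> eqv p (\<^bold>\<not>\<phi>) (\<^bold>\<not>\<phi>')"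
  unfolding eqv_def f_not_iff by (metis order_trans)

lemma eqv_all [simp]: "(\<And>x. eqv p (\<phi> x) (\<phi>' x)) \<Longrightarrow> eqv p (\<^bold>\<forall>x. \<phi> x) (\<^bold>\<forall>x. \<phi>' x)"
  by (simp add: eqv_def f_all_iff)

lemma eqv_or [simp]: "eqv p \<phi> \<phi>' \<Longrightarrow> eqv p \<psi> \<psi>' \<Longrightarrow> eqv p (\<phi> \<^bold>\<or> \<psi>) (\<phi>' \<^bold>\<or> \<psi>')"
  unfolding f_or_def by simp

lemma eqv_imp [simp]: "eqv p \<phi> \<phi>' \<Longrightarrow> eqv p \<psi> \<psi>' \<Longrightarrow> eqv p (\<phi> \<^bold>\<longrightarrow> \<psi>) (\<phi>' \<^bold>\<longrightarrow> \<psi>')"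
  unfolding f_imp_def by simp

lemma eqv_ex [simp]: "(\<And>x. eqv p (\<phi> x) (\<phi>' x)) \<Longrightarrow> eqv p (\<^bold>\<exists>x. \<phi> x) (\<^bold>\<exists>x. \<phi>' x)"
  unfolding f_ex_def by simp

lemma eqv_eq [simp]:
  assumes "(x \<^bold>= x') p" "(y \<^bold>= y') p"
  shows "eqv p (x \<^bold>= y) (x' \<^bold>= y')"
  unfolding eqv_def
proof (intro allI impI)
  fix q assume "q \<le> p"
  then have "(x \<^bold>= x') q" "(y \<^bold>= y') q" using eq_lower[OF assms(1)] eq_lower[OF assms(2)] by blast+
  then show "(x \<^bold>= y) q \<longleftrightarrow> (x' \<^bold>= y') q" by (meson eq_sym eq_trans)
qed

lemma f_eq_setn_iff: "((A :: 'a::names setn) \<^bold>= B) p \<longleftrightarrow> (\<forall>q\<le>p. \<forall>x. (x \<^bold>\<in> A) q \<longleftrightarrow> (x \<^bold>\<in> B) q)"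
  by (auto simp: f_eq_setn_def f_all_iff f_iff_iff)

lemma eqv_mem [simp]:
  assumes "(x \<^bold>= x') p" "(A \<^bold>= A') p"
  shows "eqv p (x \<^bold>\<in> A) (x' \<^bold>\<in> A')"
proof -
  have *: "(x' \<^bold>\<in> A) q" if "(x \<^bold>\<in> A) q" "(x \<^bold>= x') q" for x x' :: 'a and q
    unfolding f_mem_def
  proof (intro allI impI)
    fix r assume r: "r \<le> q"
    then obtain t y s where t: "t \<le> r" "(y, s) \<in> pairs A" "t \<le> s" "(x \<^bold>= y) t"
      using \<open>(x \<^bold>\<in> A) q\<close> unfolding f_mem_def by blast
    have "(x \<^bold>= x') t" using eq_lower[OF that(2) order_trans[OF t(1) r]] .
    then have "(x' \<^bold>= y) t" using t(4) by (meson eq_sym eq_trans)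
    with t show "\<exists>r'\<le>r. \<exists>(y, s)\<in>pairs A. r' \<le> s \<and> (x' \<^bold>= y) r'" by blast
  qed
  show ?thesis
    unfolding eqv_def
  proof (intro allI impI)
    fix q assume q: "q \<le> p"
    then have "(x \<^bold>= x') q" using eq_lower[OF assms(1)] by blast
    then have "(x \<^bold>\<in> A) q \<longleftrightarrow> (x' \<^bold>\<in> A) q" using * eq_sym by blast
    also have "\<dots> \<longleftrightarrow> (x' \<^bold>\<in> A') q" using assms(2) q by (simp add: f_eq_setn_iff)
    finally show "(x \<^bold>\<in> A) q \<longleftrightarrow> (x' \<^bold>\<in> A') q" .
  qed
qed

lemma f_eq_pair [simp]: "((x, y) \<^bold>= (x', y')) p \<longleftrightarrow> (x \<^bold>= x') p \<and> (y \<^bold>= y') p"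
  by (simp add: f_eq_prod_def f_and_iff)

lemma f_eq_fst [simp]: "(z \<^bold>= z') p \<Longrightarrow> (fst z \<^bold>= fst z') p"
  by (simp add: f_eq_prod_def f_and_iff)

lemma f_eq_snd [simp]: "(z \<^bold>= z') p \<Longrightarrow> (snd z \<^bold>= snd z') p"
  by (simp add: f_eq_prod_def f_and_iff)

lemma f_eq_nat [simp]: "((m :: nat) \<^bold>= n) = \<^bold>\<langle>m = n\<^bold>\<rangle>"
  by (simp add: f_eq_nat_def)

lemma f_eq_snd_nat: "(z \<^bold>= z') p \<Longrightarrow> snd z = (snd z' :: nat)"
  using f_eq_snd[of z z' p] by simp

lemma f_eq_nat_list [simp]: "((xs :: nat list) \<^bold>= ys) = \<^bold>\<langle>xs = ys\<^bold>\<rangle>"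
  by (rule ext) (simp add: f_eq_list_def list_all2_eq[symmetric] lift_def)

lemma eq_set_of [simp]:
  assumes "\<And>x. eqv p (\<phi> x) (\<psi> x)" "\<And>x. stable (\<phi> x)" "\<And>x. stable (\<psi> x)"
  shows "((SetOf x. \<phi> x) \<^bold>= (SetOf x. \<psi> x)) p"
proof -
  have *: "(x \<^bold>\<in> (SetOf x. \<psi> x)) q"
    if "q \<le> p" "(x \<^bold>\<in> (SetOf x. \<phi> x)) q"
      "\<And>x. eqv p (\<phi> x) (\<psi> x)" "\<And>x. stable (\<phi> x)" for q x \<phi> \<psi>
    unfolding f_mem_def
  proof (intro allI impI)
    fix r assume r: "r \<le> q"
    with that(2) obtain t y s where t: "t \<le> r" "\<phi> y s" "t \<le> s" "(x \<^bold>= y) t"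
      unfolding f_mem_def set_of_def by auto
    have "\<phi> y t" using stable_mono[OF that(4) t(2,3)] .
    moreover have "t \<le> p" using order_trans[OF order_trans[OF t(1) r] that(1)] .
    ultimately have "\<psi> y t" using that(3)[of y] by (simp add: eqv_def)
    with t order_refl[of t] show "\<exists>r'\<le>r. \<exists>(y, s)\<in>pairs (SetOf x. \<psi> x). r' \<le> s \<and> (x \<^bold>= y) r'"
      by (auto simp: set_of_def)
  qed
  have "\<And>x. eqv p (\<psi> x) (\<phi> x)" using assms(1) by (simp add: eqv_def)
  then show ?thesis using assms * unfolding f_eq_setn_iff by blast
qed

text \<open>As an equation between sentences, and not at one condition, it unfolds membership in a
  set name under every connective.\<close>

lemma mem_set_of_eq:
  assumes "\<And>x. stable (\<phi> x)" "extn \<phi>"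
  shows "(x \<^bold>\<in> (SetOf x. \<phi> x)) = \<phi> x"
proof
  fix p
  show "(x \<^bold>\<in> (SetOf x. \<phi> x)) p = \<phi> x p"
  proof (rule mem_set_of[OF assms(1)])
    fix x y p assume "(x \<^bold>= y) p" "\<phi> y p"
    with assms(2) eqvD show "\<phi> x p" unfolding extn_def by metis
  qed
qed

lemma extnI: "(\<And>x y p. (x \<^bold>= y) p \<Longrightarrow> eqv p (\<phi> x) (\<phi> y)) \<Longrightarrow> extn \<phi>"
  by (simp add: extn_def)

lemma eqv_mem_iff: "((A :: 'a::names setn) \<^bold>= B) p \<Longrightarrow> q \<le> p \<Longrightarrow> (x \<^bold>\<in> A) q \<longleftrightarrow> (x \<^bold>\<in> B) q"
  by (simp add: f_eq_setn_iff)

lemma set_eqI: "(\<And>q x. q \<le> p \<Longrightarrow> (x \<^bold>\<in> A) q \<longleftrightarrow> (x \<^bold>\<in> B) q) \<Longrightarrow> (A \<^bold>= B) p"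
  by (simp add: f_eq_setn_iff)

lemma mem_subst: "(x \<^bold>\<in> A) p \<Longrightarrow> (x \<^bold>= y) p \<Longrightarrow> (y \<^bold>\<in> A) p"
  using eqvD[OF eqv_mem[of x y p A A]] by simp

subsection \<open>Sets and functions\<close>

lemma stable_subset [simp]: "stable (A \<^bold>\<subseteq> B)"
  by (simp add: f_subset_def)

lemmas subset_lower = stable_mono[OF stable_subset]

lemma eqv_subset [simp]: "(A \<^bold>= A') p \<Longrightarrow> (B \<^bold>= B') p \<Longrightarrow> eqv p (A \<^bold>\<subseteq> B) (A' \<^bold>\<subseteq> B')"
  by (simp add: f_subset_def)

lemma subset_iff: "(A \<^bold>\<subseteq> B) p \<longleftrightarrow> (\<forall>q\<le>p. \<forall>x. (x \<^bold>\<in> A) q \<longrightarrow> (x \<^bold>\<in> B) q)"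
  by (auto simp: f_subset_def f_all_iff f_imp_iff)

lemma subsetD: "(A \<^bold>\<subseteq> B) p \<Longrightarrow> (x \<^bold>\<in> A) p \<Longrightarrow> (x \<^bold>\<in> B) p"
  using order_refl by (auto simp: subset_iff)

lemma subsetI: "(\<And>q x. q \<le> p \<Longrightarrow> (x \<^bold>\<in> A) q \<Longrightarrow> (x \<^bold>\<in> B) q) \<Longrightarrow> (A \<^bold>\<subseteq> B) p"
  by (simp add: subset_iff)

lemma subset_trans: "(A \<^bold>\<subseteq> B) p \<Longrightarrow> (B \<^bold>\<subseteq> C) p \<Longrightarrow> (A \<^bold>\<subseteq> C) p"
  by (simp add: subset_iff)

lemma subset_refl [simp]: "(A \<^bold>\<subseteq> A) p"
  by (simp add: subset_iff)

lemma mem_diff [simp]: "(x \<^bold>\<in> A \<^bold>- B) = (x \<^bold>\<in> A \<^bold>\<and> \<^bold>\<not>(x \<^bold>\<in> B))"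
  unfolding f_diff_def by (rule mem_set_of_eq) (auto intro!: extnI)

lemma eq_diff [simp]: "(A \<^bold>= A') p \<Longrightarrow> (B \<^bold>= B') p \<Longrightarrow> (A \<^bold>- B \<^bold>= A' \<^bold>- B') p"
  by (simp add: f_diff_def)

lemma mem_inter [simp]: "(x \<^bold>\<in> A \<^bold>\<inter> B) = (x \<^bold>\<in> A \<^bold>\<and> x \<^bold>\<in> B)"
  unfolding f_inter_def by (rule mem_set_of_eq) (auto intro!: extnI)

lemma mem_check_nat [simp]: "((n :: nat) \<^bold>\<in> check A) = \<^bold>\<langle>n \<in> A\<^bold>\<rangle>"
  unfolding check_def by (rule mem_set_of_eq) (auto intro!: extnI)

lemma mem_check_nat_list [simp]: "((s :: nat list) \<^bold>\<in> check A) = \<^bold>\<langle>s \<in> A\<^bold>\<rangle>"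
  unfolding check_def by (rule mem_set_of_eq) (auto intro!: extnI)

lemma mem_check_empty [simp]: "(x \<^bold>\<in> check {}) = \<^bold>\<langle>False\<^bold>\<rangle>"
  unfolding check_def empty_iff by (rule mem_set_of_eq) (auto intro!: extnI)

lemma mem_omega [simp]: "(n \<^bold>\<in> omega) = \<^bold>\<langle>True\<^bold>\<rangle>"
  by (simp add: omega_def)

lemma stable_func [simp]: "stable (func f A B)"
  by (simp add: func_def)

lemma eqv_func [simp]:
  "(f \<^bold>= f') p \<Longrightarrow> (A \<^bold>= A') p \<Longrightarrow> (B \<^bold>= B') p \<Longrightarrow> eqv p (func f A B) (func f' A' B')"
  by (simp add: func_def)

lemmas func_lower = stable_mono[OF stable_func]

lemma stable_injective [simp]: "stable (injective f)"
  by (simp add: injective_def)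

lemmas injective_lower = stable_mono[OF stable_injective]

lemma mem_img [simp]: "(y \<^bold>\<in> img f A) = (\<^bold>\<exists>x. x \<^bold>\<in> A \<^bold>\<and> (x, y) \<^bold>\<in> f)"
  unfolding img_def by (rule mem_set_of_eq) (auto intro!: extnI)

lemma eq_img [simp]: "(f \<^bold>= f') p \<Longrightarrow> (A \<^bold>= A') p \<Longrightarrow> (img f A \<^bold>= img f' A') p"
  by (simp add: img_def)

lemma stable_has_card [simp]: "stable (has_card A n)"
  by (simp add: has_card_def)

lemmas has_card_lower = stable_mono[OF stable_has_card]

lemma eqv_has_card [simp]: "(A \<^bold>= A') p \<Longrightarrow> eqv p (has_card A n) (has_card A' n)"
  by (simp add: has_card_def)

lemma stable_fin [simp]: "stable (fin A)"
  by (simp add: fin_def)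

lemmas fin_lower = stable_mono[OF stable_fin]

lemma stable_ctbl [simp]: "stable (ctbl A)"
  by (simp add: ctbl_def)

lemma func_dom: "func f A B p \<Longrightarrow> ((x, y) \<^bold>\<in> f) p \<Longrightarrow> (x \<^bold>\<in> A) p"
  and func_cod: "func f A B p \<Longrightarrow> ((x, y) \<^bold>\<in> f) p \<Longrightarrow> (y \<^bold>\<in> B) p"
  and func_total: "func f A B p \<Longrightarrow> (x \<^bold>\<in> A) p \<Longrightarrow> (\<^bold>\<exists>y. (x, y) \<^bold>\<in> f) p"
  and func_unique: "func f A B p \<Longrightarrow> ((x, y) \<^bold>\<in> f) p \<Longrightarrow> ((x, z) \<^bold>\<in> f) p \<Longrightarrow> (y \<^bold>= z) p"
  using order_refl by (auto simp: func_def f_all_iff f_and_iff f_imp_iff)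

lemma funcI:
  assumes "\<And>q x y. q \<le> p \<Longrightarrow> ((x, y) \<^bold>\<in> f) q \<Longrightarrow> (x \<^bold>\<in> A) q \<and> (y \<^bold>\<in> B) q"
    and "\<And>q x. q \<le> p \<Longrightarrow> (x \<^bold>\<in> A) q \<Longrightarrow> (\<^bold>\<exists>y. (x, y) \<^bold>\<in> f) q"
    and "\<And>q x y z. q \<le> p \<Longrightarrow> ((x, y) \<^bold>\<in> f) q \<Longrightarrow> ((x, z) \<^bold>\<in> f) q \<Longrightarrow> (y \<^bold>= z) q"
  shows "func f A B p"
  using assms by (auto simp: func_def f_all_iff f_and_iff f_imp_iff)

lemma injectiveD: "injective f p \<Longrightarrow> ((x, z) \<^bold>\<in> f) p \<Longrightarrow> ((y, z) \<^bold>\<in> f) p \<Longrightarrow> (x \<^bold>= y) p"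
  using order_refl by (auto simp: injective_def f_all_iff f_and_iff f_imp_iff)

lemma injectiveI:
  "(\<And>q x y z. q \<le> p \<Longrightarrow> ((x, z) \<^bold>\<in> f) q \<Longrightarrow> ((y, z) \<^bold>\<in> f) q \<Longrightarrow> (x \<^bold>= y) q) \<Longrightarrow> injective f p"
  by (auto simp: injective_def f_all_iff f_and_iff f_imp_iff)

subsection \<open>Finite sets\<close>

text \<open>The elements have names listed in the ground model, but the number of a given element is
  decided only by stronger conditions; hence the form of \<open>cover\<close>. The bijection is the
  name of all pairs of an element and its number.\<close>

lemma has_card_enum:
  fixes A :: "'a::names setn" and X :: "nat \<Rightarrow> 'a"
  assumes mem: "\<And>m. m < n \<Longrightarrow> (X m \<^bold>\<in> A) p"
    and dist: "\<And>q m m'. q \<le> p \<Longrightarrow> m < n \<Longrightarrow> m' < n \<Longrightarrow> (X m \<^bold>= X m') q \<Longrightarrow> m = m'"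
    and cover: "\<And>q x. q \<le> p \<Longrightarrow> (x \<^bold>\<in> A) q \<Longrightarrow> \<exists>r\<le>q. \<exists>m<n. (x \<^bold>= X m) r"
  shows "has_card A n p"
proof -
  define \<phi> where "\<phi> z = (if snd z < n then fst z \<^bold>= X (snd z) else \<^bold>\<langle>False\<^bold>\<rangle>)" for z :: "'a \<times> nat"
  define f where "f = (SetOf z. \<phi> z)"
  have stab: "stable (\<phi> z)" for z by (simp add: \<phi>_def)
  have "(z \<^bold>\<in> f) = \<phi> z" for z
    unfolding f_def
  proof (rule mem_set_of_eq[OF stab], rule extnI)
    fix z z' :: "'a \<times> nat" and p assume z: "(z \<^bold>= z') p"
    then have "snd z = snd z'" by (rule f_eq_snd_nat)
    with z show "eqv p (\<phi> z) (\<phi> z')" by (simp add: \<phi>_def)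
  qed
  then have f: "((x, m) \<^bold>\<in> f) q \<longleftrightarrow> m < n \<and> (x \<^bold>= X m) q" for x m q
    by (simp add: \<phi>_def)
  have mem': "(x \<^bold>\<in> A) q" if "q \<le> p" "m < n" "(x \<^bold>= X m) q" for x m q
    using mem_subst[OF mem_lower[OF mem[OF that(2)] that(1)] eq_sym[OF that(3)]] .
  have "func f A (check {..<n}) p"
  proof (rule funcI)
    fix q x assume q: "q \<le> p" "(x \<^bold>\<in> A) q"
    show "(\<^bold>\<exists>m. (x, m) \<^bold>\<in> f) q"
      unfolding f_ex_iff f
    proof (intro allI impI)
      fix q' assume q': "q' \<le> q"
      show "\<exists>r\<le>q'. \<exists>m. m < n \<and> (x \<^bold>= X m) r"
        using cover[OF order_trans[OF q' q(1)] mem_lower[OF q(2) q']] by auto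
    qed
  next
    fix q x i j assume q: "q \<le> p" "((x, i) \<^bold>\<in> f) q" "((x, j) \<^bold>\<in> f) q"
    then have "(X i \<^bold>= X j) q" unfolding f by (meson eq_sym eq_trans)
    with dist[of q i j] q show "(i \<^bold>= j) q" by (simp add: f)
  qed (auto simp: f mem')
  moreover have "injective f p"
    by (rule injectiveI) (auto simp: f intro: eq_sym eq_trans)
  moreover have "(img f A \<^bold>= check {..<n}) p"
  proof (rule set_eqI)
    fix q m assume q: "q \<le> p"
    show "(m \<^bold>\<in> img f A) q \<longleftrightarrow> (m \<^bold>\<in> check {..<n}) q"
    proof
      assume "(m \<^bold>\<in> img f A) q"
      then have "\<exists>r\<le>q. \<exists>x. (x \<^bold>\<in> A \<^bold>\<and> (x, m) \<^bold>\<in> f) r"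
        unfolding mem_img by (rule f_exD) (rule order_refl)
      then show "(m \<^bold>\<in> check {..<n}) q" by (auto simp: f f_and_iff)
    next
      assume "(m \<^bold>\<in> check {..<n}) q"
      then have "m < n" by simp
      then have "(X m \<^bold>\<in> A \<^bold>\<and> (X m, m) \<^bold>\<in> f) q"
        using mem_lower[OF mem q] by (simp add: f f_and_iff)
      then show "(m \<^bold>\<in> img f A) q" unfolding mem_img by (rule f_exI) simp
    qed
  qed
  ultimately show ?thesis
    unfolding has_card_def by (intro f_exI[of _ f]) (simp_all add: f_and_iff)
qed

lemma f_decide: "\<exists>r\<le>p. \<phi> r \<or> (\<^bold>\<not>\<phi>) r"
  using order_refl by (auto simp: f_not_iff)

text \<open>\<open>R x i\<close> indexes the elements \<open>x\<close> of \<open>A\<close> by elements \<open>i\<close> of a finite set of the ground model.\<close>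

lemma has_card_bounded:
  fixes A :: "'a::names setn" and R :: "'a \<Rightarrow> 'i \<Rightarrow> sentence"
  assumes fin: "finite I"
    and stab: "\<And>x i. stable (R x i)"
    and cover: "\<And>q x. q \<le> p \<Longrightarrow> (x \<^bold>\<in> A) q \<Longrightarrow> \<exists>r\<le>q. \<exists>i\<in>I. R x i r"
    and inj: "\<And>q x y i. q \<le> p \<Longrightarrow> R x i q \<Longrightarrow> R y i q \<Longrightarrow> (x \<^bold>\<in> A) q \<Longrightarrow> (y \<^bold>\<in> A) q \<Longrightarrow> (x \<^bold>= y) q"
  shows "\<exists>r\<le>p. \<exists>n\<le>card I. has_card A n r"
proof -
  define \<phi> where "\<phi> i = (\<^bold>\<exists>x. x \<^bold>\<in> A \<^bold>\<and> R x i)" for i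
  have st: "stable (\<phi> i)" for i by (simp add: \<phi>_def stab)
  \<comment> \<open>A single condition settles for every index whether it is occupied and, if so,
    names an occupant.\<close>
  have "\<exists>q\<le>p. \<forall>i\<in>I. (\<exists>x. (x \<^bold>\<in> A \<^bold>\<and> R x i) q) \<or> (\<^bold>\<not>\<phi> i) q"
  proof (rule decide_finite[OF fin])
    fix i p q assume "(\<exists>x. (x \<^bold>\<in> A \<^bold>\<and> R x i) p) \<or> (\<^bold>\<not>\<phi> i) p" "q \<le> p"
    then show "(\<exists>x. (x \<^bold>\<in> A \<^bold>\<and> R x i) q) \<or> (\<^bold>\<not>\<phi> i) q"
      using stable_mono[OF stable_and[OF stable_mem stab]] stable_mono[OF stable_not[OF st]] by metis
  next
    fix i q
    show "\<exists>r\<le>q. (\<exists>x. (x \<^bold>\<in> A \<^bold>\<and> R x i) r) \<or> (\<^bold>\<not>\<phi> i) r"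
    proof (cases "(\<^bold>\<not>\<phi> i) q")
      case False
      then obtain q' where q': "q' \<le> q" "\<phi> i q'" by (auto simp: f_not_iff)
      then obtain r where "r \<le> q'" "\<exists>x. (x \<^bold>\<in> A \<^bold>\<and> R x i) r"
        using f_exD[OF _ order_refl] unfolding \<phi>_def by blast
      with order_trans[OF _ q'(1)] show ?thesis by blast
    qed (use order_refl in blast)
  qed
  then obtain q where q: "q \<le> p" "\<And>i. i \<in> I \<Longrightarrow> (\<exists>x. (x \<^bold>\<in> A \<^bold>\<and> R x i) q) \<or> (\<^bold>\<not>\<phi> i) q" by blast
  define I' where "I' = {i \<in> I. \<exists>x. (x \<^bold>\<in> A \<^bold>\<and> R x i) q}"
  have "\<forall>i\<in>I'. \<exists>x. (x \<^bold>\<in> A) q \<and> R x i q" by (simp add: I'_def f_and_iff)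
  then obtain X where X: "\<And>i. i \<in> I' \<Longrightarrow> (X i \<^bold>\<in> A) q \<and> R (X i) i q" by metis
  have fin': "finite (I' \<times> I')" using fin by (simp add: I'_def)
  have "\<exists>r\<le>q. \<forall>(i, j)\<in>I' \<times> I'. (X i \<^bold>= X j) r \<or> (\<^bold>\<not>(X i \<^bold>= X j)) r"
  proof (rule decide_finite[OF fin'])
    fix z p q assume "case z of (i, j) \<Rightarrow> (X i \<^bold>= X j) p \<or> (\<^bold>\<not>(X i \<^bold>= X j)) p" "q \<le> p"
    then show "case z of (i, j) \<Rightarrow> (X i \<^bold>= X j) q \<or> (\<^bold>\<not>(X i \<^bold>= X j)) q"
      by (cases z) (auto intro: stable_mono[OF stable_eq] stable_mono[OF stable_not[OF stable_eq]])
  next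
    fix z q
    show "\<exists>r\<le>q. case z of (i, j) \<Rightarrow> (X i \<^bold>= X j) r \<or> (\<^bold>\<not>(X i \<^bold>= X j)) r"
      by (cases z) (use f_decide in auto)
  qed
  then obtain r where r: "r \<le> q"
    and dec: "\<And>i j. i \<in> I' \<Longrightarrow> j \<in> I' \<Longrightarrow> (X i \<^bold>= X j) r \<or> (\<^bold>\<not>(X i \<^bold>= X j)) r" by blast
  \<comment> \<open>One element may carry several indices. \<open>c\<close> picks one index for each
    class of occupants forced to be equal; it depends on the class only, so it fixes its own values
    and distinct values have distinct occupants.\<close>
  define c where "c i = (SOME j. j \<in> I' \<and> (X i \<^bold>= X j) r)" for i
  have c: "c i \<in> I' \<and> (X i \<^bold>= X (c i)) r" if "i \<in> I'" for i
    unfolding c_def by (rule someI[of _ i]) (use that in simp)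
  have c_eq: "c i = c j" if "(X i \<^bold>= X j) r" for i j
  proof -
    have "(X i \<^bold>= X k) r \<longleftrightarrow> (X j \<^bold>= X k) r" for k using that by (meson eq_sym eq_trans)
    then show ?thesis by (simp add: c_def)
  qed
  define n where "n = card (c ` I')"
  have "n \<le> card I'" using fin' unfolding n_def
    by (intro card_image_le) (simp add: I'_def fin)
  also have "\<dots> \<le> card I" using fin by (intro card_mono) (auto simp: I'_def)
  finally have n: "n \<le> card I" .
  have "finite (c ` I')" using fin by (simp add: I'_def)
  then obtain e where e: "bij_betw e {..<n} (c ` I')"
    unfolding n_def using ex_bij_betw_nat_finite[of "c ` I'"] by (auto simp: atLeast0LessThan)
  have e_c: "e m \<in> c ` I'" "e m \<in> I'" if "m < n" for m
  proof -
    show "e m \<in> c ` I'" using bij_betwE[OF e] that by simp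
    then show "e m \<in> I'" using c by auto
  qed
  have "has_card A n r"
  proof (rule has_card_enum[where X = "\<lambda>m. X (e m)"])
    fix m assume "m < n"
    then show "(X (e m) \<^bold>\<in> A) r" using mem_lower[OF conjunct1[OF X[OF e_c(2)]] r] by simp
  next
    fix q' m m' assume q': "q' \<le> r" and m: "m < n" "m' < n" and eq: "(X (e m) \<^bold>= X (e m')) q'"
    have "\<not> (\<^bold>\<not>(X (e m) \<^bold>= X (e m'))) r" using eq q' by (auto simp: f_not_iff)
    then have "(X (e m) \<^bold>= X (e m')) r" using dec e_c(2) m by blast
    then have cc: "c (e m) = c (e m')" by (rule c_eq)
    have cid: "c (e m) = e m" if "m < n" for m
    proof -
      obtain i where "i \<in> I'" "e m = c i" using e_c(1)[OF \<open>m < n\<close>] by auto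
      then show ?thesis using c_eq c by metis
    qed
    have "e m = e m'" using cc cid[OF m(1)] cid[OF m(2)] by simp
    with e m show "m = m'" by (auto simp: bij_betw_def inj_on_def)
  next
    fix q' x assume q': "q' \<le> r" "(x \<^bold>\<in> A) q'"
    have q'p: "q' \<le> p" using order_trans[OF q'(1) order_trans[OF r q(1)]] .
    obtain t i where t: "t \<le> q'" "i \<in> I" "R x i t" using cover[OF q'p q'(2)] by blast
    have tr: "t \<le> r" using order_trans[OF t(1) q'(1)] .
    have tA: "(x \<^bold>\<in> A) t" using mem_lower[OF q'(2) t(1)] .
    then have "\<phi> i t" unfolding \<phi>_def
      using t(3) by (intro f_exI[of _ x]) (simp_all add: f_and_iff stab)
    then have "\<not> (\<^bold>\<not>\<phi> i) q" using order_trans[OF tr r] by (auto simp: f_not_iff)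
    then have i: "i \<in> I'" using q(2)[OF t(2)] t(2) by (auto simp: I'_def)
    have "(X i \<^bold>\<in> A) t" "R (X i) i t"
      using X[OF i] stable_mono[OF stable_mem _ order_trans[OF tr r]] stable_mono[OF stab _ order_trans[OF tr r]] by auto
    then have "(x \<^bold>= X i) t" using inj[OF order_trans[OF t(1) q'p] t(3)] tA by simp
    moreover have "(X i \<^bold>= X (c i)) t" using eq_lower[OF conjunct2[OF c[OF i]] tr] .
    ultimately have "(x \<^bold>= X (c i)) t" by (rule eq_trans)
    moreover obtain m where "m < n" "e m = c i"
      using e i by (metis bij_betw_imp_surj_on imageE image_eqI lessThan_iff)
    ultimately have "m < n \<and> (x \<^bold>= X (e m)) t" by simp
    with t(1) show "\<exists>t\<le>q'. \<exists>m<n. (x \<^bold>= X (e m)) t" by blast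
  qed
  then show ?thesis using n order_trans[OF r q(1)] by blast
qed

lemma has_cardE:
  assumes "has_card A n p"
  obtains r f where "r \<le> p" "func f A (check {..<n}) r" "injective f r" "(img f A \<^bold>= check {..<n}) r"
  using f_exD[OF assms[unfolded has_card_def] order_refl] by (auto simp: f_and_iff)

text \<open>The pigeonhole argument is moved to the ground model: one condition names, for each
  \<open>i < m\<close>, the element numbered \<open>i\<close> by the first bijection and decides its
  number \<open>\<pi> i\<close> under the second. Then \<open>\<pi>\<close> is an injection between
  sets of ordinary numbers.\<close>

lemma has_card_le:
  assumes "has_card A m p" "has_card A n p"
  shows "m \<le> n"
proof -
  obtain r f where f: "r \<le> p" "func f A (check {..<m}) r" "injective f r" "(img f A \<^bold>= check {..<m}) r"
    using assms(1) by (rule has_cardE)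
  obtain r' f' where f': "r' \<le> r" "func f' A (check {..<n}) r'" "injective f' r'"
    using has_cardE[OF has_card_lower[OF assms(2) f(1)]] by metis
  have f_r': "func f A (check {..<m}) r'" "(img f A \<^bold>= check {..<m}) r'"
    using func_lower[OF f(2) f'(1)] eq_lower[OF f(4) f'(1)] .
  have "\<exists>q\<le>r'. \<forall>i\<in>{..<m}. \<exists>x j. ((x, i) \<^bold>\<in> f) q \<and> ((x, j) \<^bold>\<in> f') q"
  proof (rule decide_finite)
    fix i p q assume "\<exists>x j. ((x, i) \<^bold>\<in> f) p \<and> ((x, j) \<^bold>\<in> f') p" "q \<le> p"
    then show "\<exists>x j. ((x, i) \<^bold>\<in> f) q \<and> ((x, j) \<^bold>\<in> f') q" using mem_lower by meson
  next
    fix i q assume i: "i \<in> {..<m}" and q: "q \<le> r'"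
    have "(i \<^bold>\<in> check {..<m}) q" using i by simp
    then have "(i \<^bold>\<in> img f A) q" using eqv_mem_iff[OF f_r'(2) q] by blast
    then obtain t x where t: "t \<le> q" "(x \<^bold>\<in> A) t" "((x, i) \<^bold>\<in> f) t"
      using f_exD[OF _ order_refl] unfolding mem_img f_and_iff by blast
    have "(\<^bold>\<exists>j. (x, j) \<^bold>\<in> f') t"
      using func_total[OF func_lower[OF f'(2) order_trans[OF t(1) q]] t(2)] .
    then obtain u j where u: "u \<le> t" "((x, j) \<^bold>\<in> f') u" using f_exD[OF _ order_refl] by blast
    with mem_lower[OF t(3) u(1)] order_trans[OF u(1) t(1)]
    show "\<exists>r\<le>q. \<exists>x j. ((x, i) \<^bold>\<in> f) r \<and> ((x, j) \<^bold>\<in> f') r" by auto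
  qed simp
  then obtain q where q: "q \<le> r'" "\<forall>i\<in>{..<m}. \<exists>x j. ((x, i) \<^bold>\<in> f) q \<and> ((x, j) \<^bold>\<in> f') q" by blast
  then obtain X \<pi> where X: "\<And>i. i < m \<Longrightarrow> ((X i, i) \<^bold>\<in> f) q" "\<And>i. i < m \<Longrightarrow> ((X i, \<pi> i) \<^bold>\<in> f') q"
    by (metis lessThan_iff)
  have fq: "func f A (check {..<m}) q" "func f' A (check {..<n}) q" "injective f' q"
    using func_lower[OF f_r'(1) q(1)] func_lower[OF f'(2) q(1)] injective_lower[OF f'(3) q(1)] .
  have "inj_on \<pi> {..<m}"
  proof (rule inj_onI)
    fix i j assume ij: "i \<in> {..<m}" "j \<in> {..<m}" "\<pi> i = \<pi> j"
    have "((X j, \<pi> i) \<^bold>\<in> f') q" using X(2)[of j] ij by simp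
    then have "(X i \<^bold>= X j) q" using injectiveD[OF fq(3) X(2)[of i]] ij(1) by simp
    then have "((X i, j) \<^bold>\<in> f) q"
      using X(1)[of j] ij mem_subst[of "(X j, j)" f q "(X i, j)"] by (simp add: eq_sym)
    with func_unique[OF fq(1) X(1)[of i]] ij show "i = j" by simp
  qed
  moreover have "\<pi> ` {..<m} \<subseteq> {..<n}"
    using func_cod[OF fq(2) X(2)] by auto
  ultimately show "m \<le> n" using card_inj_on_le[of \<pi> "{..<m}" "{..<n}"] by simp
qed

lemma has_card_unique: "has_card A m p \<Longrightarrow> has_card A n p \<Longrightarrow> m = n"
  using has_card_le by (metis order_antisym)

lemma fin_bounded:
  fixes A :: "'a::names setn" and R :: "'a \<Rightarrow> 'i \<Rightarrow> sentence"
  assumes fin: "finite I"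
    and stab: "\<And>x i. stable (R x i)"
    and cover: "\<And>q x. q \<le> p \<Longrightarrow> (x \<^bold>\<in> A) q \<Longrightarrow> \<exists>r\<le>q. \<exists>i\<in>I. R x i r"
    and inj: "\<And>q x y i. q \<le> p \<Longrightarrow> R x i q \<Longrightarrow> R y i q \<Longrightarrow> (x \<^bold>\<in> A) q \<Longrightarrow> (y \<^bold>\<in> A) q \<Longrightarrow> (x \<^bold>= y) q"
  shows "fin A p"
proof (rule stable_dense[OF stable_fin])
  fix q assume q: "q \<le> p"
  have "\<exists>r\<le>q. \<exists>n\<le>card I. has_card A n r"
    by (rule has_card_bounded[where R = R, OF fin stab])
       (use cover[OF order_trans[OF _ q]] inj[OF order_trans[OF _ q]] in blast)+
  then show "\<exists>r\<le>q. fin A r" unfolding fin_def by (blast intro: f_exI stable_has_card)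
qed

lemma fin_index:
  assumes "fin A p"
  obtains r f and n :: nat where "r \<le> p" "func f A (check {..<n}) r" "injective f r"
proof -
  obtain q n where q: "q \<le> p" "has_card A n q"
    using f_exD[OF assms[unfolded fin_def] order_refl] by blast
  obtain r f where "r \<le> q" "func f A (check {..<n}) r" "injective f r"
    using has_cardE[OF q(2)] by metis
  with order_trans[OF _ q(1)] that show ?thesis by blast
qed

lemma fin_subset:
  assumes "fin A p" "(B \<^bold>\<subseteq> A) p"
  shows "fin B p"
proof (rule stable_dense[OF stable_fin])
  fix q assume q: "q \<le> p"
  obtain r f and n :: nat where r: "r \<le> q" and f: "func f A (check {..<n}) r" "injective f r"
    using fin_index[OF fin_lower[OF assms(1) q]] by metis
  have "fin B r"
  proof (rule fin_bounded[where I = "{..<n}" and R = "\<lambda>x i. (x, i) \<^bold>\<in> f"])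
    fix t x assume t: "t \<le> r" "(x \<^bold>\<in> B) t"
    have "(x \<^bold>\<in> A) t"
      using subsetD[OF subset_lower[OF assms(2) order_trans[OF t(1) order_trans[OF r q]]] t(2)] .
    then obtain u i where u: "u \<le> t" "((x, i) \<^bold>\<in> f) u"
      using f_exD[OF func_total[OF func_lower[OF f(1) t(1)]] order_refl] by blast
    moreover have "i < n"
      using func_cod[OF func_lower[OF f(1) order_trans[OF u(1) t(1)]] u(2)] by simp
    ultimately show "\<exists>u\<le>t. \<exists>i\<in>{..<n}. ((x, i) \<^bold>\<in> f) u" by blast
  qed (use injectiveD[OF injective_lower[OF f(2)]] in simp_all)
  with r show "\<exists>r\<le>q. fin B r" by blast
qed

lemma fin_img:
  assumes "fin A p" "func f X Y p"
  shows "fin (img f A) p"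
proof (rule stable_dense[OF stable_fin])
  fix q assume q: "q \<le> p"
  obtain r g and n :: nat where r: "r \<le> q" and g: "func g A (check {..<n}) r" "injective g r"
    using fin_index[OF fin_lower[OF assms(1) q]] by metis
  have f: "func f X Y t" if "t \<le> r" for t
    using func_lower[OF assms(2) order_trans[OF that order_trans[OF r q]]] .
  \<comment> \<open>A point of the image inherits the indices of all its preimages; it may have
    several, but an index still determines the point.\<close>
  let ?R = "\<lambda>y i. \<^bold>\<exists>x. (x, i) \<^bold>\<in> g \<^bold>\<and> (x, y) \<^bold>\<in> f"
  have "fin (img f A) r"
  proof (rule fin_bounded[where I = "{..<n}" and R = ?R])
    fix t y assume t: "t \<le> r" "(y \<^bold>\<in> img f A) t"
    then obtain u x where u: "u \<le> t" "(x \<^bold>\<in> A) u" "((x, y) \<^bold>\<in> f) u"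
      using f_exD[OF _ order_refl] unfolding mem_img f_and_iff by blast
    obtain v i where v: "v \<le> u" "((x, i) \<^bold>\<in> g) v"
      using f_exD[OF func_total[OF func_lower[OF g(1) order_trans[OF u(1) t(1)]] u(2)] order_refl] by blast
    moreover have "i < n"
      using func_cod[OF func_lower[OF g(1) order_trans[OF v(1) order_trans[OF u(1) t(1)]]] v(2)] by simp
    moreover have "?R y i v"
      by (rule f_exI[of _ x]) (use v mem_lower[OF u(3) v(1)] in \<open>simp_all add: f_and_iff\<close>)
    moreover have "v \<le> t" using order_trans[OF v(1) u(1)] .
    ultimately show "\<exists>v\<le>t. \<exists>i\<in>{..<n}. ?R y i v" by blast
  next
    fix t y y' i assume t: "t \<le> r" and R: "?R y i t" "?R y' i t"
    show "(y \<^bold>= y') t"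
    proof (rule f_exE[OF R(1) stable_eq])
      fix u x assume u: "u \<le> t" "((x, i) \<^bold>\<in> g \<^bold>\<and> (x, y) \<^bold>\<in> f) u"
      have R': "?R y' i u" by (rule ex_lower[OF R(2) u(1)])
      show "(y \<^bold>= y') u"
      proof (rule f_exE[OF R' stable_eq])
        fix v x' assume v: "v \<le> u" "((x', i) \<^bold>\<in> g \<^bold>\<and> (x', y') \<^bold>\<in> f) v"
        have vr: "v \<le> r" using order_trans[OF v(1) order_trans[OF u(1) t]] .
        have x: "((x, i) \<^bold>\<in> g) v" "((x, y) \<^bold>\<in> f) v"
          using u(2) mem_lower[OF _ v(1)] by (auto simp: f_and_iff)
        have "(x' \<^bold>= x) v"
          using injectiveD[OF injective_lower[OF g(2) vr] _ x(1)] v(2) by (simp add: f_and_iff)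
        then have "((x, y') \<^bold>\<in> f) v"
          using v(2) mem_subst[of "(x', y')" f v "(x, y')"] by (simp add: f_and_iff)
        then show "(y \<^bold>= y') v" using func_unique[OF f[OF vr] x(2)] by simp
      qed
    qed
  qed simp_all
  with r show "\<exists>r\<le>q. fin (img f A) r" by blast
qed

text \<open>The number of elements of \<open>A\<close> becomes an ordinary number at a stronger
  condition, so one further condition can fix the value of \<open>h\<close> at each numbered
  element. The resulting finite set is in the ground model, as the indices in
  \<open>tukey_selection\<close> must be.\<close>

lemma fin_values:
  fixes h :: "('a::names \<times> nat) setn"
  assumes "fin A p" "func h X Y p"
  shows "\<exists>r\<le>p. \<exists>F. finite F \<and> (\<forall>q\<le>r. \<forall>x j. (x \<^bold>\<in> A) q \<longrightarrow> ((x, j) \<^bold>\<in> h) q \<longrightarrow> j \<in> F)"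
proof -
  obtain r f and n :: nat where r: "r \<le> p" and f: "func f A (check {..<n}) r" "injective f r"
    using fin_index[OF assms(1)] by metis
  \<comment> \<open>It holds vacuously if below \<open>q\<close> no element with number
    \<open>i\<close> and a value of \<open>h\<close> appears.\<close>
  define \<Theta> where "\<Theta> i q \<longleftrightarrow>
    (\<exists>j. \<forall>q'\<le>q. \<forall>x j'. ((x, i) \<^bold>\<in> f) q' \<longrightarrow> ((x, j') \<^bold>\<in> h) q' \<longrightarrow> j' = j)" for i q
  have "\<exists>q\<le>r. \<forall>i\<in>{..<n}. \<Theta> i q"
  proof (rule decide_finite)
    fix i p q assume "\<Theta> i p" "q \<le> p"
    then show "\<Theta> i q" unfolding \<Theta>_def using order_trans by meson
  next
    fix i q assume q: "q \<le> r"
    show "\<exists>q'\<le>q. \<Theta> i q'"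
    proof (cases "\<exists>q'\<le>q. \<exists>x j. ((x, i) \<^bold>\<in> f) q' \<and> ((x, j) \<^bold>\<in> h) q'")
      case True
      then obtain q' x j where q': "q' \<le> q" "((x, i) \<^bold>\<in> f) q'" "((x, j) \<^bold>\<in> h) q'" by blast
      have "j' = j" if t: "t \<le> q'" and x': "((x', i) \<^bold>\<in> f) t" "((x', j') \<^bold>\<in> h) t" for t x' j'
      proof -
        have tr: "t \<le> r" using order_trans[OF t order_trans[OF q'(1) q]] .
        have "(x' \<^bold>= x) t"
          using injectiveD[OF injective_lower[OF f(2) tr] x'(1) mem_lower[OF q'(2) t]] .
        then have "((x, j') \<^bold>\<in> h) t"
          using x'(2) mem_subst[of "(x', j')" h t "(x, j')"] by simp
        then show ?thesis
          using func_unique[OF func_lower[OF assms(2) order_trans[OF tr r]] mem_lower[OF q'(3) t]] by simp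
      qed
      then have "\<Theta> i q'" unfolding \<Theta>_def by blast
      with q'(1) show ?thesis by blast
    next
      case False
      then have "\<Theta> i q" unfolding \<Theta>_def by blast
      then show ?thesis using order_refl by blast
    qed
  qed simp
  then obtain q where q: "q \<le> r" "\<And>i. i < n \<Longrightarrow> \<Theta> i q" by blast
  then obtain J where J: "\<And>i q' x j'. i < n \<Longrightarrow> q' \<le> q \<Longrightarrow> ((x, i) \<^bold>\<in> f) q' \<Longrightarrow> ((x, j') \<^bold>\<in> h) q' \<Longrightarrow> j' = J i"
    unfolding \<Theta>_def by metis
  have "j \<in> J ` {..<n}" if t: "t \<le> q" "(x \<^bold>\<in> A) t" "((x, j) \<^bold>\<in> h) t" for t x j
  proof -
    obtain u i where u: "u \<le> t" "((x, i) \<^bold>\<in> f) u"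
      using f_exD[OF func_total[OF func_lower[OF f(1) order_trans[OF t(1) q(1)]] t(2)] order_refl] by blast
    have uq: "u \<le> q" using order_trans[OF u(1) t(1)] .
    have "i < n" using func_cod[OF func_lower[OF f(1) order_trans[OF uq q(1)]] u(2)] by simp
    with J[OF _ uq u(2) mem_lower[OF t(3) u(1)]] show ?thesis by auto
  qed
  then show ?thesis using order_trans[OF q(1) r] by (intro exI[of _ q] conjI exI[of _ "J ` {..<n}"]) auto
qed

section \<open>Ultrafilters and their images\<close>

lemma stable_const [simp]: "stable (\<lambda>p. b)"
  using stable_lift[of b] by (simp add: lift_def)

lemma f_allD: "(\<^bold>\<forall>x. \<phi> x) p \<Longrightarrow> \<phi> x p"
  by (simp add: f_all_def)

lemma f_andI: "\<phi> p \<Longrightarrow> \<psi> p \<Longrightarrow> (\<phi> \<^bold>\<and> \<psi>) p"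
  by (simp add: f_and_def)

lemma f_ex_andD: "(\<^bold>\<exists>x. \<phi> x \<^bold>\<and> \<psi> x) p \<Longrightarrow> \<exists>r\<le>p. \<exists>x. \<phi> x r \<and> \<psi> x r"
  using f_exD[OF _ order_refl, of "\<lambda>x. \<phi> x \<^bold>\<and> \<psi> x" p] by (simp add: f_and_iff)

lemma stable_ultrafilter [simp]: "stable (ultrafilter X \<U>)"
  by (simp add: ultrafilter_def)

lemmas ultrafilter_lower = stable_mono[OF stable_ultrafilter]

lemma eqv_ultrafilter [simp]:
  "(X \<^bold>= X') p \<Longrightarrow> (\<U> \<^bold>= \<U>') p \<Longrightarrow> eqv p (ultrafilter X \<U>) (ultrafilter X' \<U>')"
  by (simp add: ultrafilter_def)

lemma ultrafilter_iff:
  "ultrafilter X \<U> p \<longleftrightarrow>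
     (\<forall>A. \<forall>q\<le>p. (A \<^bold>\<in> \<U>) q \<longrightarrow> (A \<^bold>\<subseteq> X) q) \<and> (X \<^bold>\<in> \<U>) p \<and> (\<forall>q\<le>p. \<not> (check {} \<^bold>\<in> \<U>) q) \<and>
     (\<forall>A B. \<forall>q\<le>p. (A \<^bold>\<in> \<U>) q \<and> (A \<^bold>\<subseteq> B) q \<and> (B \<^bold>\<subseteq> X) q \<longrightarrow> (B \<^bold>\<in> \<U>) q) \<and>
     (\<forall>A B. \<forall>q\<le>p. (A \<^bold>\<in> \<U>) q \<and> (B \<^bold>\<in> \<U>) q \<longrightarrow> (A \<^bold>\<inter> B \<^bold>\<in> \<U>) q) \<and>
     (\<forall>A. \<forall>q\<le>p. (A \<^bold>\<subseteq> X) q \<longrightarrow> (A \<^bold>\<in> \<U> \<^bold>\<or> X \<^bold>- A \<^bold>\<in> \<U>) q)"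
  by (simp add: ultrafilter_def f_all_iff f_and_iff f_imp_iff f_not_iff)

lemma
  assumes "ultrafilter X \<U> p"
  shows ultrafilter_sub: "(A \<^bold>\<in> \<U>) p \<Longrightarrow> (A \<^bold>\<subseteq> X) p"
    and ultrafilter_space: "(X \<^bold>\<in> \<U>) p"
    and ultrafilter_empty: "\<not> (check {} \<^bold>\<in> \<U>) p"
    and ultrafilter_up: "(A \<^bold>\<in> \<U>) p \<Longrightarrow> (A \<^bold>\<subseteq> B) p \<Longrightarrow> (B \<^bold>\<subseteq> X) p \<Longrightarrow> (B \<^bold>\<in> \<U>) p"
    and ultrafilter_int: "(A \<^bold>\<in> \<U>) p \<Longrightarrow> (B \<^bold>\<in> \<U>) p \<Longrightarrow> (A \<^bold>\<inter> B \<^bold>\<in> \<U>) p"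
    and ultrafilter_or: "(A \<^bold>\<subseteq> X) p \<Longrightarrow> (A \<^bold>\<in> \<U> \<^bold>\<or> X \<^bold>- A \<^bold>\<in> \<U>) p"
proof -
  note U = assms[unfolded ultrafilter_iff]
  note * = conjunct1[OF U] conjunct1[OF conjunct2[OF U]] conjunct1[OF conjunct2[OF conjunct2[OF U]]]
    conjunct1[OF conjunct2[OF conjunct2[OF conjunct2[OF U]]]]
    conjunct1[OF conjunct2[OF conjunct2[OF conjunct2[OF conjunct2[OF U]]]]]
    conjunct2[OF conjunct2[OF conjunct2[OF conjunct2[OF conjunct2[OF U]]]]]
  note p = order_refl[of p]
  show "(A \<^bold>\<in> \<U>) p \<Longrightarrow> (A \<^bold>\<subseteq> X) p" using *(1) p by blast
  show "(X \<^bold>\<in> \<U>) p" by fact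
  show "\<not> (check {} \<^bold>\<in> \<U>) p" using *(3) p by blast
  show "(A \<^bold>\<in> \<U>) p \<Longrightarrow> (A \<^bold>\<subseteq> B) p \<Longrightarrow> (B \<^bold>\<subseteq> X) p \<Longrightarrow> (B \<^bold>\<in> \<U>) p" using *(4) p by blast
  show "(A \<^bold>\<in> \<U>) p \<Longrightarrow> (B \<^bold>\<in> \<U>) p \<Longrightarrow> (A \<^bold>\<inter> B \<^bold>\<in> \<U>) p" using *(5) p by blast
  show "(A \<^bold>\<subseteq> X) p \<Longrightarrow> (A \<^bold>\<in> \<U> \<^bold>\<or> X \<^bold>- A \<^bold>\<in> \<U>) p" using *(6) p by blast
qed

lemma ultrafilter_compl:
  assumes "ultrafilter X \<U> p" "(A \<^bold>\<subseteq> X) p" "(\<^bold>\<not>(A \<^bold>\<in> \<U>)) p"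
  shows "(X \<^bold>- A \<^bold>\<in> \<U>) p"
proof (rule f_orE[OF ultrafilter_or[OF assms(1,2)] stable_mem])
  fix q assume "q \<le> p" "(A \<^bold>\<in> \<U>) q"
  with f_notE[OF assms(3)] show "(X \<^bold>- A \<^bold>\<in> \<U>) q" by blast
qed

lemma ultrafilter_nonempty:
  assumes "ultrafilter X \<U> p" "(A \<^bold>\<in> \<U>) p"
  shows "\<exists>q\<le>p. \<exists>x. (x \<^bold>\<in> A) q"
proof (rule ccontr)
  assume *: "\<not> ?thesis"
  have "(A \<^bold>= check {}) p" by (rule set_eqI) (use * in auto)
  then have "(check {} \<^bold>\<in> \<U>) p" by (rule mem_subst[OF assms(2)])
  with ultrafilter_empty[OF assms(1)] show False by blast
qed

lemma ultrafilterI: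
  assumes "\<And>q A. q \<le> p \<Longrightarrow> (A \<^bold>\<in> \<U>) q \<Longrightarrow> (A \<^bold>\<subseteq> X) q"
    and "(X \<^bold>\<in> \<U>) p"
    and "\<And>q. q \<le> p \<Longrightarrow> (check {} \<^bold>\<in> \<U>) q \<Longrightarrow> False"
    and "\<And>q A B. q \<le> p \<Longrightarrow> (A \<^bold>\<in> \<U>) q \<Longrightarrow> (A \<^bold>\<subseteq> B) q \<Longrightarrow> (B \<^bold>\<subseteq> X) q \<Longrightarrow> (B \<^bold>\<in> \<U>) q"
    and "\<And>q A B. q \<le> p \<Longrightarrow> (A \<^bold>\<in> \<U>) q \<Longrightarrow> (B \<^bold>\<in> \<U>) q \<Longrightarrow> (A \<^bold>\<inter> B \<^bold>\<in> \<U>) q"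
    and "\<And>q A. q \<le> p \<Longrightarrow> (A \<^bold>\<subseteq> X) q \<Longrightarrow> (A \<^bold>\<in> \<U> \<^bold>\<or> X \<^bold>- A \<^bold>\<in> \<U>) q"
  shows "ultrafilter X \<U> p"
  unfolding ultrafilter_iff using assms by blast

lemma stable_nonprincipal [simp]: "stable (nonprincipal \<U>)"
  by (simp add: nonprincipal_def)

lemma eqv_nonprincipal [simp]: "(\<U> \<^bold>= \<U>') p \<Longrightarrow> eqv p (nonprincipal \<U>) (nonprincipal \<U>')"
  by (simp add: nonprincipal_def)

lemma mem_singleton [simp]: "(y \<^bold>\<in> (SetOf y. y \<^bold>= x)) = (y \<^bold>= x)"
  by (rule mem_set_of_eq) (auto intro!: extnI)

text \<open>With \<open>A\<close> numbered by \<open>f\<close>, let \<open>B i\<close> hold the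
  elements with number \<open>i\<close> or higher. Passing to \<open>B (Suc i)\<close> removes
  \<open>C i\<close>, which has at most one element and so is not in a nonprincipal ultrafilter. All
  \<open>B i\<close> would thus be in it, although \<open>B n\<close> is empty.\<close>

lemma ultrafilter_fin:
  assumes U: "ultrafilter X \<U> p" and np: "nonprincipal \<U> p" and A: "(A \<^bold>\<in> \<U>) p" and fin: "fin A p"
  shows False
proof -
  obtain r f and n :: nat where r: "r \<le> p" and f: "func f A (check {..<n}) r" "injective f r"
    using fin_index[OF fin] by metis
  have Ur: "ultrafilter X \<U> r" by (rule ultrafilter_lower[OF U r])
  have Ar: "(A \<^bold>\<in> \<U>) r" by (rule mem_lower[OF A r])
  define B where "B i = (SetOf x. x \<^bold>\<in> A \<^bold>\<and> (\<^bold>\<exists>k. (x, k) \<^bold>\<in> f \<^bold>\<and> \<^bold>\<langle>i \<le> k\<^bold>\<rangle>))" for i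
  have B: "(x \<^bold>\<in> B i) = (x \<^bold>\<in> A \<^bold>\<and> (\<^bold>\<exists>k. (x, k) \<^bold>\<in> f \<^bold>\<and> \<^bold>\<langle>i \<le> k\<^bold>\<rangle>))" for x i
    unfolding B_def by (rule mem_set_of_eq) (auto intro!: extnI)
  define C where "C i = (SetOf x. x \<^bold>\<in> A \<^bold>\<and> (x, i) \<^bold>\<in> f)" for i
  have C: "(x \<^bold>\<in> C i) = (x \<^bold>\<in> A \<^bold>\<and> (x, i) \<^bold>\<in> f)" for x i
    unfolding C_def by (rule mem_set_of_eq) (auto intro!: extnI)
  have BX: "(B i \<^bold>\<subseteq> X) r" for i
    by (rule subset_trans[OF _ ultrafilter_sub[OF Ur Ar]], rule subsetI) (simp add: B f_and_iff)
  have CX: "(C i \<^bold>\<subseteq> X) r" for i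
    by (rule subset_trans[OF _ ultrafilter_sub[OF Ur Ar]], rule subsetI) (simp add: C f_and_iff)
  \<comment> \<open>\<open>nonprincipal\<close> speaks of singletons of named elements, so an
    element of \<open>C i\<close> must first be given a name.\<close>
  have "(\<^bold>\<not>(C i \<^bold>\<in> \<U>)) r" for i
  proof (rule f_notI)
    fix q assume q: "q \<le> r" "(C i \<^bold>\<in> \<U>) q"
    obtain t x where t: "t \<le> q" "(x \<^bold>\<in> C i) t"
      using ultrafilter_nonempty[OF ultrafilter_lower[OF Ur q(1)] q(2)] by blast
    have tr: "t \<le> r" using order_trans[OF t(1) q(1)] .
    have "(C i \<^bold>= (SetOf y. y \<^bold>= x)) t"
    proof (rule set_eqI)
      fix u y assume u: "u \<le> t"
      have x: "(x \<^bold>\<in> C i) u" using mem_lower[OF t(2) u] .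
      show "(y \<^bold>\<in> C i) u \<longleftrightarrow> (y \<^bold>\<in> (SetOf y. y \<^bold>= x)) u"
        using injectiveD[OF injective_lower[OF f(2) order_trans[OF u tr]], of y i x] x
          mem_subst[OF x, of y] eq_sym[of y x u]
        by (auto simp: C f_and_iff)
    qed
    then have "((SetOf y. y \<^bold>= x) \<^bold>\<in> \<U>) t" by (rule mem_subst[OF mem_lower[OF q(2) t(1)]])
    moreover have "(\<^bold>\<not>((SetOf y. y \<^bold>= x) \<^bold>\<in> \<U>)) p"
      using np by (simp add: nonprincipal_def f_all_iff)
    ultimately show False using f_notE[OF _ order_trans[OF tr r]] by blast
  qed
  then have C': "(X \<^bold>- C i \<^bold>\<in> \<U>) r" for i
    using ultrafilter_compl[OF Ur CX] by blast
  have fA: "(\<^bold>\<exists>k. (x, k) \<^bold>\<in> f) q" if "q \<le> r" "(x \<^bold>\<in> A) q" for q x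
    using func_total[OF func_lower[OF f(1) that(1)] that(2)] .
  have "(B i \<^bold>\<in> \<U>) r" for i
  proof (induction i)
    case 0
    show ?case
    proof (rule ultrafilter_up[OF Ur Ar _ BX], rule subsetI)
      fix q x assume q: "q \<le> r" "(x \<^bold>\<in> A) q"
      have "(\<^bold>\<exists>k. (x, k) \<^bold>\<in> f \<^bold>\<and> \<^bold>\<langle>0 \<le> k\<^bold>\<rangle>) q"
      proof (rule f_exE[OF fA[OF q]])
        fix t k assume "t \<le> q" "((x, k) \<^bold>\<in> f) t"
        then show "(\<^bold>\<exists>k. (x, k) \<^bold>\<in> f \<^bold>\<and> \<^bold>\<langle>0 \<le> k\<^bold>\<rangle>) t"
          by (intro f_exI[of _ k]) (simp_all add: f_and_iff)
      qed simp
      with q(2) show "(x \<^bold>\<in> B 0) q" by (simp add: B f_and_iff)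
    qed
  next
    case (Suc i)
    show ?case
    proof (rule ultrafilter_up[OF Ur ultrafilter_int[OF Ur Suc.IH C'] _ BX], rule subsetI)
      fix q x assume q: "q \<le> r" "(x \<^bold>\<in> B i \<^bold>\<inter> (X \<^bold>- C i)) q"
      then have x: "(x \<^bold>\<in> A) q" "(\<^bold>\<exists>k. (x, k) \<^bold>\<in> f \<^bold>\<and> \<^bold>\<langle>i \<le> k\<^bold>\<rangle>) q" "(\<^bold>\<not>(x \<^bold>\<in> C i)) q"
        by (simp_all add: B f_and_iff)
      have "(\<^bold>\<exists>k. (x, k) \<^bold>\<in> f \<^bold>\<and> \<^bold>\<langle>Suc i \<le> k\<^bold>\<rangle>) q"
      proof (rule f_exE[OF x(2)])
        fix t k assume t: "t \<le> q" "((x, k) \<^bold>\<in> f \<^bold>\<and> \<^bold>\<langle>i \<le> k\<^bold>\<rangle>) t"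
        have "k \<noteq> i"
          using f_notE[OF x(3) t(1)] t(2) mem_lower[OF x(1) t(1)] by (auto simp: C f_and_iff)
        with t(2) show "(\<^bold>\<exists>k. (x, k) \<^bold>\<in> f \<^bold>\<and> \<^bold>\<langle>Suc i \<le> k\<^bold>\<rangle>) t"
          by (intro f_exI[of _ k]) (simp_all add: f_and_iff)
      qed simp
      with x(1) show "(x \<^bold>\<in> B (Suc i)) q" by (simp add: B f_and_iff)
    qed
  qed
  then obtain q x where q: "q \<le> r" "(x \<^bold>\<in> B n) q" using ultrafilter_nonempty[OF Ur] by blast
  then have "(\<^bold>\<exists>k. (x, k) \<^bold>\<in> f \<^bold>\<and> \<^bold>\<langle>n \<le> k\<^bold>\<rangle>) q" by (simp add: B f_and_iff)
  then obtain t k where t: "t \<le> q" "((x, k) \<^bold>\<in> f) t" "n \<le> k"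
    using f_ex_andD[of "\<lambda>k. (x, k) \<^bold>\<in> f"] by fastforce
  show False
    using func_cod[OF func_lower[OF f(1) order_trans[OF t(1) q(1)]] t(2)] t(3) by simp
qed

text \<open>The inverse image of \<open>B\<close> under \<open>g\<close>. It replaces the direct
  images in \<open>image_filter\<close> by the criterion of \<open>image_filter_iff\<close>, to
  which the ultrafilter axioms transfer directly.\<close>

definition vim :: "('a::names \<times> 'b::names) setn \<Rightarrow> 'b setn \<Rightarrow> 'a setn" where
  "vim g B = (SetOf x. \<^bold>\<exists>y. y \<^bold>\<in> B \<^bold>\<and> (x, y) \<^bold>\<in> g)"

lemma mem_vim [simp]: "(x \<^bold>\<in> vim g B) = (\<^bold>\<exists>y. y \<^bold>\<in> B \<^bold>\<and> (x, y) \<^bold>\<in> g)"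
  unfolding vim_def by (rule mem_set_of_eq) (auto intro!: extnI)

lemma vim_sub:
  assumes "func g X Y p"
  shows "(vim g B \<^bold>\<subseteq> X) p"
proof (rule subsetI)
  fix q x assume q: "q \<le> p" "(x \<^bold>\<in> vim g B) q"
  show "(x \<^bold>\<in> X) q"
  proof (rule f_exE[OF q(2)[unfolded mem_vim] stable_mem])
    fix r y assume r: "r \<le> q" "(y \<^bold>\<in> B \<^bold>\<and> (x, y) \<^bold>\<in> g) r"
    then show "(x \<^bold>\<in> X) r"
      using func_dom[OF func_lower[OF assms order_trans[OF r(1) q(1)]]] unfolding f_and_iff by blast
  qed
qed

lemma mem_vim_iff:
  assumes "func g X Y p" "((x, y) \<^bold>\<in> g) p"
  shows "(x \<^bold>\<in> vim g B) p \<longleftrightarrow> (y \<^bold>\<in> B) p"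
proof
  assume "(x \<^bold>\<in> vim g B) p"
  then show "(y \<^bold>\<in> B) p"
    unfolding mem_vim
  proof (rule f_exE[OF _ stable_mem])
    fix r y' assume r: "r \<le> p" "(y' \<^bold>\<in> B \<^bold>\<and> (x, y') \<^bold>\<in> g) r"
    then have "(y' \<^bold>= y) r"
      using func_unique[OF func_lower[OF assms(1) r(1)] _ mem_lower[OF assms(2) r(1)]]
      by (simp add: f_and_iff)
    with r(2) show "(y \<^bold>\<in> B) r" using mem_subst by (auto simp: f_and_iff)
  qed
next
  assume "(y \<^bold>\<in> B) p"
  with assms(2) show "(x \<^bold>\<in> vim g B) p"
    unfolding mem_vim by (intro f_exI[of _ y]) (simp_all add: f_and_iff)
qed

text \<open>To prove a property of \<open>x\<close> in the domain of \<open>g\<close>, one may assume that the value \<open>g(x)\<close> has a name.\<close>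

lemma func_valueE:
  assumes "func g X Y p" "(x \<^bold>\<in> X) p" "stable \<psi>"
    and "\<And>q y. q \<le> p \<Longrightarrow> ((x, y) \<^bold>\<in> g) q \<Longrightarrow> (y \<^bold>\<in> Y) q \<Longrightarrow> \<psi> q"
  shows "\<psi> p"
  using func_total[OF assms(1,2)] assms(3)
proof (rule f_exE)
  fix q y assume "q \<le> p" "((x, y) \<^bold>\<in> g) q"
  with assms(4) func_cod[OF func_lower[OF assms(1)]] show "\<psi> q" by blast
qed

lemma mem_image_filter:
  "(B \<^bold>\<in> image_filter g Y \<U>) = (B \<^bold>\<subseteq> Y \<^bold>\<and> (\<^bold>\<exists>Z. Z \<^bold>\<in> \<U> \<^bold>\<and> img g Z \<^bold>\<subseteq> B))"
  unfolding image_filter_def by (rule mem_set_of_eq) (auto intro!: extnI)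

lemma image_filter_iff:
  assumes g: "func g X Y p" and U: "ultrafilter X \<U> p"
  shows "(B \<^bold>\<in> image_filter g Y \<U>) p \<longleftrightarrow> (B \<^bold>\<subseteq> Y) p \<and> (vim g B \<^bold>\<in> \<U>) p"
proof -
  have "(vim g B \<^bold>\<in> \<U>) p" if "(\<^bold>\<exists>Z. Z \<^bold>\<in> \<U> \<^bold>\<and> img g Z \<^bold>\<subseteq> B) p"
    using that stable_mem
  proof (rule f_exE)
    fix q Z assume q: "q \<le> p" "(Z \<^bold>\<in> \<U> \<^bold>\<and> img g Z \<^bold>\<subseteq> B) q"
    have gq: "func g X Y q" and Uq: "ultrafilter X \<U> q"
      using func_lower[OF g q(1)] ultrafilter_lower[OF U q(1)] .
    have "(Z \<^bold>\<subseteq> vim g B) q"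
    proof (rule subsetI)
      fix r x assume r: "r \<le> q" "(x \<^bold>\<in> Z) r"
      have gr: "func g X Y r" using func_lower[OF gq r(1)] .
      have "(x \<^bold>\<in> X) r"
        using subsetD[OF subset_lower[OF ultrafilter_sub[OF Uq] r(1)] r(2)] q(2)
        by (simp add: f_and_iff)
      then show "(x \<^bold>\<in> vim g B) r"
      proof (rule func_valueE[OF gr _ stable_mem])
        fix t y assume t: "t \<le> r" "((x, y) \<^bold>\<in> g) t"
        have "(y \<^bold>\<in> img g Z) t"
          unfolding mem_img
          by (rule f_exI[of _ x]) (use t mem_lower[OF r(2) t(1)] in \<open>simp_all add: f_and_iff\<close>)
        moreover have "(img g Z \<^bold>\<subseteq> B) t"
          using subset_lower[OF _ order_trans[OF t(1) r(1)]] q(2) unfolding f_and_iff by blast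
        ultimately have "(y \<^bold>\<in> B) t" by (rule subsetD[rotated])
        then show "(x \<^bold>\<in> vim g B) t" using mem_vim_iff[OF func_lower[OF gr t(1)] t(2)] by simp
      qed
    qed
    then show "(vim g B \<^bold>\<in> \<U>) q"
      using ultrafilter_up[OF Uq _ _ vim_sub[OF gq]] q(2) unfolding f_and_iff by blast
  qed
  moreover have "(\<^bold>\<exists>Z. Z \<^bold>\<in> \<U> \<^bold>\<and> img g Z \<^bold>\<subseteq> B) p" if V: "(vim g B \<^bold>\<in> \<U>) p"
  proof -
    have "(img g (vim g B) \<^bold>\<subseteq> B) p"
    proof (rule subsetI)
      fix q y assume q: "q \<le> p" "(y \<^bold>\<in> img g (vim g B)) q"
      show "(y \<^bold>\<in> B) q"
      proof (rule f_exE[OF q(2)[unfolded mem_img] stable_mem])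
        fix r x assume r: "r \<le> q" "(x \<^bold>\<in> vim g B \<^bold>\<and> (x, y) \<^bold>\<in> g) r"
        then show "(y \<^bold>\<in> B) r"
          using mem_vim_iff[OF func_lower[OF g order_trans[OF r(1) q(1)]]] unfolding f_and_iff by blast
      qed
    qed
    with V show ?thesis by (intro f_exI[of _ "vim g B"]) (simp_all add: f_and_iff)
  qed
  ultimately show ?thesis by (auto simp: mem_image_filter f_and_iff)
qed

lemma image_filterI:
  assumes "func g X Y p" "ultrafilter X \<U> p" "(A \<^bold>\<in> \<U>) p" "(B \<^bold>\<subseteq> Y) p"
    and "\<And>q x y. q \<le> p \<Longrightarrow> (x \<^bold>\<in> A) q \<Longrightarrow> ((x, y) \<^bold>\<in> g) q \<Longrightarrow> (y \<^bold>\<in> B) q"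
  shows "(B \<^bold>\<in> image_filter g Y \<U>) p"
proof -
  have "(A \<^bold>\<subseteq> vim g B) p"
  proof (rule subsetI)
    fix q x assume q: "q \<le> p" "(x \<^bold>\<in> A) q"
    have gq: "func g X Y q" using func_lower[OF assms(1) q(1)] .
    have "(x \<^bold>\<in> X) q"
      using subsetD[OF subset_lower[OF ultrafilter_sub[OF assms(2,3)] q(1)] q(2)] .
    then show "(x \<^bold>\<in> vim g B) q"
    proof (rule func_valueE[OF gq _ stable_mem])
      fix r y assume r: "r \<le> q" "((x, y) \<^bold>\<in> g) r"
      then show "(x \<^bold>\<in> vim g B) r"
        using mem_vim_iff[OF func_lower[OF gq r(1)] r(2)]
          assms(5)[OF order_trans[OF r(1) q(1)] mem_lower[OF q(2) r(1)] r(2)] by simp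
    qed
  qed
  then show ?thesis
    using ultrafilter_up[OF assms(2,3) _ vim_sub[OF assms(1)]] assms(4)
    by (simp add: image_filter_iff[OF assms(1,2)])
qed

lemma ultrafilter_image:
  assumes g: "func g X Y p" and U: "ultrafilter X \<U> p"
  shows "ultrafilter Y (image_filter g Y \<U>) p"
proof -
  let ?V = "image_filter g Y \<U>"
  have gq: "func g X Y q" and Uq: "ultrafilter X \<U> q" if "q \<le> p" for q
    using func_lower[OF g that] ultrafilter_lower[OF U that] .
  note iff = image_filter_iff[OF gq Uq]
  note I = image_filterI[OF gq Uq]
  show ?thesis
  proof (rule ultrafilterI)
    fix q A assume q: "q \<le> p" "(A \<^bold>\<in> ?V) q"
    then show "(A \<^bold>\<subseteq> Y) q" by (simp add: iff)
  next
    show "(Y \<^bold>\<in> ?V) p"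
      using func_cod[OF gq]
      by (intro I[OF order_refl order_refl ultrafilter_space[OF U]]) simp_all
  next
    fix q assume q: "q \<le> p" "(check {} \<^bold>\<in> ?V) q"
    then have "(vim g (check {}) \<^bold>\<in> \<U>) q" by (simp add: iff)
    then obtain r x where r: "r \<le> q" "(x \<^bold>\<in> vim g (check {})) r"
      using ultrafilter_nonempty[OF Uq[OF q(1)]] by blast
    then show False using f_ex_andD[of "\<lambda>y. y \<^bold>\<in> check {}" _ r] by simp
  next
    fix q A B assume q: "q \<le> p" and A: "(A \<^bold>\<in> ?V) q" "(A \<^bold>\<subseteq> B) q" "(B \<^bold>\<subseteq> Y) q"
    have V: "(vim g A \<^bold>\<in> \<U>) q" using A q by (simp add: iff)
    show "(B \<^bold>\<in> ?V) q"
    proof (rule I[OF q q V A(3)])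
      fix r x y assume r: "r \<le> q" "(x \<^bold>\<in> vim g A) r" "((x, y) \<^bold>\<in> g) r"
      then have "(y \<^bold>\<in> A) r" using mem_vim_iff[OF gq[OF order_trans[OF r(1) q]]] by blast
      then show "(y \<^bold>\<in> B) r" using subsetD[OF subset_lower[OF A(2) r(1)]] by blast
    qed
  next
    fix q A B assume q: "q \<le> p" and A: "(A \<^bold>\<in> ?V) q" "(B \<^bold>\<in> ?V) q"
    have V: "(vim g A \<^bold>\<in> \<U>) q" "(vim g B \<^bold>\<in> \<U>) q" "(A \<^bold>\<subseteq> Y) q" using A q by (simp_all add: iff)
    have "(A \<^bold>\<inter> B \<^bold>\<subseteq> Y) q"
      by (rule subset_trans[OF _ V(3)], rule subsetI) (simp add: f_and_iff)
    then show "(A \<^bold>\<inter> B \<^bold>\<in> ?V) q"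
    proof (rule I[OF q q ultrafilter_int[OF Uq[OF q] V(1,2)]])
      fix r x y assume r: "r \<le> q" "(x \<^bold>\<in> vim g A \<^bold>\<inter> vim g B) r" "((x, y) \<^bold>\<in> g) r"
      then show "(y \<^bold>\<in> A \<^bold>\<inter> B) r"
        using mem_vim_iff[OF gq[OF order_trans[OF r(1) q]] r(3)]
        by (auto simp: f_and_iff simp del: mem_vim)
    qed
  next
    fix q A assume q: "q \<le> p" "(A \<^bold>\<subseteq> Y) q"
    show "(A \<^bold>\<in> ?V \<^bold>\<or> Y \<^bold>- A \<^bold>\<in> ?V) q"
      unfolding f_or_iff
    proof (intro allI impI)
      fix q' assume q': "q' \<le> q"
      have q'p: "q' \<le> p" using order_trans[OF q' q(1)] .
      obtain r where r: "r \<le> q'" "(vim g A \<^bold>\<in> \<U>) r \<or> (X \<^bold>- vim g A \<^bold>\<in> \<U>) r"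
        using ultrafilter_or[OF Uq[OF q'p] vim_sub[OF gq[OF q'p]]] order_refl
        unfolding f_or_iff by blast
      have rp: "r \<le> p" using order_trans[OF r(1) q'p] .
      have "(Y \<^bold>- A \<^bold>\<in> ?V) r" if V: "(X \<^bold>- vim g A \<^bold>\<in> \<U>) r"
      proof (rule I[OF rp rp V])
        show "(Y \<^bold>- A \<^bold>\<subseteq> Y) r" by (rule subsetI) (simp add: f_and_iff)
      next
        fix t x y assume t: "t \<le> r" "(x \<^bold>\<in> X \<^bold>- vim g A) t" "((x, y) \<^bold>\<in> g) t"
        have gt: "func g X Y t" using gq[OF order_trans[OF t(1) rp]] .
        have "(\<^bold>\<not>(y \<^bold>\<in> A)) t"
        proof (rule f_notI)
          fix u assume u: "u \<le> t" "(y \<^bold>\<in> A) u"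
          then have "(x \<^bold>\<in> vim g A) u"
            using mem_vim_iff[OF func_lower[OF gt u(1)] mem_lower[OF t(3) u(1)]] by blast
          moreover have "(\<^bold>\<not>(x \<^bold>\<in> vim g A)) t" using t(2) by (simp add: f_and_iff)
          ultimately show False using f_notE[OF _ u(1)] by blast
        qed
        with func_cod[OF gt t(3)] show "(y \<^bold>\<in> Y \<^bold>- A) t" by (simp add: f_and_iff)
      qed
      moreover have "(A \<^bold>\<subseteq> Y) r" using subset_lower[OF q(2) order_trans[OF r(1) q']] .
      ultimately show "\<exists>r\<le>q'. (A \<^bold>\<in> ?V) r \<or> (Y \<^bold>- A \<^bold>\<in> ?V) r"
        using r rp by (auto simp: iff)
    qed
  qed
qed

lemma mem_fibre [simp]: "(x \<^bold>\<in> fibre g A y) = (x \<^bold>\<in> A \<^bold>\<and> (x, y) \<^bold>\<in> g)"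
  unfolding fibre_def by (rule mem_set_of_eq) (auto intro!: extnI)

lemma eq_fibre [simp]: "(g \<^bold>= g') p \<Longrightarrow> (A \<^bold>= A') p \<Longrightarrow> (y \<^bold>= y') p \<Longrightarrow> (fibre g A y \<^bold>= fibre g' A' y') p"
  by (simp add: fibre_def)

text \<open>If a singleton were in the image, the fibre of \<open>g\<close> in \<open>A\<close> over
  its point would be in \<open>\<U>\<close>, although it is finite. In the application,
  \<open>A\<close> comes from an element of \<open>L\<close>.\<close>

lemma nonprincipal_image:
  assumes g: "func g X Y p" and U: "ultrafilter X \<U> p" and np: "nonprincipal \<U> p"
    and A: "(A \<^bold>\<in> \<U>) p" and fin: "\<And>q y. q \<le> p \<Longrightarrow> (y \<^bold>\<in> Y) q \<Longrightarrow> fin (fibre g A y) q"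
  shows "nonprincipal (image_filter g Y \<U>) p"
  unfolding nonprincipal_def f_all_iff
proof (intro allI f_notI)
  fix y q assume q: "q \<le> p" "((SetOf y'. y' \<^bold>= y) \<^bold>\<in> image_filter g Y \<U>) q"
  have gq: "func g X Y q" and Uq: "ultrafilter X \<U> q"
    using func_lower[OF g q(1)] ultrafilter_lower[OF U q(1)] .
  have *: "((SetOf y'. y' \<^bold>= y) \<^bold>\<subseteq> Y) q" "(vim g (SetOf y'. y' \<^bold>= y) \<^bold>\<in> \<U>) q"
    using q(2) by (simp_all add: image_filter_iff[OF gq Uq])
  have Aq: "(A \<^bold>\<in> \<U>) q" using mem_lower[OF A q(1)] .
  have "(y \<^bold>\<in> Y) q" using subsetD[OF *(1), of y] by simp
  then have fin: "fin (fibre g A y) q" using fin[OF q(1)] by blast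
  have "(fibre g A y \<^bold>\<subseteq> X) q"
    by (rule subset_trans[OF _ ultrafilter_sub[OF Uq Aq]], rule subsetI) (simp add: f_and_iff)
  moreover have "(vim g (SetOf y'. y' \<^bold>= y) \<^bold>\<inter> A \<^bold>\<subseteq> fibre g A y) q"
  proof (rule subsetI)
    fix r x assume r: "r \<le> q" "(x \<^bold>\<in> vim g (SetOf y'. y' \<^bold>= y) \<^bold>\<inter> A) r"
    then have x: "(\<^bold>\<exists>y'. y' \<^bold>= y \<^bold>\<and> (x, y') \<^bold>\<in> g) r" "(x \<^bold>\<in> A) r" by (simp_all add: f_and_iff)
    have "((x, y) \<^bold>\<in> g) r"
    proof (rule f_exE[OF x(1) stable_mem])
      fix t y' assume "t \<le> r" "(y' \<^bold>= y \<^bold>\<and> (x, y') \<^bold>\<in> g) t"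
      then show "((x, y) \<^bold>\<in> g) t"
        using mem_subst[of "(x, y')" g t "(x, y)"] by (simp add: f_and_iff)
    qed
    with x(2) show "(x \<^bold>\<in> fibre g A y) r" by (simp add: f_and_iff)
  qed
  ultimately have "(fibre g A y \<^bold>\<in> \<U>) q"
    using ultrafilter_up[OF Uq ultrafilter_int[OF Uq *(2) Aq]] by blast
  then show False
    using ultrafilter_fin[OF Uq stable_mono[OF stable_nonprincipal np q(1)] _ fin] by blast
qed

section \<open>P-points, their images and countability\<close>

lemma stable_p_ultrafilter [simp]: "stable (p_ultrafilter X \<U>)"
  by (simp add: p_ultrafilter_def)

lemma eqv_p_ultrafilter [simp]:
  "(X \<^bold>= X') p \<Longrightarrow> (\<U> \<^bold>= \<U>') p \<Longrightarrow> eqv p (p_ultrafilter X \<U>) (p_ultrafilter X' \<U>')"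
  by (simp add: p_ultrafilter_def)

text \<open>A ground-model sequence of names is itself turned into the name of a sequence, to which
  the p-point property applies.\<close>

lemma p_ultrafilter_sequence:
  fixes D :: "nat \<Rightarrow> 'a::names setn"
  assumes U: "p_ultrafilter X \<U> p" and D: "\<And>i. (D i \<^bold>\<in> \<U>) p" "\<And>i. (D (Suc i) \<^bold>\<subseteq> D i) p"
  shows "(\<^bold>\<exists>A. A \<^bold>\<in> \<U> \<^bold>\<and> (\<^bold>\<forall>i. fin (A \<^bold>- D i))) p"
proof -
  define \<A> where "\<A> = (SetOf z. snd z \<^bold>= D (fst z))"
  have "(z \<^bold>\<in> \<A>) = (snd z \<^bold>= D (fst z))" for z
    unfolding \<A>_def
  proof (rule mem_set_of_eq[OF stable_eq], rule extnI)
    fix z z' :: "nat \<times> 'a setn" and q assume z: "(z \<^bold>= z') q"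
    then have "fst z = fst z'" using f_eq_fst[OF z] by simp
    with z show "eqv q (snd z \<^bold>= D (fst z)) (snd z' \<^bold>= D (fst z'))" by simp
  qed
  then have \<A>: "((i, B) \<^bold>\<in> \<A>) = (B \<^bold>= D i)" for i B by simp
  have func: "func \<A> omega \<U> p"
  proof (rule funcI)
    fix q i B assume q: "q \<le> p" "((i, B) \<^bold>\<in> \<A>) q"
    then show "(i \<^bold>\<in> omega) q \<and> (B \<^bold>\<in> \<U>) q"
      using mem_subst[OF mem_lower[OF D(1) q(1)]] eq_sym[of B "D i" q] by (simp add: \<A>)
  next
    fix q i
    show "(\<^bold>\<exists>B. (i, B) \<^bold>\<in> \<A>) q" by (rule f_exI[of _ "D i"]) (simp_all add: \<A>)
  next
    fix q i B B' assume "((i, B) \<^bold>\<in> \<A>) q" "((i, B') \<^bold>\<in> \<A>) q"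
    then show "(B \<^bold>= B') q" unfolding \<A> by (meson eq_sym eq_trans)
  qed
  have dec: "(\<^bold>\<forall>i A B. (i, A) \<^bold>\<in> \<A> \<^bold>\<and> (Suc i, B) \<^bold>\<in> \<A> \<^bold>\<longrightarrow> B \<^bold>\<subseteq> A) p"
    unfolding f_all_iff
  proof (intro allI f_impI)
    fix i A B q assume q: "q \<le> p" "((i, A) \<^bold>\<in> \<A> \<^bold>\<and> (Suc i, B) \<^bold>\<in> \<A>) q"
    then show "(B \<^bold>\<subseteq> A) q"
      using eqvD[OF eqv_subset[of B "D (Suc i)" q A "D i"]] subset_lower[OF D(2) q(1)]
      by (simp add: \<A> f_and_iff)
  qed simp_all
  have "(\<^bold>\<forall>\<A>. func \<A> omega \<U> \<^bold>\<and> (\<^bold>\<forall>i A B. (i, A) \<^bold>\<in> \<A> \<^bold>\<and> (Suc i, B) \<^bold>\<in> \<A> \<^bold>\<longrightarrow> B \<^bold>\<subseteq> A) \<^bold>\<longrightarrow>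
         (\<^bold>\<exists>A. A \<^bold>\<in> \<U> \<^bold>\<and> (\<^bold>\<forall>i B. (i, B) \<^bold>\<in> \<A> \<^bold>\<longrightarrow> fin (A \<^bold>- B)))) p"
    using U by (simp add: p_ultrafilter_def f_and_iff)
  then have "(\<^bold>\<exists>A. A \<^bold>\<in> \<U> \<^bold>\<and> (\<^bold>\<forall>i B. (i, B) \<^bold>\<in> \<A> \<^bold>\<longrightarrow> fin (A \<^bold>- B))) p"
  proof (rule f_impE[OF f_allD[where x = \<A>]])
    show "(func \<A> omega \<U> \<^bold>\<and> (\<^bold>\<forall>i A B. (i, A) \<^bold>\<in> \<A> \<^bold>\<and> (Suc i, B) \<^bold>\<in> \<A> \<^bold>\<longrightarrow> B \<^bold>\<subseteq> A)) p"
      using func dec by (rule f_andI)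
  qed simp_all
  then show ?thesis
  proof (rule f_exE)
    fix q A assume q: "q \<le> p" "(A \<^bold>\<in> \<U> \<^bold>\<and> (\<^bold>\<forall>i B. (i, B) \<^bold>\<in> \<A> \<^bold>\<longrightarrow> fin (A \<^bold>- B))) q"
    have "fin (A \<^bold>- D i) q" for i
    proof (rule f_impE[where \<phi> = "(i, D i) \<^bold>\<in> \<A>"])
      show "((i, D i) \<^bold>\<in> \<A> \<^bold>\<longrightarrow> fin (A \<^bold>- D i)) q" using q(2) by (simp add: f_and_iff f_all_iff)
    qed (simp_all add: \<A>)
    with q(2) show "(\<^bold>\<exists>A. A \<^bold>\<in> \<U> \<^bold>\<and> (\<^bold>\<forall>i. fin (A \<^bold>- D i))) q"
      by (intro f_exI[of _ A]) (simp_all add: f_and_iff f_all_iff)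
  qed simp
qed

text \<open>A pseudo-intersection of the inverse images of a decreasing sequence is mapped by
  \<open>g\<close> to one of the sequence, because images of finite sets are finite. The finite
  fibres of \<open>A\<close> guarantee that the image is nonprincipal.\<close>

lemma p_ultrafilter_image:
  fixes g :: "('a::names \<times> 'b::names) setn"
  assumes g: "func g X Y p" and PU: "p_ultrafilter X \<U> p"
    and A: "(A \<^bold>\<in> \<U>) p" and fin: "\<And>q y. q \<le> p \<Longrightarrow> (y \<^bold>\<in> Y) q \<Longrightarrow> fin (fibre g A y) q"
  shows "p_ultrafilter Y (image_filter g Y \<U>) p"
proof -
  let ?V = "image_filter g Y \<U>"
  have U: "ultrafilter X \<U> p" "nonprincipal \<U> p" using PU by (simp_all add: p_ultrafilter_def f_and_iff)
  have V: "ultrafilter Y ?V p" using ultrafilter_image[OF g U(1)] .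
  have "(\<^bold>\<forall>\<A>. func \<A> omega ?V \<^bold>\<and> (\<^bold>\<forall>i A B. (i, A) \<^bold>\<in> \<A> \<^bold>\<and> (Suc i, B) \<^bold>\<in> \<A> \<^bold>\<longrightarrow> B \<^bold>\<subseteq> A) \<^bold>\<longrightarrow>
         (\<^bold>\<exists>A. A \<^bold>\<in> ?V \<^bold>\<and> (\<^bold>\<forall>i B. (i, B) \<^bold>\<in> \<A> \<^bold>\<longrightarrow> fin (A \<^bold>- B)))) p"
  proof (rule f_all_iff[THEN iffD2], intro allI f_impI)
    fix \<A> :: "(nat \<times> 'b setn) setn" and q
    let ?goal = "\<^bold>\<exists>A. A \<^bold>\<in> ?V \<^bold>\<and> (\<^bold>\<forall>i B. (i, B) \<^bold>\<in> \<A> \<^bold>\<longrightarrow> fin (A \<^bold>- B))"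
    assume q: "q \<le> p"
      and "(func \<A> omega ?V \<^bold>\<and> (\<^bold>\<forall>i A B. (i, A) \<^bold>\<in> \<A> \<^bold>\<and> (Suc i, B) \<^bold>\<in> \<A> \<^bold>\<longrightarrow> B \<^bold>\<subseteq> A)) q"
    then have \<A>: "func \<A> omega ?V q"
      and dec: "\<And>r i A B. r \<le> q \<Longrightarrow> ((i, A) \<^bold>\<in> \<A>) r \<Longrightarrow> ((Suc i, B) \<^bold>\<in> \<A>) r \<Longrightarrow> (B \<^bold>\<subseteq> A) r"
      by (simp_all add: f_and_iff f_all_iff f_imp_iff)
    have gr: "func g X Y r" and Ur: "ultrafilter X \<U> r" if "r \<le> q" for r
      using func_lower[OF g order_trans[OF that q]] ultrafilter_lower[OF U(1) order_trans[OF that q]] .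
    \<comment> \<open>The sequence is given only by a name, so its \<open>i\<close>-th member is
      quantified in the forcing language instead of being chosen outside; \<open>D i\<close> then
      has a name for each ordinary number \<open>i\<close>.\<close>
    define D where "D i = (SetOf x. \<^bold>\<exists>B. (i, B) \<^bold>\<in> \<A> \<^bold>\<and> x \<^bold>\<in> vim g B)" for i
    have D: "(x \<^bold>\<in> D i) = (\<^bold>\<exists>B. (i, B) \<^bold>\<in> \<A> \<^bold>\<and> x \<^bold>\<in> vim g B)" for x i
      unfolding D_def by (rule mem_set_of_eq) (auto intro!: extnI)
    have ex: "(\<^bold>\<exists>B. (i, B) \<^bold>\<in> \<A>) r" if "r \<le> q" for i r
      using func_total[OF func_lower[OF \<A> that], of i] by simp
    have DX: "(D i \<^bold>\<subseteq> X) r" if r: "r \<le> q" for i r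
    proof (rule subsetI)
      fix t x assume t: "t \<le> r" "(x \<^bold>\<in> D i) t"
      show "(x \<^bold>\<in> X) t"
      proof (rule f_exE[OF t(2)[unfolded D] stable_mem])
        fix u B assume u: "u \<le> t" "((i, B) \<^bold>\<in> \<A> \<^bold>\<and> x \<^bold>\<in> vim g B) u"
        have "u \<le> q" using order_trans[OF u(1) order_trans[OF t(1) r]] .
        with u(2) show "(x \<^bold>\<in> X) u" using subsetD[OF vim_sub[OF gr]] by (auto simp: f_and_iff simp del: mem_vim)
      qed
    qed
    have "(D i \<^bold>\<in> \<U>) q" for i
    proof (rule f_exE[OF ex[OF order_refl] stable_mem])
      fix r B assume r: "r \<le> q" "((i, B) \<^bold>\<in> \<A>) r"
      have "(B \<^bold>\<in> ?V) r" using func_cod[OF func_lower[OF \<A> r(1)] r(2)] .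
      then have "(vim g B \<^bold>\<in> \<U>) r" using image_filter_iff[OF gr[OF r(1)] Ur[OF r(1)]] by simp
      then show "(D i \<^bold>\<in> \<U>) r"
      proof (rule ultrafilter_up[OF Ur[OF r(1)] _ _ DX[OF r(1)]], intro subsetI)
        fix t x assume t: "t \<le> r" "(x \<^bold>\<in> vim g B) t"
        then show "(x \<^bold>\<in> D i) t" unfolding D using mem_lower[OF r(2) t(1)]
          by (intro f_exI[of _ B]) (simp_all add: f_and_iff)
      qed
    qed
    moreover have "(D (Suc i) \<^bold>\<subseteq> D i) q" for i
    proof (rule subsetI)
      fix r x assume r: "r \<le> q" "(x \<^bold>\<in> D (Suc i)) r"
      show "(x \<^bold>\<in> D i) r"
      proof (rule f_exE[OF r(2)[unfolded D] stable_mem])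
        fix t B assume t: "t \<le> r" "((Suc i, B) \<^bold>\<in> \<A> \<^bold>\<and> x \<^bold>\<in> vim g B) t"
        have tq: "t \<le> q" using order_trans[OF t(1) r(1)] .
        show "(x \<^bold>\<in> D i) t"
        proof (rule f_exE[OF ex[OF tq] stable_mem])
          fix u B' assume u: "u \<le> t" "((i, B') \<^bold>\<in> \<A>) u"
          have uq: "u \<le> q" using order_trans[OF u(1) tq] .
          have B: "((Suc i, B) \<^bold>\<in> \<A>) u" "(x \<^bold>\<in> vim g B) u"
            using t(2) mem_lower[OF _ u(1)] unfolding f_and_iff by blast+
          have sub: "(B \<^bold>\<subseteq> B') u" using dec[OF uq u(2) B(1)] .
          have "(x \<^bold>\<in> X) u" using subsetD[OF vim_sub[OF gr[OF uq]] B(2)] .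
          then have "(x \<^bold>\<in> vim g B') u"
          proof (rule func_valueE[OF gr[OF uq] _ stable_mem])
            fix v y assume v: "v \<le> u" "((x, y) \<^bold>\<in> g) v"
            note iff = mem_vim_iff[OF gr[OF order_trans[OF v(1) uq]] v(2)]
            have "(y \<^bold>\<in> B) v" using iff mem_lower[OF B(2) v(1)] by blast
            then show "(x \<^bold>\<in> vim g B') v" using iff subsetD[OF subset_lower[OF sub v(1)]] by blast
          qed
          with u(2) show "(x \<^bold>\<in> D i) u" unfolding D
            by (intro f_exI[of _ B']) (simp_all add: f_and_iff)
        qed
      qed
    qed
    ultimately have "(\<^bold>\<exists>A. A \<^bold>\<in> \<U> \<^bold>\<and> (\<^bold>\<forall>i. fin (A \<^bold>- D i))) q"
      using p_ultrafilter_sequence[OF stable_mono[OF stable_p_ultrafilter PU q]] by blast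
    then show "?goal q"
    proof (rule f_exE)
      fix r A assume r: "r \<le> q" and A: "(A \<^bold>\<in> \<U> \<^bold>\<and> (\<^bold>\<forall>i. fin (A \<^bold>- D i))) r"
      have AU: "(A \<^bold>\<in> \<U>) r" and fin: "fin (A \<^bold>- D i) r" for i
        using A by (simp_all add: f_and_iff f_all_iff)
      have AX: "(A \<^bold>\<subseteq> X) r" using ultrafilter_sub[OF Ur[OF r] AU] .
      have "(img g A \<^bold>\<in> ?V) r"
      proof (rule image_filterI[OF gr[OF r] Ur[OF r] AU])
        show "(img g A \<^bold>\<subseteq> Y) r"
        proof (rule subsetI)
          fix t y assume t: "t \<le> r" "(y \<^bold>\<in> img g A) t"
          show "(y \<^bold>\<in> Y) t"
          proof (rule f_exE[OF t(2)[unfolded mem_img] stable_mem])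
            fix u x assume u: "u \<le> t" "(x \<^bold>\<in> A \<^bold>\<and> (x, y) \<^bold>\<in> g) u"
            then show "(y \<^bold>\<in> Y) u"
              using func_cod[OF gr[OF order_trans[OF u(1) order_trans[OF t(1) r]]]]
              unfolding f_and_iff by blast
          qed
        qed
      next
        fix t x y assume "t \<le> r" "(x \<^bold>\<in> A) t" "((x, y) \<^bold>\<in> g) t"
        then show "(y \<^bold>\<in> img g A) t"
          unfolding mem_img by (intro f_exI[of _ x]) (simp_all add: f_and_iff)
      qed
      moreover have "((i, B) \<^bold>\<in> \<A> \<^bold>\<longrightarrow> fin (img g A \<^bold>- B)) r" for i B
      proof (rule f_impI)
        fix t assume t: "t \<le> r" "((i, B) \<^bold>\<in> \<A>) t"
        have tq: "t \<le> q" using order_trans[OF t(1) r] .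
        have "fin (img g (A \<^bold>- D i)) t"
          by (rule fin_img[OF fin_lower[OF fin t(1)] gr[OF tq]])
        then show "fin (img g A \<^bold>- B) t"
        proof (rule fin_subset, intro subsetI)
          fix u y assume u: "u \<le> t" "(y \<^bold>\<in> img g A \<^bold>- B) u"
          then have y: "(\<^bold>\<exists>x. x \<^bold>\<in> A \<^bold>\<and> (x, y) \<^bold>\<in> g) u" "(\<^bold>\<not>(y \<^bold>\<in> B)) u" by (simp_all add: f_and_iff)
          show "(y \<^bold>\<in> img g (A \<^bold>- D i)) u"
          proof (rule f_exE[OF y(1) stable_mem])
            fix v x assume v: "v \<le> u" "(x \<^bold>\<in> A \<^bold>\<and> (x, y) \<^bold>\<in> g) v"
            have "(\<^bold>\<not>(x \<^bold>\<in> D i)) v"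
            proof (rule f_notI)
              fix w assume w: "w \<le> v" "(x \<^bold>\<in> D i) w"
              then obtain s B' where s: "s \<le> w" "((i, B') \<^bold>\<in> \<A>) s" "(x \<^bold>\<in> vim g B') s"
                using f_ex_andD[OF w(2)[unfolded D]] by blast
              have st: "s \<le> t" using order_trans[OF s(1) order_trans[OF w(1) order_trans[OF v(1) u(1)]]] .
              have sq: "s \<le> q" using order_trans[OF st tq] .
              have "((x, y) \<^bold>\<in> g) s"
                using v(2) mem_lower[OF _ order_trans[OF s(1) w(1)]] unfolding f_and_iff by blast
              then have "(y \<^bold>\<in> B') s" using mem_vim_iff[OF gr[OF sq]] s(3) by blast
              moreover have "(B' \<^bold>= B) s"
                using func_unique[OF func_lower[OF \<A> sq] s(2) mem_lower[OF t(2) st]] .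
              ultimately have "(y \<^bold>\<in> B) s" using eqv_mem_iff[OF _ order_refl] by blast
              then show False
                using f_notE[OF y(2) order_trans[OF s(1) order_trans[OF w(1) v(1)]]] by blast
            qed
            with v(2) show "(y \<^bold>\<in> img g (A \<^bold>- D i)) v"
              unfolding mem_img by (intro f_exI[of _ x]) (simp_all add: f_and_iff)
          qed
        qed
      qed simp_all
      ultimately show "?goal r"
        by (intro f_exI[of _ "img g A"]) (simp_all add: f_and_iff f_all_iff)
    qed simp
  qed simp_all
  with V nonprincipal_image[OF g U A fin] show ?thesis
    by (simp add: p_ultrafilter_def f_and_iff)
qed

text \<open>A point \<open>y\<close> of the image gets the least number that \<open>e\<close>
  assigns to a preimage of \<open>y\<close>. This chooses no preimage, and \<open>y\<close> is
  recovered from the number because \<open>e\<close> is injective.\<close>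

lemma ctbl_img:
  assumes g: "func g X Y p" and X: "ctbl X p"
  shows "ctbl (img g X) p"
proof (rule stable_dense[OF stable_ctbl])
  fix p' assume p': "p' \<le> p"
  obtain q e where q: "q \<le> p'" and e: "func e X omega q" "injective e q"
    using f_ex_andD[OF ex_lower[OF X[unfolded ctbl_def] p']] by blast
  have gq: "func g X Y r" and eq: "func e X omega r" "injective e r" if "r \<le> q" for r
    using func_lower[OF g order_trans[OF that order_trans[OF q p']]] func_lower[OF e(1) that]
      injective_lower[OF e(2) that] .
  define \<phi> where "\<phi> z x = ((x, fst z) \<^bold>\<in> g \<^bold>\<and> (x, snd z) \<^bold>\<in> e \<^bold>\<and>
    (\<^bold>\<forall>x' n'. (x', fst z) \<^bold>\<in> g \<^bold>\<and> (x', n') \<^bold>\<in> e \<^bold>\<longrightarrow> \<^bold>\<langle>snd z \<le> n'\<^bold>\<rangle>))" for z x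
  have st: "stable (\<phi> z x)" for z x by (simp add: \<phi>_def)
  have \<phi>_iff: "\<phi> (y, n) x r \<longleftrightarrow> ((x, y) \<^bold>\<in> g) r \<and> ((x, n) \<^bold>\<in> e) r \<and>
      (\<forall>x' n'. \<forall>u\<le>r. ((x', y) \<^bold>\<in> g) u \<and> ((x', n') \<^bold>\<in> e) u \<longrightarrow> n \<le> n')" for y n x r
    by (simp add: \<phi>_def f_and_iff f_all_iff f_imp_iff)
  define f where "f = (SetOf z. \<^bold>\<exists>x. \<phi> z x)"
  have f: "(z \<^bold>\<in> f) = (\<^bold>\<exists>x. \<phi> z x)" for z
    unfolding f_def
  proof (rule mem_set_of_eq)
    show "extn (\<lambda>z. \<^bold>\<exists>x. \<phi> z x)"
    proof (rule extnI)
      fix z z' :: "'b \<times> nat" and p assume z: "(z \<^bold>= z') p"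
      then have "snd z = snd z'" by (rule f_eq_snd_nat)
      with z show "eqv p (\<^bold>\<exists>x. \<phi> z x) (\<^bold>\<exists>x. \<phi> z' x)" by (simp add: \<phi>_def)
    qed
  qed (simp add: st)
  have fD: "\<exists>t\<le>r. \<exists>x. ((x, y) \<^bold>\<in> g) t \<and> ((x, n) \<^bold>\<in> e) t \<and>
      (\<forall>u\<le>t. \<forall>x' n'. ((x', y) \<^bold>\<in> g) u \<longrightarrow> ((x', n') \<^bold>\<in> e) u \<longrightarrow> n \<le> n')"
    if f_mem: "((y, n) \<^bold>\<in> f) r" for r y n
  proof -
    obtain t x where "t \<le> r" "\<phi> (y, n) x t"
      using f_exD[OF f_mem[unfolded f] order_refl] by blast
    then show ?thesis unfolding \<phi>_iff by blast
  qed
  have "func f (img g X) omega q"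
  proof (rule funcI)
    fix r y n assume r: "r \<le> q" and yn: "((y, n) \<^bold>\<in> f) r"
    have "(y \<^bold>\<in> img g X) r"
    proof (rule stable_dense[OF stable_mem])
      fix s assume s: "s \<le> r"
      obtain t x where t: "t \<le> s" "((x, y) \<^bold>\<in> g) t" using fD[OF mem_lower[OF yn s]] by blast
      have "(x \<^bold>\<in> X) t" using func_dom[OF gq[OF order_trans[OF t(1) order_trans[OF s r]]] t(2)] .
      with t have "(y \<^bold>\<in> img g X) t" unfolding mem_img by (intro f_exI[of _ x] f_andI) simp_all
      with t(1) show "\<exists>t\<le>s. (y \<^bold>\<in> img g X) t" by blast
    qed
    then show "(y \<^bold>\<in> img g X) r \<and> (n \<^bold>\<in> omega) r" by simp
  next
    fix r y assume r: "r \<le> q" and y: "(y \<^bold>\<in> img g X) r"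
    show "(\<^bold>\<exists>n. (y, n) \<^bold>\<in> f) r"
      unfolding f_ex_iff
    proof (intro allI impI)
      fix s assume s: "s \<le> r"
      \<comment> \<open>The least number that any condition below \<open>s\<close> assigns to a
        preimage. A condition attaining it forces it to be the minimum, as every stronger condition
        is still below \<open>s\<close>.\<close>
      define P where "P n \<longleftrightarrow> (\<exists>t\<le>s. \<exists>x. ((x, y) \<^bold>\<in> g) t \<and> ((x, n) \<^bold>\<in> e) t)" for n
      obtain t x where t: "t \<le> s" "(x \<^bold>\<in> X) t" "((x, y) \<^bold>\<in> g) t"
        using f_ex_andD[OF mem_lower[OF y s, unfolded mem_img]] by blast
      obtain u n where "u \<le> t" "((x, n) \<^bold>\<in> e) u"
        using f_exD[OF func_total[OF eq(1)[OF order_trans[OF t(1) order_trans[OF s r]]] t(2)] order_refl]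
        by blast
      then have "P n" unfolding P_def
        using mem_lower[OF t(3)] order_trans[OF _ t(1)] by blast
      then have "P (LEAST n. P n)" by (rule LeastI)
      then obtain u x where u: "u \<le> s" "((x, y) \<^bold>\<in> g) u" "((x, LEAST n. P n) \<^bold>\<in> e) u"
        unfolding P_def by blast
      have "(LEAST n. P n) \<le> n'" if "v \<le> u" "((x', y) \<^bold>\<in> g) v" "((x', n') \<^bold>\<in> e) v" for v x' n'
        using that order_trans[OF that(1) u(1)] by (intro Least_le) (auto simp: P_def)
      with u have "\<phi> (y, LEAST n. P n) x u" unfolding \<phi>_iff by blast
      then have "((y, LEAST n. P n) \<^bold>\<in> f) u"
        unfolding f by (rule f_exI) (rule st)
      with u(1) show "\<exists>t\<le>s. \<exists>n. ((y, n) \<^bold>\<in> f) t" by blast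
    qed
  next
    fix r y m n assume "r \<le> q" and y: "((y, m) \<^bold>\<in> f) r" "((y, n) \<^bold>\<in> f) r"
    obtain t x where t: "t \<le> r" "((x, y) \<^bold>\<in> g) t" "((x, m) \<^bold>\<in> e) t"
      "\<forall>u\<le>t. \<forall>x' n'. ((x', y) \<^bold>\<in> g) u \<longrightarrow> ((x', n') \<^bold>\<in> e) u \<longrightarrow> m \<le> n'"
      using fD[OF y(1)] by blast
    obtain u x' where u: "u \<le> t" "((x', y) \<^bold>\<in> g) u" "((x', n) \<^bold>\<in> e) u"
      "\<forall>v\<le>u. \<forall>x' n'. ((x', y) \<^bold>\<in> g) v \<longrightarrow> ((x', n') \<^bold>\<in> e) v \<longrightarrow> n \<le> n'"
      using fD[OF mem_lower[OF y(2) t(1)]] by blast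
    have "m \<le> n" using t(4) u(1-3) by blast
    moreover have "n \<le> m" using u(4) order_refl[of u] mem_lower[OF t(2) u(1)] mem_lower[OF t(3) u(1)]
      by blast
    ultimately show "(m \<^bold>= n) r" by simp
  qed
  moreover have "injective f q"
  proof (rule injectiveI)
    fix r y y' n assume r: "r \<le> q" and y: "((y, n) \<^bold>\<in> f) r" "((y', n) \<^bold>\<in> f) r"
    show "(y \<^bold>= y') r"
    proof (rule stable_dense[OF stable_eq])
      fix s assume s: "s \<le> r"
      obtain t x where t: "t \<le> s" "((x, y) \<^bold>\<in> g) t" "((x, n) \<^bold>\<in> e) t"
        using fD[OF mem_lower[OF y(1) s]] by blast
      obtain u x' where u: "u \<le> t" "((x', y') \<^bold>\<in> g) u" "((x', n) \<^bold>\<in> e) u"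
        using fD[OF mem_lower[OF y(2) order_trans[OF t(1) s]]] by blast
      have uq: "u \<le> q" using order_trans[OF u(1) order_trans[OF t(1) order_trans[OF s r]]] .
      have "(x' \<^bold>= x) u" using injectiveD[OF eq(2)[OF uq] u(3) mem_lower[OF t(3) u(1)]] .
      then have "((x, y') \<^bold>\<in> g) u" by (intro mem_subst[OF u(2)]) simp
      then have "(y \<^bold>= y') u" using func_unique[OF gq[OF uq] mem_lower[OF t(2) u(1)]] by blast
      then show "\<exists>u\<le>s. (y \<^bold>= y') u" using order_trans[OF u(1) t(1)] by blast
    qed
  qed
  ultimately have "ctbl (img g X) q"
    unfolding ctbl_def by (intro f_exI[of _ f] f_andI) simp_all
  with q show "\<exists>r\<le>p'. ctbl (img g X) r" by blast
qed

section \<open>Tukey reductions to the generic ultrafilter\<close>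

lemma stable_cofinal [simp]: "stable (cofinal \<D> \<U>)"
  by (simp add: cofinal_def)

lemma cofinal_iff:
  "cofinal \<D> \<U> p \<longleftrightarrow> (\<D> \<^bold>\<subseteq> \<U>) p \<and> (\<forall>q\<le>p. \<forall>A. (A \<^bold>\<in> \<U>) q \<longrightarrow> (\<^bold>\<exists>D. D \<^bold>\<in> \<D> \<^bold>\<and> D \<^bold>\<subseteq> A) q)"
  by (auto simp: cofinal_def f_and_iff f_all_iff f_imp_iff)

lemma mem_tips [simp]: "(s \<^bold>\<in> tips S) = (s \<^bold>\<in> S \<^bold>\<and> \<^bold>\<langle>length s = 2\<^bold>\<rangle>)"
  unfolding tips_def by (rule mem_set_of_eq) (auto intro!: extnI)

lemma eq_tips [simp]: "(S \<^bold>= S') p \<Longrightarrow> (tips S \<^bold>= tips S') p"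
  by (simp add: tips_def)

section \<open>The generic filter and the ultrafilter it generates\<close>

lemma tips_check: "(tips (check (Rep_cond r)) \<^bold>= check (ctips r)) p"
  by (rule set_eqI) (auto simp: f_and_iff ctips_def)

lemma mem_generic_check: "(check (Rep_cond p) \<^bold>\<in> generic) p"
  unfolding f_mem_def generic_def
proof (intro allI impI)
  fix q assume "q \<le> p"
  then show "\<exists>r\<le>q. \<exists>(y, s)\<in>pairs (Setn {(check (Rep_cond p), p) |p. True}). r \<le> s \<and> (check (Rep_cond p) \<^bold>= y) r"
    using order_refl[of q] eq_refl[of "check (Rep_cond p)" q] by (auto simp del: eq_refl)
qed

lemma mem_genericD:
  assumes "(S \<^bold>\<in> generic) p"
  obtains r s where "r \<le> p" "r \<le> s" "(S \<^bold>= check (Rep_cond s)) r"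
  using assms order_refl[of p] unfolding f_mem_def generic_def by fastforce

lemma subset_check_iff [simp]: "(check A \<^bold>\<subseteq> check (B :: nat list set)) p \<longleftrightarrow> A \<subseteq> B"
  using order_refl by (auto simp: subset_iff)

lemma stable_generated_by [simp]: "stable (generated_by \<U> \<C>)"
  by (simp add: generated_by_def)

text \<open>Every condition forces its own tree into the generic filter.\<close>

lemma generated_by_generic_mem:
  assumes gen: "generated_by \<U> generic p"
  shows "(check (ctips p) \<^bold>\<in> \<U>) p"
proof -
  let ?\<D> = "SetOf A. \<^bold>\<exists>S. S \<^bold>\<in> generic \<^bold>\<and> A \<^bold>= tips S"
  have mem: "(A \<^bold>\<in> ?\<D>) = (\<^bold>\<exists>S. S \<^bold>\<in> generic \<^bold>\<and> A \<^bold>= tips S)" for A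
    by (rule mem_set_of_eq) (auto intro!: extnI)
  have "(check (ctips p) \<^bold>\<in> ?\<D>) p"
    unfolding mem
    by (intro f_exI[of _ "check (Rep_cond p)"] f_andI mem_generic_check eq_sym[OF tips_check]) simp
  moreover have "(?\<D> \<^bold>\<subseteq> \<U>) p"
    using gen by (simp add: generated_by_def cofinal_iff f_and_iff)
  ultimately show ?thesis using subsetD by blast
qed

text \<open>Some condition forces \<open>A\<close> to contain the tips of a tree \<open>u\<close> of
  the generic filter and is itself below \<open>u\<close>, but only up to finitely many levels.
  Thinning into \<open>u\<close> yields a tree whose own leaves are forced into \<open>A\<close>;
  thinning into \<open>q\<close> secures the exact inclusion that \<open>rapid_selection\<close>
  asks for.\<close>

lemma generated_by_generic_dense:
  assumes gen: "generated_by \<U> generic p" and A: "(A \<^bold>\<in> \<U>) p" and pq: "p \<le> q"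
  shows "\<exists>r\<le>p. ctips r \<subseteq> ctips q \<and> (check (ctips r) \<^bold>\<subseteq> A) r"
proof -
  let ?\<D> = "SetOf A. \<^bold>\<exists>S. S \<^bold>\<in> generic \<^bold>\<and> A \<^bold>= tips S"
  have mem: "(A \<^bold>\<in> ?\<D>) = (\<^bold>\<exists>S. S \<^bold>\<in> generic \<^bold>\<and> A \<^bold>= tips S)" for A
    by (rule mem_set_of_eq) (auto intro!: extnI)
  have cof: "cofinal ?\<D> \<U> p"
    using gen by (simp add: generated_by_def f_and_iff)
  have "(\<^bold>\<exists>D. D \<^bold>\<in> ?\<D> \<^bold>\<and> D \<^bold>\<subseteq> A) p"
    using conjunct2[OF cof[unfolded cofinal_iff]] A order_refl[of p] by blast
  from f_ex_andD[OF this] obtain r D where r: "r \<le> p" "(D \<^bold>\<in> ?\<D>) r" "(D \<^bold>\<subseteq> A) r"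
      by blast
  obtain s S where s: "s \<le> r" "(S \<^bold>\<in> generic) s" "(D \<^bold>= tips S) s"
    using f_ex_andD[OF r(2)[unfolded mem]] by blast
  obtain t u where t: "t \<le> s" "t \<le> u" "(S \<^bold>= check (Rep_cond u)) t"
    using mem_genericD[OF s(2)] .
  obtain v where v: "v \<le> t" "ctips v \<subseteq> ctips t \<inter> ctips u" using ctips_thin[OF t(2)] by blast
  have t_le_p: "t \<le> p" using order_trans[OF t(1) order_trans[OF s(1) r(1)]] .
  obtain w where w: "w \<le> v" "ctips w \<subseteq> ctips v \<inter> ctips q"
    using ctips_thin[OF order_trans[OF v(1) order_trans[OF t_le_p pq]]] by blast
  have wt: "w \<le> t" using order_trans[OF w(1) v(1)] .
  have ws: "w \<le> s" using order_trans[OF wt t(1)] .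
  have "(D \<^bold>= check (ctips u)) w"
    using eq_trans[OF eq_lower[OF s(3) ws] eq_trans[OF eq_tips[OF eq_lower[OF t(3) wt]] tips_check]] .
  moreover have "(D \<^bold>\<subseteq> A) w" using subset_lower[OF r(3) order_trans[OF ws s(1)]] .
  ultimately have "(check (ctips u) \<^bold>\<subseteq> A) w"
    using eqvD[OF eqv_subset[OF _ eq_refl]] by blast
  moreover have "(check (ctips w) \<^bold>\<subseteq> check (ctips u)) w" using w(2) v(2) by auto
  ultimately have "(check (ctips w) \<^bold>\<subseteq> A) w" using subset_trans by blast
  with w(2) order_trans[OF wt t_le_p] show ?thesis by blast
qed

section \<open>Tukey maps defined on the generic ultrafilter\<close>

text \<open>If no \<open>A\<close> works, then below each set of \<open>\<U>\<close> there is
  another one whose image is not inside \<open>B\<close>. These sets form a cofinal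
  \<open>\<D>\<close>, but no member of its image is a subset of \<open>B\<close>, so the image is
  not cofinal.\<close>

lemma tukey_monotone:
  assumes \<phi>: "func \<phi> \<U> \<V> p"
    and cof: "\<And>q \<D>. q \<le> p \<Longrightarrow> cofinal \<D> \<U> q \<Longrightarrow> cofinal (img \<phi> \<D>) \<V> q"
    and B: "(B \<^bold>\<in> \<V>) p"
  shows "(\<^bold>\<exists>A. A \<^bold>\<in> \<U> \<^bold>\<and> (\<^bold>\<forall>A' C. A' \<^bold>\<in> \<U> \<^bold>\<and> A' \<^bold>\<subseteq> A \<^bold>\<and> (A', C) \<^bold>\<in> \<phi> \<^bold>\<longrightarrow> C \<^bold>\<subseteq> B)) p"
    (is "?goal p")
proof (rule f_ccontr)
  fix r assume r: "r \<le> p" and no: "(\<^bold>\<not>?goal) r"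
  define \<D> where "\<D> = (SetOf A. A \<^bold>\<in> \<U> \<^bold>\<and> (\<^bold>\<exists>C. (A, C) \<^bold>\<in> \<phi> \<^bold>\<and> \<^bold>\<not>(C \<^bold>\<subseteq> B)))"
  have \<D>: "(A \<^bold>\<in> \<D>) = (A \<^bold>\<in> \<U> \<^bold>\<and> (\<^bold>\<exists>C. (A, C) \<^bold>\<in> \<phi> \<^bold>\<and> \<^bold>\<not>(C \<^bold>\<subseteq> B)))" for A
    unfolding \<D>_def by (rule mem_set_of_eq) (auto intro!: extnI)
  have "cofinal \<D> \<U> r"
    unfolding cofinal_iff
  proof (intro conjI allI impI)
    show "(\<D> \<^bold>\<subseteq> \<U>) r" by (rule subsetI) (simp add: \<D> f_and_iff)
  next
    fix t A assume t: "t \<le> r" and A: "(A \<^bold>\<in> \<U>) t"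
    show "(\<^bold>\<exists>D. D \<^bold>\<in> \<D> \<^bold>\<and> D \<^bold>\<subseteq> A) t"
    proof (rule f_ccontr)
      fix u assume u: "u \<le> t" and noD: "(\<^bold>\<not>(\<^bold>\<exists>D. D \<^bold>\<in> \<D> \<^bold>\<and> D \<^bold>\<subseteq> A)) u"
      have "(A' \<^bold>\<in> \<U> \<^bold>\<and> A' \<^bold>\<subseteq> A \<^bold>\<and> (A', C) \<^bold>\<in> \<phi> \<^bold>\<longrightarrow> C \<^bold>\<subseteq> B) u" for A' C
      proof (rule f_impI)
        fix v assume v: "v \<le> u" "(A' \<^bold>\<in> \<U> \<^bold>\<and> A' \<^bold>\<subseteq> A \<^bold>\<and> (A', C) \<^bold>\<in> \<phi>) v"
        then have A': "(A' \<^bold>\<in> \<U>) v" "(A' \<^bold>\<subseteq> A) v" "((A', C) \<^bold>\<in> \<phi>) v" by (simp_all add: f_and_iff)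
        show "(C \<^bold>\<subseteq> B) v"
        proof (rule f_ccontr[OF stable_subset])
          fix w assume w: "w \<le> v" "(\<^bold>\<not>(C \<^bold>\<subseteq> B)) w"
          have "(A' \<^bold>\<in> \<D>) w"
            unfolding \<D> using mem_lower[OF A'(1) w(1)] mem_lower[OF A'(3) w(1)] w(2)
            by (intro f_andI f_exI[of _ C]) simp_all
          with subset_lower[OF A'(2) w(1)] have "(\<^bold>\<exists>D. D \<^bold>\<in> \<D> \<^bold>\<and> D \<^bold>\<subseteq> A) w"
            by (intro f_exI[of _ A'] f_andI) simp_all
          with f_notE[OF noD order_trans[OF w(1) v(1)]] show False by blast
        qed
      qed simp_all
      then have "(\<^bold>\<forall>A' C. A' \<^bold>\<in> \<U> \<^bold>\<and> A' \<^bold>\<subseteq> A \<^bold>\<and> (A', C) \<^bold>\<in> \<phi> \<^bold>\<longrightarrow> C \<^bold>\<subseteq> B) u"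
        by (simp add: f_all_iff)
      with mem_lower[OF A u] have "?goal u"
        by (intro f_exI[of _ A] f_andI) simp_all
      with f_notE[OF no order_trans[OF u t]] show False by blast
    qed simp
  qed
  then have "cofinal (img \<phi> \<D>) \<V> r" by (rule cof[OF r])
  then have "(\<^bold>\<exists>D. D \<^bold>\<in> img \<phi> \<D> \<^bold>\<and> D \<^bold>\<subseteq> B) r"
    using mem_lower[OF B r] order_refl[of r] unfolding cofinal_iff by blast
  from f_ex_andD[OF this] obtain t D where t: "t \<le> r" "(D \<^bold>\<in> img \<phi> \<D>) t" "(D \<^bold>\<subseteq> B) t"
      by blast
  obtain u A where u: "u \<le> t" "(A \<^bold>\<in> \<D>) u" "((A, D) \<^bold>\<in> \<phi>) u"
    using f_ex_andD[OF t(2)[unfolded mem_img]] by blast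
  have "(\<^bold>\<exists>C. (A, C) \<^bold>\<in> \<phi> \<^bold>\<and> \<^bold>\<not>(C \<^bold>\<subseteq> B)) u" using u(2) by (simp add: \<D> f_and_iff)
  from f_ex_andD[OF this] obtain v C where v: "v \<le> u" "((A, C) \<^bold>\<in> \<phi>) v" "(\<^bold>\<not>(C \<^bold>\<subseteq> B)) v"
      by blast
  have "v \<le> p" using order_trans[OF v(1) order_trans[OF u(1) order_trans[OF t(1) r]]] .
  then have "(D \<^bold>= C) v"
    using func_unique[OF func_lower[OF \<phi>] mem_lower[OF u(3) v(1)] v(2)] by blast
  moreover have "(D \<^bold>\<subseteq> B) v" using subset_lower[OF t(3) order_trans[OF v(1) u(1)]] .
  ultimately have "(C \<^bold>\<subseteq> B) v" using eqvD[OF eqv_subset[OF _ eq_refl]] by blast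
  with f_notE[OF v(3) order_refl] show False by blast
qed simp

text \<open>\<open>K\<close> attaches ground-model indices to the points of \<open>A\<close>,
  grouped into finite blocks by \<open>f\<close>. From each block few indices can be kept so that
  the points carrying them still form a set in the ultrafilter, which is rapidity in the form used
  for the cut.\<close>

lemma tukey_selection:
  fixes \<U> :: "nat list setn setn" and K :: "'a::names \<Rightarrow> 'i \<Rightarrow> sentence" and f :: "'i \<Rightarrow> nat"
  assumes gen: "generated_by \<U> generic p"
    and \<phi>: "func \<phi> \<U> \<Y> p"
    and cof: "\<And>q \<D>. q \<le> p \<Longrightarrow> cofinal \<D> \<U> q \<Longrightarrow> cofinal (img \<phi> \<D>) \<Y> q"
    and Y: "ultrafilter X \<Y> p" and A: "(A \<^bold>\<in> \<Y>) p"
    and stab: "\<And>x i. stable (K x i)" and ext: "\<And>i. extn (\<lambda>x. K x i)"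
    and cover: "\<And>q x. q \<le> p \<Longrightarrow> (x \<^bold>\<in> A) q \<Longrightarrow> \<exists>r\<le>q. \<exists>i\<in>I. K x i r"
    and fin: "\<And>n. finite {i \<in> I. f i = n}"
  shows "\<exists>q\<le>p. \<exists>B\<subseteq>I. (\<forall>n. card {i \<in> B. f i = n} \<le> 2 ^ (Suc n * Suc n)) \<and>
    ((SetOf x. x \<^bold>\<in> A \<^bold>\<and> (\<^bold>\<exists>i. \<^bold>\<langle>i \<in> B\<^bold>\<rangle> \<^bold>\<and> K x i)) \<^bold>\<in> \<Y>) q"
proof -
  \<comment> \<open>The quantifier over \<open>A'\<close> inside \<open>D\<close> is what makes
    \<open>J\<close> increasing in \<open>D\<close>; the value of \<open>\<phi>\<close> at the tips
    of one tree would not be.\<close>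
  define \<psi> where "\<psi> D i A' C x = (A' \<^bold>\<in> \<U> \<^bold>\<and> A' \<^bold>\<subseteq> check D \<^bold>\<and> (A', C) \<^bold>\<in> \<phi> \<^bold>\<and> x \<^bold>\<in> C \<^bold>\<and> x \<^bold>\<in> A \<^bold>\<and> K x i)"
    for D i A' C x
  define J where "J q D i = (\<^bold>\<exists>A' C x. \<psi> D i A' C x) q" for q D i
  have st: "stable (\<psi> D i A' C x)" for D i A' C x by (simp add: \<psi>_def stab)
  have JI: "J q D i" if "\<psi> D i A' C x q" for q D i A' C x
    unfolding J_def using that st by (intro f_exI[of _ A'] f_exI[of _ C] f_exI[of _ x]) simp_all
  have JD: "\<exists>r\<le>q. \<exists>A' C x. \<psi> D i A' C x r" if J: "J q D i" for q D i
  proof -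
    obtain r A' where r: "r \<le> q" "(\<^bold>\<exists>C x. \<psi> D i A' C x) r"
      using f_exD[OF J[unfolded J_def] order_refl] by blast
    obtain s C where s: "s \<le> r" "(\<^bold>\<exists>x. \<psi> D i A' C x) s" using f_exD[OF r(2) order_refl] by blast
    obtain t x where t: "t \<le> s" "\<psi> D i A' C x t" using f_exD[OF s(2) order_refl] by blast
    with order_trans[OF t(1) order_trans[OF s(1) r(1)]] show ?thesis by blast
  qed
  have J_stab: "stable (\<lambda>q. J q D i)" for D i
    unfolding J_def using st by (simp add: stable_ex)
  have J_mono: "J q D' i" if J: "J q D i" and sub: "D \<subseteq> D'" for q D D' i
  proof (rule stable_dense[OF J_stab])
    fix r assume r: "r \<le> q"
    obtain s A' C x where s: "s \<le> r" "\<psi> D i A' C x s"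
      using JD[OF stable_mono[OF J_stab J r]] by blast
    have "(check D \<^bold>\<subseteq> check D') s" using sub by simp
    with s(2) have "\<psi> D' i A' C x s"
      using subset_trans unfolding \<psi>_def f_and_iff by blast
    with s(1) JI show "\<exists>s\<le>r. J s D' i" by blast
  qed
  have "\<exists>q\<le>p. \<exists>B\<subseteq>I. (\<forall>n. card {i \<in> B. f i = n} \<le> 2 ^ (Suc n * Suc n)) \<and>
    (\<forall>r\<le>q. \<forall>t\<le>r. \<forall>i\<in>I. ctips r \<subseteq> ctips q \<longrightarrow> J t (ctips r) i \<longrightarrow> (\<exists>i'\<in>B. J r (ctips r) i'))"
    by (rule rapid_selection) (rule J_stab, erule J_mono, assumption, rule fin)
  then obtain q B where q: "q \<le> p" "B \<subseteq> I"
    and card: "\<forall>n. card {i \<in> B. f i = n} \<le> 2 ^ (Suc n * Suc n)"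
    and sel: "\<forall>r\<le>q. \<forall>t\<le>r. \<forall>i\<in>I. ctips r \<subseteq> ctips q \<longrightarrow> J t (ctips r) i \<longrightarrow> (\<exists>i'\<in>B. J r (ctips r) i')"
    by blast
  define AB where "AB = (SetOf x. x \<^bold>\<in> A \<^bold>\<and> (\<^bold>\<exists>i. \<^bold>\<langle>i \<in> B\<^bold>\<rangle> \<^bold>\<and> K x i))"
  have AB: "(x \<^bold>\<in> AB) = (x \<^bold>\<in> A \<^bold>\<and> (\<^bold>\<exists>i. \<^bold>\<langle>i \<in> B\<^bold>\<rangle> \<^bold>\<and> K x i))" for x
    unfolding AB_def
  proof (rule mem_set_of_eq)
    show "extn (\<lambda>x. x \<^bold>\<in> A \<^bold>\<and> (\<^bold>\<exists>i. \<^bold>\<langle>i \<in> B\<^bold>\<rangle> \<^bold>\<and> K x i))"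
      using ext by (auto intro!: extnI simp: extn_def)
  qed (simp add: stab)
  \<comment> \<open>Otherwise the complement of \<open>AB\<close> is in \<open>\<Y>\<close>, and
    \<open>\<phi>\<close> sends every set of \<open>\<U>\<close> inside some \<open>D\<close> into
    that complement. A tree \<open>t\<close> with leaves in \<open>D\<close> will nevertheless
    contain a set whose image meets \<open>AB\<close>.\<close>
  have "(AB \<^bold>\<in> \<Y>) q"
  proof (rule f_ccontr[OF stable_mem])
    fix r assume r: "r \<le> q" and no: "(\<^bold>\<not>(AB \<^bold>\<in> \<Y>)) r"
    have rp: "r \<le> p" using order_trans[OF r q(1)] .
    have Yr: "ultrafilter X \<Y> r" using ultrafilter_lower[OF Y rp] .
    have "(AB \<^bold>\<subseteq> X) r"
      by (rule subset_trans[OF _ ultrafilter_sub[OF Yr mem_lower[OF A rp]]], rule subsetI)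
         (simp add: AB f_and_iff)
    then have "(X \<^bold>- AB \<^bold>\<in> \<Y>) r" using ultrafilter_compl[OF Yr _ no] by blast
    then have "(\<^bold>\<exists>D. D \<^bold>\<in> \<U> \<^bold>\<and> (\<^bold>\<forall>A' C. A' \<^bold>\<in> \<U> \<^bold>\<and> A' \<^bold>\<subseteq> D \<^bold>\<and> (A', C) \<^bold>\<in> \<phi> \<^bold>\<longrightarrow> C \<^bold>\<subseteq> X \<^bold>- AB)) r"
      using tukey_monotone[OF func_lower[OF \<phi> rp] cof[OF order_trans[OF _ rp]]] by blast
    from f_ex_andD[OF this] obtain s D where s: "s \<le> r" "(D \<^bold>\<in> \<U>) s"
      and D: "(\<^bold>\<forall>A' C. A' \<^bold>\<in> \<U> \<^bold>\<and> A' \<^bold>\<subseteq> D \<^bold>\<and> (A', C) \<^bold>\<in> \<phi> \<^bold>\<longrightarrow> C \<^bold>\<subseteq> X \<^bold>- AB) s"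
      by blast
    have sq: "s \<le> q" using order_trans[OF s(1) r] .
    have sp: "s \<le> p" using order_trans[OF sq q(1)] .
    have gen': "generated_by \<U> generic t" if "t \<le> p" for t
      using stable_mono[OF stable_generated_by gen that] .
    obtain t where t: "t \<le> s" "ctips t \<subseteq> ctips q" "(check (ctips t) \<^bold>\<subseteq> D) t"
      using generated_by_generic_dense[OF gen'[OF sp] s(2) sq] by blast
    have tq: "t \<le> q" using order_trans[OF t(1) sq] .
    have t_le_p: "t \<le> p" using order_trans[OF t(1) sp] .
    have tU: "(check (ctips t) \<^bold>\<in> \<U>) t" using generated_by_generic_mem[OF gen'[OF t_le_p]] .
    obtain u C where u: "u \<le> t" "((check (ctips t), C) \<^bold>\<in> \<phi>) u"
      using f_exD[OF func_total[OF func_lower[OF \<phi> t_le_p] tU] order_refl] by blast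
    have up: "u \<le> p" using order_trans[OF u(1) t_le_p] .
    have "(C \<^bold>\<inter> A \<^bold>\<in> \<Y>) u"
      using ultrafilter_int[OF ultrafilter_lower[OF Y up] func_cod[OF func_lower[OF \<phi> up] u(2)]
          mem_lower[OF A up]] .
    then obtain v x where v: "v \<le> u" "(x \<^bold>\<in> C \<^bold>\<inter> A) v"
      using ultrafilter_nonempty[OF ultrafilter_lower[OF Y up]] by blast
    then have x: "(x \<^bold>\<in> C) v" "(x \<^bold>\<in> A) v" by (simp_all add: f_and_iff)
    have vp: "v \<le> p" using order_trans[OF v(1) up] .
    obtain w i where w: "w \<le> v" "i \<in> I" "K x i w" using cover[OF vp x(2)] by blast
    have wu: "w \<le> u" using order_trans[OF w(1) v(1)] .
    have wt: "w \<le> t" using order_trans[OF wu u(1)] .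
    have "\<psi> (ctips t) i (check (ctips t)) C x w"
      using mem_lower[OF tU wt] mem_lower[OF u(2) wu] mem_lower[OF x(1) w(1)] mem_lower[OF x(2) w(1)] w(3)
      by (simp add: \<psi>_def f_and_iff)
    \<comment> \<open>The condition \<open>w\<close> knows only that some index is hit from inside
      \<open>ctips t\<close>. The selection exchanges it for an index of \<open>B\<close>, hit from
      inside the same set and already by force of \<open>t\<close>.\<close>
    then obtain i' where i': "i' \<in> B" "J t (ctips t) i'"
      using sel tq t(2) wt w(2) JI by blast
    obtain a A' C' x' where a: "a \<le> t" "\<psi> (ctips t) i' A' C' x' a" using JD[OF i'(2)] by blast
    then have a': "(A' \<^bold>\<in> \<U>) a" "(A' \<^bold>\<subseteq> check (ctips t)) a" "((A', C') \<^bold>\<in> \<phi>) a" "(x' \<^bold>\<in> C') a"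
      "(x' \<^bold>\<in> A) a" "K x' i' a"
      by (simp_all add: \<psi>_def f_and_iff)
    have "(A' \<^bold>\<subseteq> D) a" using subset_trans[OF a'(2) subset_lower[OF t(3) a(1)]] .
    then have prem: "(A' \<^bold>\<in> \<U> \<^bold>\<and> A' \<^bold>\<subseteq> D \<^bold>\<and> (A', C') \<^bold>\<in> \<phi>) a" using a' by (simp add: f_and_iff)
    have "(A' \<^bold>\<in> \<U> \<^bold>\<and> A' \<^bold>\<subseteq> D \<^bold>\<and> (A', C') \<^bold>\<in> \<phi> \<^bold>\<longrightarrow> C' \<^bold>\<subseteq> X \<^bold>- AB) s"
      using D by (simp add: f_all_iff)
    then have "\<forall>b\<le>s. (A' \<^bold>\<in> \<U> \<^bold>\<and> A' \<^bold>\<subseteq> D \<^bold>\<and> (A', C') \<^bold>\<in> \<phi>) b \<longrightarrow> (C' \<^bold>\<subseteq> X \<^bold>- AB) b"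
      by (subst (asm) f_imp_iff) simp_all
    then have "(C' \<^bold>\<subseteq> X \<^bold>- AB) a" using prem order_trans[OF a(1) t(1)] by blast
    then have "(x' \<^bold>\<in> X \<^bold>- AB) a" using a'(4) by (rule subsetD)
    then have "(\<^bold>\<not>(x' \<^bold>\<in> AB)) a" by (simp add: f_and_iff)
    moreover have "(x' \<^bold>\<in> AB) a"
      unfolding AB using a' i'(1) stab by (intro f_andI f_exI[of _ i']) (simp_all add: f_and_iff)
    ultimately show False using f_notE[OF _ order_refl] by blast
  qed
  with q card show ?thesis unfolding AB_def by blast
qed

section \<open>Cuts\<close>

text \<open>Common form of the sets deciding equality and order in the ultrapower: \<open>R\<close>
  is instantiated with \<open>=\<close> and with \<open>\<le>\<close>.\<close>

definition rel_set ::
  "'b::names setn \<Rightarrow> (nat \<Rightarrow> nat \<Rightarrow> bool) \<Rightarrow> ('b \<times> nat) setn \<Rightarrow> ('b \<times> nat) setn \<Rightarrow> 'b setn" where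
  "rel_set Y R h h' =
     (SetOf y. y \<^bold>\<in> Y \<^bold>\<and> (\<^bold>\<exists>m n. (y, m) \<^bold>\<in> h \<^bold>\<and> (y, n) \<^bold>\<in> h' \<^bold>\<and> \<^bold>\<langle>R m n\<^bold>\<rangle>))"

lemma rel_set_iff:
  "(y \<^bold>\<in> rel_set Y R h h') p \<longleftrightarrow>
     (y \<^bold>\<in> Y) p \<and> (\<forall>q\<le>p. \<exists>r\<le>q. \<exists>m n. ((y, m) \<^bold>\<in> h) r \<and> ((y, n) \<^bold>\<in> h') r \<and> R m n)"
proof -
  have "(y \<^bold>\<in> rel_set Y R h h') = (y \<^bold>\<in> Y \<^bold>\<and> (\<^bold>\<exists>m n. (y, m) \<^bold>\<in> h \<^bold>\<and> (y, n) \<^bold>\<in> h' \<^bold>\<and> \<^bold>\<langle>R m n\<^bold>\<rangle>))"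
    unfolding rel_set_def by (rule mem_set_of_eq) (auto intro!: extnI)
  moreover have "(\<^bold>\<exists>m n. (y, m) \<^bold>\<in> h \<^bold>\<and> (y, n) \<^bold>\<in> h' \<^bold>\<and> \<^bold>\<langle>R m n\<^bold>\<rangle>) p \<longleftrightarrow>
      (\<forall>q\<le>p. \<exists>r\<le>q. \<exists>m n. ((y, m) \<^bold>\<in> h) r \<and> ((y, n) \<^bold>\<in> h') r \<and> R m n)" (is "?L p \<longleftrightarrow> ?R")
  proof
    assume L: "?L p"
    show ?R
    proof (intro allI impI)
      fix q assume "q \<le> p"
      then obtain r m where r: "r \<le> q" "(\<^bold>\<exists>n. (y, m) \<^bold>\<in> h \<^bold>\<and> (y, n) \<^bold>\<in> h' \<^bold>\<and> \<^bold>\<langle>R m n\<^bold>\<rangle>) r"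
        using f_exD[OF L] by blast
      obtain s n where "s \<le> r" "((y, m) \<^bold>\<in> h \<^bold>\<and> (y, n) \<^bold>\<in> h' \<^bold>\<and> \<^bold>\<langle>R m n\<^bold>\<rangle>) s"
        using f_exD[OF r(2) order_refl] by blast
      with order_trans[OF _ r(1)]
      show "\<exists>r\<le>q. \<exists>m n. ((y, m) \<^bold>\<in> h) r \<and> ((y, n) \<^bold>\<in> h') r \<and> R m n" by (auto simp: f_and_iff)
    qed
  next
    assume R: ?R
    show "?L p"
    proof (rule stable_dense[of ?L])
      fix q assume "q \<le> p"
      then obtain r m n where "r \<le> q" "((y, m) \<^bold>\<in> h) r" "((y, n) \<^bold>\<in> h') r" "R m n" using R by blast
      then have "?L r" by (intro f_exI[of _ m] f_exI[of _ n] f_andI) simp_all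
      with \<open>r \<le> q\<close> show "\<exists>r\<le>q. ?L r" by blast
    qed simp
  qed
  ultimately show ?thesis by (simp add: f_and_iff)
qed

lemma eq_rel_set [simp]:
  "(Y \<^bold>= Y') p \<Longrightarrow> (h \<^bold>= k) p \<Longrightarrow> (h' \<^bold>= k') p \<Longrightarrow> (rel_set Y R h h' \<^bold>= rel_set Y' R k k') p"
  by (simp add: rel_set_def)

lemma rel_set_sub: "(rel_set Y R h h' \<^bold>\<subseteq> Y) p"
  by (rule subsetI) (simp add: rel_set_iff)

lemma stable_power_fun [simp]: "stable (power_fun Y h)"
  by (simp add: power_fun_def)

lemma eqv_power_fun [simp]: "(Y \<^bold>= Y') p \<Longrightarrow> (h \<^bold>= h') p \<Longrightarrow> eqv p (power_fun Y h) (power_fun Y' h')"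
  by (simp add: power_fun_def)

lemma ult_eq_iff: "ult_eq Y \<V> h h' = (rel_set Y (=) h h' \<^bold>\<in> \<V>)"
  by (simp add: ult_eq_def rel_set_def)

lemma mem_ult_class: "(h' \<^bold>\<in> ult_class Y \<V> h) = (power_fun Y h' \<^bold>\<and> rel_set Y (=) h h' \<^bold>\<in> \<V>)"
  unfolding ult_class_def ult_eq_iff by (rule mem_set_of_eq) (auto intro!: extnI)

lemma eq_ult_class [simp]:
  "(Y \<^bold>= Y') p \<Longrightarrow> (\<V> \<^bold>= \<V>') p \<Longrightarrow> (h \<^bold>= h') p \<Longrightarrow> (ult_class Y \<V> h \<^bold>= ult_class Y' \<V>' h') p"
  by (simp add: ult_class_def ult_eq_iff)

lemma mem_ultrapower: "(c \<^bold>\<in> ultrapower Y \<V>) = (\<^bold>\<exists>h. power_fun Y h \<^bold>\<and> c \<^bold>= ult_class Y \<V> h)"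
  unfolding ultrapower_def by (rule mem_set_of_eq) (auto intro!: extnI)

lemma ult_le_iff: "ult_le Y \<V> c d =
     (\<^bold>\<exists>h h'. power_fun Y h \<^bold>\<and> power_fun Y h' \<^bold>\<and>
        c \<^bold>= ult_class Y \<V> h \<^bold>\<and> d \<^bold>= ult_class Y \<V> h' \<^bold>\<and> rel_set Y (\<le>) h h' \<^bold>\<in> \<V>)"
  by (simp add: ult_le_def rel_set_def)

lemma stable_ult_le [simp]: "stable (ult_le Y \<V> c d)"
  by (simp add: ult_le_iff)

lemma eqv_ult_le [simp]:
  "(c \<^bold>= c') p \<Longrightarrow> (d \<^bold>= d') p \<Longrightarrow> eqv p (ult_le Y \<V> c d) (ult_le Y \<V> c' d')"
  by (simp add: ult_le_iff)

definition const_fun :: "'b::names setn \<Rightarrow> nat \<Rightarrow> ('b \<times> nat) setn" where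
  "const_fun Y n = (SetOf z. fst z \<^bold>\<in> Y \<^bold>\<and> \<^bold>\<langle>snd z = n\<^bold>\<rangle>)"

lemma mem_const_fun:
  fixes Y :: "'b::names setn"
  shows "((y, m) \<^bold>\<in> const_fun Y n) = (y \<^bold>\<in> Y \<^bold>\<and> \<^bold>\<langle>m = n\<^bold>\<rangle>)"
proof -
  have "(z \<^bold>\<in> const_fun Y n) = (fst z \<^bold>\<in> Y \<^bold>\<and> \<^bold>\<langle>snd z = n\<^bold>\<rangle>)" for z
    unfolding const_fun_def
  proof (rule mem_set_of_eq, simp, rule extnI)
    fix z z' :: "'b \<times> nat" and p assume z: "(z \<^bold>= z') p"
    then have "snd z = snd z'" by (rule f_eq_snd_nat)
    with z show "eqv p (fst z \<^bold>\<in> Y \<^bold>\<and> \<^bold>\<langle>snd z = n\<^bold>\<rangle>) (fst z' \<^bold>\<in> Y \<^bold>\<and> \<^bold>\<langle>snd z' = n\<^bold>\<rangle>)" by simp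
  qed
  then show ?thesis by simp
qed

lemma mem_const_classes:
  "(c \<^bold>\<in> const_classes Y \<V>) = (\<^bold>\<exists>n. c \<^bold>= ult_class Y \<V> (const_fun Y n))"
  unfolding const_classes_def const_fun_def by (rule mem_set_of_eq) (auto intro!: extnI)

lemma eq_const_classes: "(\<V> \<^bold>= \<V>') p \<Longrightarrow> (const_classes Y \<V> \<^bold>= const_classes Y \<V>') p"
  unfolding const_classes_def by simp

lemma mem_fibre_count:
  fixes g :: "('a::names \<times> 'b::names) setn"
  shows "((y, n) \<^bold>\<in> fibre_count g Y A) = (y \<^bold>\<in> Y \<^bold>\<and> has_card (fibre g A y) n)"
proof -
  have "(z \<^bold>\<in> fibre_count g Y A) = (fst z \<^bold>\<in> Y \<^bold>\<and> has_card (fibre g A (fst z)) (snd z))" for z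
    unfolding fibre_count_def
  proof (rule mem_set_of_eq, simp, rule extnI)
    fix z z' :: "'b \<times> nat" and p assume z: "(z \<^bold>= z') p"
    then have "snd z = snd z'" by (rule f_eq_snd_nat)
    with z show "eqv p (fst z \<^bold>\<in> Y \<^bold>\<and> has_card (fibre g A (fst z)) (snd z))
        (fst z' \<^bold>\<in> Y \<^bold>\<and> has_card (fibre g A (fst z')) (snd z'))" by simp
  qed
  then show ?thesis by simp
qed

text \<open>Used contrapositively: if the class of \<open>h\<close> is not that of a constant map,
  no single value is taken on a set of the ultrafilter.\<close>

lemma ult_class_const:
  assumes V: "ultrafilter Y \<V> p" and h: "func h Y omega p"
    and E: "((SetOf y. y \<^bold>\<in> Y \<^bold>\<and> (y, m) \<^bold>\<in> h) \<^bold>\<in> \<V>) p"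
  shows "(ult_class Y \<V> h \<^bold>= ult_class Y \<V> (const_fun Y m)) p"
proof (rule set_eqI)
  fix q h' assume q: "q \<le> p"
  let ?E = "SetOf y. y \<^bold>\<in> Y \<^bold>\<and> (y, m) \<^bold>\<in> h"
  have E_iff: "(y \<^bold>\<in> ?E) = (y \<^bold>\<in> Y \<^bold>\<and> (y, m) \<^bold>\<in> h)" for y
    by (rule mem_set_of_eq) (auto intro!: extnI)
  note Vq = ultrafilter_lower[OF V q] and Eq = mem_lower[OF E q]
  let ?c = "const_fun Y m"
  have sub1: "(rel_set Y (=) h h' \<^bold>\<inter> ?E \<^bold>\<subseteq> rel_set Y (=) ?c h') q"
  proof (rule subsetI)
    fix r y assume r: "r \<le> q" and "(y \<^bold>\<in> rel_set Y (=) h h' \<^bold>\<inter> ?E) r"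
    then have y: "(y \<^bold>\<in> rel_set Y (=) h h') r" "(y \<^bold>\<in> Y) r" "((y, m) \<^bold>\<in> h) r"
      by (simp_all add: f_and_iff E_iff)
    have "\<exists>t\<le>s. \<exists>a b. ((y, a) \<^bold>\<in> ?c) t \<and> ((y, b) \<^bold>\<in> h') t \<and> a = b" if s: "s \<le> r" for s
    proof -
      obtain t a where t: "t \<le> s" "((y, a) \<^bold>\<in> h) t" "((y, a) \<^bold>\<in> h') t"
        using y(1) s by (auto simp: rel_set_iff)
      have tr: "t \<le> r" using order_trans[OF t(1) s] .
      have "(a \<^bold>= m) t"
        using func_unique[OF func_lower[OF h order_trans[OF tr order_trans[OF r q]]] t(2) mem_lower[OF y(3) tr]] .
      with t mem_lower[OF y(2) tr] show ?thesis by (auto simp: mem_const_fun f_and_iff)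
    qed
    with y(2) show "(y \<^bold>\<in> rel_set Y (=) ?c h') r" by (simp add: rel_set_iff)
  qed
  have sub2: "(rel_set Y (=) ?c h' \<^bold>\<inter> ?E \<^bold>\<subseteq> rel_set Y (=) h h') q"
  proof (rule subsetI)
    fix r y assume r: "r \<le> q" and "(y \<^bold>\<in> rel_set Y (=) ?c h' \<^bold>\<inter> ?E) r"
    then have y: "(y \<^bold>\<in> rel_set Y (=) ?c h') r" "(y \<^bold>\<in> Y) r" "((y, m) \<^bold>\<in> h) r"
      by (simp_all add: f_and_iff E_iff)
    have "\<exists>t\<le>s. \<exists>a b. ((y, a) \<^bold>\<in> h) t \<and> ((y, b) \<^bold>\<in> h') t \<and> a = b" if s: "s \<le> r" for s
    proof -
      obtain t where t: "t \<le> s" "((y, m) \<^bold>\<in> h') t"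
        using y(1) s by (auto simp: rel_set_iff mem_const_fun f_and_iff)
      with mem_lower[OF y(3) order_trans[OF t(1) s]] show ?thesis by auto
    qed
    with y(2) show "(y \<^bold>\<in> rel_set Y (=) h h') r" by (simp add: rel_set_iff)
  qed
  have "(rel_set Y (=) h h' \<^bold>\<in> \<V>) q \<longleftrightarrow> (rel_set Y (=) ?c h' \<^bold>\<in> \<V>) q"
    using ultrafilter_up[OF Vq ultrafilter_int[OF Vq _ Eq] sub1 rel_set_sub]
      ultrafilter_up[OF Vq ultrafilter_int[OF Vq _ Eq] sub2 rel_set_sub] by blast
  then show "(h' \<^bold>\<in> ult_class Y \<V> h) q \<longleftrightarrow> (h' \<^bold>\<in> ult_class Y \<V> ?c) q"
    by (simp add: mem_ult_class f_and_iff)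
qed

section \<open>Sets with small fibres\<close>

text \<open>The numbers \<open>n\<close> with \<open>N (Suc n) \<le> m\<close> form an initial
  segment, so their count \<open>\<rho> m\<close> is the largest \<open>k\<close> with
  \<open>N k \<le> m\<close>, provided \<open>N 0 \<le> m\<close>. A given count bounds
  \<open>m\<close> by the next value of \<open>N\<close>, so \<open>\<rho>\<close> is
  finite-to-one.\<close>

lemma inverse_growth:
  fixes N :: "nat \<Rightarrow> nat"
  assumes N: "\<And>n. n < N n" "\<And>n. N n \<le> N (Suc n)"
  obtains \<rho> :: "nat \<Rightarrow> nat" where "\<And>m. N 0 \<le> m \<Longrightarrow> N (\<rho> m) \<le> m" "\<And>n. finite {m. \<rho> m = n}"
proof -
  define \<rho> where "\<rho> m = card {n. N (Suc n) \<le> m}" for m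
  have mono: "N i \<le> N j" if "i \<le> j" for i j using that N(2) by (rule lift_Suc_mono_le[rotated])
  have fin: "finite {n. N (Suc n) \<le> m}" for m
    by (rule finite_subset[of _ "{..m}"]) (use N(1) in \<open>auto, meson Suc_lessD le_trans less_imp_le\<close>)
  have "N (\<rho> m) \<le> m" if "N 0 \<le> m" for m
  proof (cases "\<rho> m")
    case (Suc k)
    show ?thesis
    proof (rule ccontr)
      assume "\<not> N (\<rho> m) \<le> m"
      then have "{n. N (Suc n) \<le> m} \<subseteq> {..<k}"
        using mono Suc by (auto simp: not_less) (metis Suc_le_mono le_trans not_less)
      then have "\<rho> m \<le> card {..<k}" unfolding \<rho>_def by (intro card_mono) simp
      with Suc show False by simp
    qed
  qed (use that in simp)
  moreover have "finite {m. \<rho> m = n}" for n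
  proof (rule finite_subset[of _ "{..N (Suc n)}"])
    show "{m. \<rho> m = n} \<subseteq> {..N (Suc n)}"
    proof
      fix m assume m: "m \<in> {m. \<rho> m = n}"
      show "m \<in> {..N (Suc n)}"
      proof (rule ccontr)
        assume "m \<notin> {..N (Suc n)}"
        then have "{..n} \<subseteq> {n. N (Suc n) \<le> m}"
          using mono by (auto simp: not_le) (meson Suc_le_mono le_trans less_imp_le)
        then have "card {..n} \<le> \<rho> m" unfolding \<rho>_def by (rule card_mono[OF fin])
        with m show False by simp
      qed
    qed
  qed simp
  ultimately show ?thesis using that by blast
qed

text \<open>A point \<open>x\<close> is indexed by the pair of \<open>m = h(g(x))\<close> and its
  number \<open>j = e(x)\<close>, and \<open>\<rho> m\<close> is its block. In the fibre over
  \<open>y\<close> all points share \<open>m = h(y)\<close>, so they lie in one block, where at most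
  \<open>N (\<rho> m) \<le> m\<close> indices are kept. The hypothesis \<open>unb\<close> makes
  \<open>h\<close> unbounded on every set of the ultrafilter, so that the p-point property can make
  the sets of bounded value finite.\<close>

lemma tukey_fibre_bound:
  fixes \<U> :: "nat list setn setn" and g :: "('a::names \<times> 'b::names) setn"
  assumes gen: "generated_by \<U> generic p"
    and \<phi>: "func \<phi> \<U> \<Y> p"
    and cof: "\<And>q \<D>. q \<le> p \<Longrightarrow> cofinal \<D> \<U> q \<Longrightarrow> cofinal (img \<phi> \<D>) \<Y> q"
    and Y: "p_ultrafilter X \<Y> p" and X: "ctbl X p"
    and g: "func g X Y p" and h: "func h Y omega p"
    and unb: "\<And>m. (\<^bold>\<not>((SetOf y. y \<^bold>\<in> Y \<^bold>\<and> (y, m) \<^bold>\<in> h) \<^bold>\<in> image_filter g Y \<Y>)) p"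
  shows "\<exists>q\<le>p. \<exists>A. (A \<^bold>\<in> \<Y>) q \<and> (\<forall>r\<le>q. \<forall>y. (y \<^bold>\<in> Y) r \<longrightarrow>
    (\<exists>s\<le>r. \<exists>c m. has_card (fibre g A y) c s \<and> ((y, m) \<^bold>\<in> h) s \<and> c \<le> m))"
proof -
  \<comment> \<open>The number of indices that \<open>tukey_selection\<close> may leave in block
    \<open>n\<close>.\<close>
  define N :: "nat \<Rightarrow> nat" where "N n = 2 ^ (Suc n * Suc n)" for n
  have N: "n < N n" "N n \<le> N (Suc n)" for n
  proof -
    have "n < 2 ^ n" by simp
    also have "(2::nat) ^ n \<le> N n" unfolding N_def by (rule power_increasing) auto
    finally show "n < N n" .
    show "N n \<le> N (Suc n)" unfolding N_def by (rule power_increasing) auto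
  qed
  obtain \<rho> where \<rho>: "\<And>m. N 0 \<le> m \<Longrightarrow> N (\<rho> m) \<le> m" "\<And>n. finite {m. \<rho> m = n}"
    using inverse_growth[of N] N by metis
  let ?V = "image_filter g Y \<Y>"
  have UY: "ultrafilter X \<Y> p" using Y by (simp add: p_ultrafilter_def f_and_iff)
  have V: "ultrafilter Y ?V p" by (rule ultrafilter_image[OF g UY])
  define H where "H n = (SetOf y. y \<^bold>\<in> Y \<^bold>\<and> (\<^bold>\<exists>m. (y, m) \<^bold>\<in> h \<^bold>\<and> \<^bold>\<langle>n \<le> m\<^bold>\<rangle>))" for n
  have H: "(y \<^bold>\<in> H n) = (y \<^bold>\<in> Y \<^bold>\<and> (\<^bold>\<exists>m. (y, m) \<^bold>\<in> h \<^bold>\<and> \<^bold>\<langle>n \<le> m\<^bold>\<rangle>))" for y n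
    unfolding H_def by (rule mem_set_of_eq) (auto intro!: extnI)
  have H_val: "(y \<^bold>\<in> H n) q \<longleftrightarrow> n \<le> m" if q: "q \<le> p" and ym: "((y, m) \<^bold>\<in> h) q" for y n m q
  proof
    assume "(y \<^bold>\<in> H n) q"
    then have "(\<^bold>\<exists>m. (y, m) \<^bold>\<in> h \<^bold>\<and> \<^bold>\<langle>n \<le> m\<^bold>\<rangle>) q" by (simp add: H f_and_iff)
    from f_ex_andD[OF this] obtain r m' where r: "r \<le> q" "((y, m') \<^bold>\<in> h) r" "n \<le> m'"
      by auto
    have "(m' \<^bold>= m) r"
      using func_unique[OF func_lower[OF h order_trans[OF r(1) q]] r(2) mem_lower[OF ym r(1)]] .
    with r(3) show "n \<le> m" by simp
  next
    assume "n \<le> m"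
    then show "(y \<^bold>\<in> H n) q"
      unfolding H using ym func_dom[OF func_lower[OF h q] ym]
      by (intro f_andI f_exI[of _ m]) simp_all
  qed
  have HI: "(y \<^bold>\<in> H n) q" if q: "q \<le> p" and y: "(y \<^bold>\<in> Y) q"
    and ge: "\<And>r m. r \<le> q \<Longrightarrow> ((y, m) \<^bold>\<in> h) r \<Longrightarrow> n \<le> m" for y n q
    using func_lower[OF h q] y stable_mem
  proof (rule func_valueE)
    fix r m assume "r \<le> q" "((y, m) \<^bold>\<in> h) r"
    with ge H_val[OF order_trans[OF _ q]] show "(y \<^bold>\<in> H n) r" by blast
  qed
  have HY: "(H n \<^bold>\<subseteq> Y) q" for n q by (rule subsetI) (simp add: H f_and_iff)
  \<comment> \<open>By \<open>unb\<close> each single value of \<open>h\<close> can be removed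
    without leaving the ultrafilter, so the values below \<open>n\<close> are removed one after
    another.\<close>
  have HV: "(H n \<^bold>\<in> ?V) p" for n
  proof (induction n)
    case 0
    show ?case
      by (rule ultrafilter_up[OF V ultrafilter_space[OF V] _ HY], rule subsetI, rule HI) simp_all
  next
    case (Suc n)
    let ?E = "SetOf y. y \<^bold>\<in> Y \<^bold>\<and> (y, n) \<^bold>\<in> h"
    have E: "(y \<^bold>\<in> ?E) = (y \<^bold>\<in> Y \<^bold>\<and> (y, n) \<^bold>\<in> h)" for y
      by (rule mem_set_of_eq) (auto intro!: extnI)
    have "(?E \<^bold>\<subseteq> Y) p" by (rule subsetI) (simp add: E f_and_iff)
    then have "(Y \<^bold>- ?E \<^bold>\<in> ?V) p" using ultrafilter_compl[OF V _ unb] by blast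
    then have "(H n \<^bold>\<inter> (Y \<^bold>- ?E) \<^bold>\<in> ?V) p" by (rule ultrafilter_int[OF V Suc.IH])
    then show ?case
    proof (rule ultrafilter_up[OF V _ _ HY], intro subsetI)
      fix q y assume q: "q \<le> p" "(y \<^bold>\<in> H n \<^bold>\<inter> (Y \<^bold>- ?E)) q"
      then have y: "(y \<^bold>\<in> H n) q" "(y \<^bold>\<in> Y) q" "(\<^bold>\<not>(y \<^bold>\<in> ?E)) q" by (simp_all add: f_and_iff)
      show "(y \<^bold>\<in> H (Suc n)) q"
      proof (rule HI[OF q(1) y(2)])
        fix r m assume r: "r \<le> q" "((y, m) \<^bold>\<in> h) r"
        have "n \<le> m" using H_val[OF order_trans[OF r(1) q(1)] r(2)] mem_lower[OF y(1) r(1)] by blast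
        moreover have "m \<noteq> n"
          using f_notE[OF y(3) r(1)] r(2) mem_lower[OF y(2) r(1)] by (auto simp: E f_and_iff)
        ultimately show "Suc n \<le> m" by simp
      qed
    qed
  qed
  define D where "D n = vim g (H n)" for n
  have DY: "(D n \<^bold>\<in> \<Y>) p" for n using HV[of n] by (simp add: image_filter_iff[OF g UY] D_def)
  have D_val: "(x \<^bold>\<in> D n) q \<longleftrightarrow> n \<le> m"
    if q: "q \<le> p" and xy: "((x, y) \<^bold>\<in> g) q" "((y, m) \<^bold>\<in> h) q" for x y m n q
    unfolding D_def using mem_vim_iff[OF func_lower[OF g q] xy(1)] H_val[OF q xy(2)] by simp
  have "(D (Suc n) \<^bold>\<subseteq> D n) p" for n
  proof (rule subsetI)
    fix q x assume q: "q \<le> p" and x: "(x \<^bold>\<in> D (Suc n)) q"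
    have "(x \<^bold>\<in> X) q" using subsetD[OF vim_sub[OF func_lower[OF g q]]] x unfolding D_def by blast
    then show "(x \<^bold>\<in> D n) q"
    proof (rule func_valueE[OF func_lower[OF g q] _ stable_mem])
      fix r y assume r: "r \<le> q" "((x, y) \<^bold>\<in> g) r" "(y \<^bold>\<in> Y) r"
      have rp: "r \<le> p" using order_trans[OF r(1) q] .
      show "(x \<^bold>\<in> D n) r"
      proof (rule func_valueE[OF func_lower[OF h rp] r(3) stable_mem])
        fix s m assume s: "s \<le> r" "((y, m) \<^bold>\<in> h) s"
        note val = D_val[OF order_trans[OF s(1) rp] mem_lower[OF r(2) s(1)] s(2)]
        have "Suc n \<le> m" using val mem_lower[OF x order_trans[OF s(1) r(1)]] by blast
        then show "(x \<^bold>\<in> D n) s" using val by simp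
      qed
    qed
  qed
  then have "(\<^bold>\<exists>A. A \<^bold>\<in> \<Y> \<^bold>\<and> (\<^bold>\<forall>i. fin (A \<^bold>- D i))) p"
    by (rule p_ultrafilter_sequence[where D = D, OF Y DY])
  from f_ex_andD[OF this] obtain p1 A0 where p1: "p1 \<le> p" "(A0 \<^bold>\<in> \<Y>) p1"
    and "(\<^bold>\<forall>i. fin (A0 \<^bold>- D i)) p1" by blast
  then have A0: "fin (A0 \<^bold>- D i) p1" for i by (simp add: f_all_iff)
  obtain p2 e where p2: "p2 \<le> p1" and e: "func e X omega p2" "injective e p2"
    using f_ex_andD[OF ex_lower[OF X[unfolded ctbl_def] p1(1)]] by blast
  have p2p: "p2 \<le> p" using order_trans[OF p2 p1(1)] .
  \<comment> \<open>\<open>N (\<rho> m) \<le> m\<close> holds only from \<open>N 0\<close> on.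
    Points with smaller values are discarded, which empties the fibres over them.\<close>
  define A where "A = A0 \<^bold>\<inter> D (N 0)"
  have AY: "(A \<^bold>\<in> \<Y>) p2"
    unfolding A_def
    by (rule ultrafilter_int[OF ultrafilter_lower[OF UY p2p] mem_lower[OF p1(2) p2] mem_lower[OF DY p2p]])
  have "\<exists>p3\<le>p2. \<forall>m. \<exists>F. finite F \<and>
      (\<forall>q\<le>p3. \<forall>x j. (x \<^bold>\<in> A0 \<^bold>- D (Suc m)) q \<longrightarrow> ((x, j) \<^bold>\<in> e) q \<longrightarrow> j \<in> F)"
  proof (rule decide_countable)
    fix m p q
    assume F: "\<exists>F. finite F \<and> (\<forall>q\<le>p. \<forall>x j. (x \<^bold>\<in> A0 \<^bold>- D (Suc m)) q \<longrightarrow> ((x, j) \<^bold>\<in> e) q \<longrightarrow> j \<in> F)"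
      and q: "q \<le> p"
    have "r \<le> p" if "r \<le> q" for r using order_trans[OF that q] .
    with F show "\<exists>F. finite F \<and> (\<forall>r\<le>q. \<forall>x j. (x \<^bold>\<in> A0 \<^bold>- D (Suc m)) r \<longrightarrow> ((x, j) \<^bold>\<in> e) r \<longrightarrow> j \<in> F)"
      by blast
  next
    fix m q assume q: "q \<le> p2"
    show "\<exists>r\<le>q. \<exists>F. finite F \<and> (\<forall>q\<le>r. \<forall>x j. (x \<^bold>\<in> A0 \<^bold>- D (Suc m)) q \<longrightarrow> ((x, j) \<^bold>\<in> e) q \<longrightarrow> j \<in> F)"
      by (rule fin_values[OF fin_lower[OF A0 order_trans[OF q p2]] func_lower[OF e(1) q]])
  qed
  then obtain p3 where p3: "p3 \<le> p2" and "\<forall>m. \<exists>F. finite F \<and>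
      (\<forall>q\<le>p3. \<forall>x j. (x \<^bold>\<in> A0 \<^bold>- D (Suc m)) q \<longrightarrow> ((x, j) \<^bold>\<in> e) q \<longrightarrow> j \<in> F)" by blast
  then obtain F where F: "\<And>m. finite (F m)"
    "\<And>m q x j. q \<le> p3 \<Longrightarrow> (x \<^bold>\<in> A0 \<^bold>- D (Suc m)) q \<Longrightarrow> ((x, j) \<^bold>\<in> e) q \<Longrightarrow> j \<in> F m"
    by metis
  have p3p: "p3 \<le> p" using order_trans[OF p3 p2p] .
  define I where "I = {(m, j). j \<in> F m \<and> N 0 \<le> m}"
  define f :: "nat \<times> nat \<Rightarrow> nat" where "f i = \<rho> (fst i)" for i
  define K where "K x i = ((x, snd i) \<^bold>\<in> e \<^bold>\<and> (\<^bold>\<exists>y. (x, y) \<^bold>\<in> g \<^bold>\<and> (y, fst i) \<^bold>\<in> h))" for x i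
  have finI: "finite {i \<in> I. f i = n}" for n
  proof -
    have "{i \<in> I. f i = n} \<subseteq> (SIGMA m:{m. \<rho> m = n}. F m)" by (auto simp: I_def f_def)
    then show ?thesis by (rule finite_subset) (use \<rho>(2) F(1) in auto)
  qed
  have "\<exists>q\<le>p3. \<exists>B\<subseteq>I. (\<forall>n. card {i \<in> B. f i = n} \<le> 2 ^ (Suc n * Suc n)) \<and>
    ((SetOf x. x \<^bold>\<in> A \<^bold>\<and> (\<^bold>\<exists>i. \<^bold>\<langle>i \<in> B\<^bold>\<rangle> \<^bold>\<and> K x i)) \<^bold>\<in> \<Y>) q"
  proof (rule tukey_selection)
    show "generated_by \<U> generic p3" by (rule stable_mono[OF stable_generated_by gen p3p])
    show "func \<phi> \<U> \<Y> p3" by (rule func_lower[OF \<phi> p3p])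
    show "cofinal (img \<phi> \<D>) \<Y> q" if "q \<le> p3" "cofinal \<D> \<U> q" for q \<D>
      using cof[OF order_trans[OF that(1) p3p] that(2)] .
    show "ultrafilter X \<Y> p3" by (rule ultrafilter_lower[OF UY p3p])
    show "(A \<^bold>\<in> \<Y>) p3" by (rule mem_lower[OF AY p3])
    show "stable (K x i)" for x i by (simp add: K_def)
    show "extn (\<lambda>x. K x i)" for i by (auto intro!: extnI simp: K_def)
    show "finite {i \<in> I. f i = n}" for n by (rule finI)
  next
    fix q x assume q: "q \<le> p3" and x: "(x \<^bold>\<in> A) q"
    have x': "(x \<^bold>\<in> A0) q" "(x \<^bold>\<in> D (N 0)) q" using x by (simp_all add: A_def f_and_iff)
    have qp: "q \<le> p" using order_trans[OF q p3p] .
    have xX: "(x \<^bold>\<in> X) q" using subsetD[OF vim_sub[OF func_lower[OF g qp]]] x'(2) unfolding D_def by blast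
    have "(\<^bold>\<exists>y. (x, y) \<^bold>\<in> g) q" by (rule func_total[OF func_lower[OF g qp] xX])
    from f_exD[OF this order_refl] obtain r y where r: "r \<le> q" "((x, y) \<^bold>\<in> g) r" by blast
    have rp: "r \<le> p" using order_trans[OF r(1) qp] .
    have "(\<^bold>\<exists>m. (y, m) \<^bold>\<in> h) r"
      by (rule func_total[OF func_lower[OF h rp] func_cod[OF func_lower[OF g rp] r(2)]])
    from f_exD[OF this order_refl] obtain s m where s: "s \<le> r" "((y, m) \<^bold>\<in> h) s" by blast
    have sq: "s \<le> q" using order_trans[OF s(1) r(1)] .
    have "(\<^bold>\<exists>j. (x, j) \<^bold>\<in> e) s"
      by (rule func_total[OF func_lower[OF e(1) order_trans[OF sq order_trans[OF q p3]]] mem_lower[OF xX sq]])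
    from f_exD[OF this order_refl] obtain t j where t: "t \<le> s" "((x, j) \<^bold>\<in> e) t" by blast
    have tq: "t \<le> q" using order_trans[OF t(1) sq] .
    have xy: "((x, y) \<^bold>\<in> g) u" and ym: "((y, m) \<^bold>\<in> h) u" if "u \<le> t" for u
      using mem_lower[OF r(2) order_trans[OF that order_trans[OF t(1) s(1)]]]
        mem_lower[OF s(2) order_trans[OF that t(1)]] .
    note val = D_val[OF order_trans[OF order_trans[OF _ tq] qp] xy ym]
    have "N 0 \<le> m" using val[OF order_refl order_refl order_refl] mem_lower[OF x'(2) tq] by blast
    moreover have "j \<in> F m"
    proof (rule F(2)[OF order_trans[OF tq q] _ t(2)])
      have "(\<^bold>\<not>(x \<^bold>\<in> D (Suc m))) t"
        by (rule f_notI) (use val in fastforce)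
      with mem_lower[OF x'(1) tq] show "(x \<^bold>\<in> A0 \<^bold>- D (Suc m)) t" by (simp add: f_and_iff)
    qed
    ultimately have "(m, j) \<in> I" by (simp add: I_def)
    moreover have "K x (m, j) t"
      unfolding K_def using t(2) xy[OF order_refl] ym[OF order_refl]
      by (intro f_andI f_exI[of _ y]) simp_all
    ultimately show "\<exists>r\<le>q. \<exists>i\<in>I. K x i r" using tq by blast
  qed
  then obtain q B where q: "q \<le> p3" and B: "B \<subseteq> I" "\<And>n. card {i \<in> B. f i = n} \<le> N n"
    and AB: "((SetOf x. x \<^bold>\<in> A \<^bold>\<and> (\<^bold>\<exists>i. \<^bold>\<langle>i \<in> B\<^bold>\<rangle> \<^bold>\<and> K x i)) \<^bold>\<in> \<Y>) q"
    unfolding N_def by blast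
  define C where "C = (SetOf x. x \<^bold>\<in> A \<^bold>\<and> (\<^bold>\<exists>i. \<^bold>\<langle>i \<in> B\<^bold>\<rangle> \<^bold>\<and> K x i))"
  have C: "(x \<^bold>\<in> C) = (x \<^bold>\<in> A \<^bold>\<and> (\<^bold>\<exists>i. \<^bold>\<langle>i \<in> B\<^bold>\<rangle> \<^bold>\<and> K x i))" for x
    unfolding C_def by (rule mem_set_of_eq) (auto intro!: extnI simp: K_def)
  have qp: "q \<le> p" using order_trans[OF q p3p] .
  have card_B: "finite {j. (m, j) \<in> B} \<and> card {j. (m, j) \<in> B} \<le> m" for m
  proof (cases "N 0 \<le> m")
    case True
    have sub: "Pair m ` {j. (m, j) \<in> B} \<subseteq> {i \<in> B. f i = \<rho> m}" by (auto simp: f_def)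
    have fin: "finite {i \<in> B. f i = \<rho> m}"
      by (rule finite_subset[OF _ finI[of "\<rho> m"]]) (use B(1) in auto)
    have inj: "inj_on (Pair m) {j. (m, j) \<in> B}" by (auto simp: inj_on_def)
    have "finite {j. (m, j) \<in> B}" using finite_imageD[OF finite_subset[OF sub fin] inj] .
    moreover have "card {j. (m, j) \<in> B} \<le> N (\<rho> m)"
      using card_mono[OF fin sub] B(2)[of "\<rho> m"] by (simp add: card_image[OF inj])
    ultimately show ?thesis using \<rho>(1)[OF True] by simp
  next
    case False
    then have "{j. (m, j) \<in> B} = {}" using B(1) by (auto simp: I_def)
    then show ?thesis by (metis card.empty finite.emptyI le0)
  qed
  have "\<exists>s\<le>r. \<exists>c m. has_card (fibre g C y) c s \<and> ((y, m) \<^bold>\<in> h) s \<and> c \<le> m"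
    if r: "r \<le> q" and y: "(y \<^bold>\<in> Y) r" for r y
  proof -
    have rp: "r \<le> p" using order_trans[OF r qp] .
    obtain s m where s: "s \<le> r" "((y, m) \<^bold>\<in> h) s"
      using f_exD[OF func_total[OF func_lower[OF h rp] y] order_refl] by blast
    have sq: "s \<le> q" using order_trans[OF s(1) r] .
    \<comment> \<open>With the value \<open>m\<close> of \<open>h\<close> at \<open>y\<close>
      decided, the second coordinate alone indexes the fibre, by injectivity of
      \<open>e\<close>.\<close>
    have "\<exists>t\<le>s. \<exists>c\<le>card {j. (m, j) \<in> B}. has_card (fibre g C y) c t"
    proof (rule has_card_bounded[where R = "\<lambda>x j. (x, j) \<^bold>\<in> e"])
      show "finite {j. (m, j) \<in> B}" using card_B by blast
    next
      fix t x assume t: "t \<le> s" and "(x \<^bold>\<in> fibre g C y) t"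
      then have x: "(x \<^bold>\<in> C) t" "((x, y) \<^bold>\<in> g) t" by (simp_all add: f_and_iff)
      have "(\<^bold>\<exists>i. \<^bold>\<langle>i \<in> B\<^bold>\<rangle> \<^bold>\<and> K x i) t" using x(1) by (simp add: C f_and_iff)
      from f_ex_andD[OF this] obtain u i where u: "u \<le> t" "i \<in> B" "K x i u" by auto
      then have i: "((x, snd i) \<^bold>\<in> e) u" "(\<^bold>\<exists>y. (x, y) \<^bold>\<in> g \<^bold>\<and> (y, fst i) \<^bold>\<in> h) u"
        by (simp_all add: K_def f_and_iff)
      from f_ex_andD[OF i(2)] obtain v y' where v: "v \<le> u" "((x, y') \<^bold>\<in> g) v" "((y', fst i) \<^bold>\<in> h) v"
        by blast
      have vs: "v \<le> s" using order_trans[OF v(1) order_trans[OF u(1) t]] .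
      have vp: "v \<le> p" using order_trans[OF vs order_trans[OF sq qp]] .
      have "(y' \<^bold>= y) v"
        using func_unique[OF func_lower[OF g vp] v(2) mem_lower[OF x(2) order_trans[OF v(1) u(1)]]] .
      then have "((y, fst i) \<^bold>\<in> h) v" by (intro mem_subst[OF v(3)]) simp
      then have "(fst i \<^bold>= m) v" by (rule func_unique[OF func_lower[OF h vp] _ mem_lower[OF s(2) vs]])
      then have "(m, snd i) \<in> B" using u(2) by (cases i) simp
      with u(1) i(1) show "\<exists>u\<le>t. \<exists>j\<in>{j. (m, j) \<in> B}. ((x, j) \<^bold>\<in> e) u" by blast
    next
      fix t x x' j assume t: "t \<le> s" and x: "((x, j) \<^bold>\<in> e) t" "((x', j) \<^bold>\<in> e) t"
      have "t \<le> p2" using order_trans[OF t order_trans[OF sq order_trans[OF q p3]]] .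
      then show "(x \<^bold>= x') t" using injectiveD[OF injective_lower[OF e(2)] x] by blast
    qed simp
    then obtain t c where t: "t \<le> s" "c \<le> card {j. (m, j) \<in> B}" "has_card (fibre g C y) c t" by blast
    moreover have "c \<le> m" using t(2) card_B le_trans by blast
    ultimately show ?thesis using mem_lower[OF s(2) t(1)] order_trans[OF t(1) s(1)] by blast
  qed
  with AB qp show ?thesis unfolding C_def by blast
qed

section \<open>The associated cut is standard\<close>

text \<open>Properness enters twice: an element of \<open>L\<close> supplies a set with finite
  fibres, which makes the image a p-point, and the constant classes being in \<open>S\<close> is one
  half of the equation for \<open>S\<close>. For the other half, a class in \<open>S\<close> that is
  not constant would lie above some fibre count, hence in \<open>L\<close>.\<close>

lemma standard_cut_at:
  fixes \<U> :: "nat list setn setn" and g :: "('a::names \<times> 'b::names) setn"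
  assumes gen: "generated_by \<U> generic p"
    and pp: "p_point X \<Y> p" and tukey: "tukey_equiv \<Y> \<U> p"
    and g: "func g X Y p" and V: "(\<V> \<^bold>= image_filter g Y \<Y>) p"
    and assoc: "associated_cut g Y \<Y> S L p" and proper: "proper_cut Y \<V> S L p"
  shows "(p_ultrafilter Y \<V> \<^bold>\<and> (\<^bold>\<exists>D. D \<^bold>\<in> \<V> \<^bold>\<and> ctbl D) \<^bold>\<and> standard_cut Y \<V> S L) p"
proof -
  let ?W = "image_filter g Y \<Y>"
  let ?\<Phi> = "\<lambda>c A. A \<^bold>\<in> \<Y> \<^bold>\<and> (\<^bold>\<forall>y. y \<^bold>\<in> Y \<^bold>\<longrightarrow> fin (fibre g A y)) \<^bold>\<and>
    ult_le Y ?W (ult_class Y ?W (fibre_count g Y A)) c"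
  let ?L = "SetOf c. c \<^bold>\<in> ultrapower Y ?W \<^bold>\<and> (\<^bold>\<exists>A. ?\<Phi> c A)"
  have X: "ctbl X p" and PY: "p_ultrafilter X \<Y> p" and UY: "ultrafilter X \<Y> p"
    using pp by (simp_all add: p_point_def p_ultrafilter_def f_and_iff)
  have W: "ultrafilter Y ?W p" by (rule ultrafilter_image[OF g UY])
  have L: "(L \<^bold>= ?L) p" and S: "(S \<^bold>= ultrapower Y ?W \<^bold>- L) p"
    using assoc by (simp_all add: associated_cut_def f_and_iff)
  have cut: "dedekind_cut Y \<V> S L p" and L_ne: "(\<^bold>\<exists>l. l \<^bold>\<in> L) p" and const: "(const_classes Y \<V> \<^bold>\<subseteq> S) p"
    using proper by (simp_all add: proper_cut_def f_and_iff)
  have mem_L: "(c \<^bold>\<in> ?L) = (c \<^bold>\<in> ultrapower Y ?W \<^bold>\<and> (\<^bold>\<exists>A. ?\<Phi> c A))" for c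
    by (rule mem_set_of_eq) (auto intro!: extnI)
  have "p_ultrafilter Y ?W p"
  proof (rule f_exE[OF L_ne stable_p_ultrafilter])
    fix q l assume q: "q \<le> p" "(l \<^bold>\<in> L) q"
    have "(l \<^bold>\<in> ?L) q" using eqv_mem_iff[OF L q(1)] q(2) by blast
    then have "(\<^bold>\<exists>A. ?\<Phi> l A) q" by (simp add: mem_L f_and_iff)
    then show "p_ultrafilter Y ?W q"
    proof (rule f_exE[OF _ stable_p_ultrafilter])
      fix r A assume r: "r \<le> q" "(?\<Phi> l A) r"
      have rp: "r \<le> p" using order_trans[OF r(1) q(1)] .
      have A: "(A \<^bold>\<in> \<Y>) r" and fib: "(\<^bold>\<forall>y. y \<^bold>\<in> Y \<^bold>\<longrightarrow> fin (fibre g A y)) r"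
        using r(2) by (simp_all add: f_and_iff)
      show "p_ultrafilter Y ?W r"
      proof (rule p_ultrafilter_image[OF func_lower[OF g rp] stable_mono[OF stable_p_ultrafilter PY rp] A])
        fix s y assume s: "s \<le> r" "(y \<^bold>\<in> Y) s"
        have "(y \<^bold>\<in> Y \<^bold>\<longrightarrow> fin (fibre g A y)) r" using fib by (rule f_allD)
        then show "fin (fibre g A y) s" using s by (simp add: f_imp_iff)
      qed
    qed
  qed
  then have p_V: "p_ultrafilter Y \<V> p" using eqvD[OF eqv_p_ultrafilter[OF eq_refl V]] by blast
  \<comment> \<open>\<open>Y\<close> may be uncountable; the range of \<open>g\<close> is the
    countable set on which the image is concentrated.\<close>
  have "(img g X \<^bold>\<in> ?W) p"
  proof (rule image_filterI[OF g UY ultrafilter_space[OF UY]])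
    show "(img g X \<^bold>\<subseteq> Y) p"
    proof (rule subsetI)
      fix q y assume q: "q \<le> p" "(y \<^bold>\<in> img g X) q"
      show "(y \<^bold>\<in> Y) q"
      proof (rule f_exE[OF q(2)[unfolded mem_img] stable_mem])
        fix r x assume r: "r \<le> q" "(x \<^bold>\<in> X \<^bold>\<and> (x, y) \<^bold>\<in> g) r"
        then show "(y \<^bold>\<in> Y) r"
          using func_cod[OF func_lower[OF g order_trans[OF r(1) q(1)]]] by (auto simp: f_and_iff)
      qed
    qed
  next
    fix q x y assume "q \<le> p" "(x \<^bold>\<in> X) q" "((x, y) \<^bold>\<in> g) q"
    then show "(y \<^bold>\<in> img g X) q" unfolding mem_img by (intro f_exI[of _ x] f_andI) simp_all
  qed
  then have "(img g X \<^bold>\<in> \<V>) p" using eqv_mem_iff[OF V order_refl] by blast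
  then have ctbl_V: "(\<^bold>\<exists>D. D \<^bold>\<in> \<V> \<^bold>\<and> ctbl D) p"
    using ctbl_img[OF g X] by (intro f_exI[of _ "img g X"] f_andI) simp_all
  have S_sub: "(S \<^bold>\<subseteq> const_classes Y \<V>) p"
  proof (rule subsetI, rule f_ccontr[OF stable_mem])
    fix p' c q assume p': "p' \<le> p" and cS: "(c \<^bold>\<in> S) p'" and q': "q \<le> p'"
      and no: "(\<^bold>\<not>(c \<^bold>\<in> const_classes Y \<V>)) q"
    have q: "q \<le> p" using order_trans[OF q' p'] .
    have "(c \<^bold>\<in> ultrapower Y ?W \<^bold>- L) q" using eqv_mem_iff[OF S q] mem_lower[OF cS q'] by blast
    then have c: "(c \<^bold>\<in> ultrapower Y ?W) q" "(\<^bold>\<not>(c \<^bold>\<in> L)) q" by (simp_all add: f_and_iff)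
    obtain r h where r: "r \<le> q" "power_fun Y h r" "(c \<^bold>= ult_class Y ?W h) r"
      using f_ex_andD[OF c(1)[unfolded mem_ultrapower]] by blast
    have rp: "r \<le> p" using order_trans[OF r(1) q] .
    have h: "func h Y omega r" using r(2) by (simp add: power_fun_def)
    \<comment> \<open>If \<open>h\<close> took the value \<open>m\<close> on a set of the image
      filter, \<open>c\<close> would be the class of the constant \<open>m\<close>.\<close>
    have unb: "(\<^bold>\<not>((SetOf y. y \<^bold>\<in> Y \<^bold>\<and> (y, m) \<^bold>\<in> h) \<^bold>\<in> ?W)) r" for m
    proof (rule f_notI)
      fix s assume s: "s \<le> r" and E: "((SetOf y. y \<^bold>\<in> Y \<^bold>\<and> (y, m) \<^bold>\<in> h) \<^bold>\<in> ?W) s"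
      have sp: "s \<le> p" using order_trans[OF s rp] .
      have "(c \<^bold>= ult_class Y ?W (const_fun Y m)) s"
        using eq_trans[OF eq_lower[OF r(3) s]
            ult_class_const[OF ultrafilter_lower[OF W sp] func_lower[OF h s] E]] .
      then have "(c \<^bold>\<in> const_classes Y ?W) s"
        unfolding mem_const_classes by (intro f_exI[of _ m]) simp_all
      then have "(c \<^bold>\<in> const_classes Y \<V>) s"
        using eqv_mem_iff[OF eq_const_classes[OF eq_lower[OF V sp]] order_refl] by blast
      with f_notE[OF no order_trans[OF s r(1)]] show False by blast
    qed
    have "tukey_le \<Y> \<U> p" using tukey by (simp add: tukey_equiv_def f_and_iff)
    from f_ex_andD[OF ex_lower[OF this[unfolded tukey_le_def] rp]]
    obtain s \<phi> where s: "s \<le> r" "func \<phi> \<U> \<Y> s"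
      and cof: "(\<^bold>\<forall>\<D>. cofinal \<D> \<U> \<^bold>\<longrightarrow> cofinal (img \<phi> \<D>) \<Y>) s" by blast
    have sp: "s \<le> p" using order_trans[OF s(1) rp] .
    have cof': "cofinal (img \<phi> \<D>) \<Y> t" if t: "t \<le> s" "cofinal \<D> \<U> t" for t \<D>
    proof -
      have "(cofinal \<D> \<U> \<^bold>\<longrightarrow> cofinal (img \<phi> \<D>) \<Y>) s" using cof by (rule f_allD)
      then show ?thesis using t by (simp add: f_imp_iff)
    qed
    obtain t A where t: "t \<le> s" "(A \<^bold>\<in> \<Y>) t"
      and A: "\<forall>r\<le>t. \<forall>y. (y \<^bold>\<in> Y) r \<longrightarrow>
        (\<exists>s\<le>r. \<exists>c m. has_card (fibre g A y) c s \<and> ((y, m) \<^bold>\<in> h) s \<and> c \<le> m)"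
      using tukey_fibre_bound[OF stable_mono[OF stable_generated_by gen sp] s(2) cof'
          stable_mono[OF stable_p_ultrafilter PY sp] stable_mono[OF stable_ctbl X sp]
          func_lower[OF g sp] func_lower[OF h s(1)] not_lower[OF unb s(1)]] by blast
    have tr: "t \<le> r" using order_trans[OF t(1) s(1)] .
    have t_le_p: "t \<le> p" using order_trans[OF t(1) sp] .
    have fib: "(\<^bold>\<forall>y. y \<^bold>\<in> Y \<^bold>\<longrightarrow> fin (fibre g A y)) t"
    proof (rule f_all_iff[THEN iffD2], intro allI, rule f_impI)
      fix y u assume u: "u \<le> t" "(y \<^bold>\<in> Y) u"
      show "fin (fibre g A y) u"
      proof (rule stable_dense[OF stable_fin])
        fix v assume v: "v \<le> u"
        obtain w c m where w: "w \<le> v" "has_card (fibre g A y) c w"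
          using A order_trans[OF v u(1)] mem_lower[OF u(2) v] by blast
        have "fin (fibre g A y) w"
          unfolding fin_def using w(2) by (rule f_exI) (rule stable_has_card)
        with w(1) show "\<exists>w\<le>v. fin (fibre g A y) w" by blast
      qed
    qed simp_all
    let ?C = "fibre_count g Y A"
    have C: "power_fun Y ?C t"
      unfolding power_fun_def
    proof (rule funcI)
      fix u y n assume "u \<le> t" "((y, n) \<^bold>\<in> ?C) u"
      then show "(y \<^bold>\<in> Y) u \<and> (n \<^bold>\<in> omega) u" by (simp add: mem_fibre_count f_and_iff)
    next
      fix u y assume u: "u \<le> t" "(y \<^bold>\<in> Y) u"
      show "(\<^bold>\<exists>n. (y, n) \<^bold>\<in> ?C) u"
        unfolding f_ex_iff
      proof (intro allI impI)
        fix v assume v: "v \<le> u"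
        obtain w c m where w: "w \<le> v" "has_card (fibre g A y) c w"
          using A order_trans[OF v u(1)] mem_lower[OF u(2) v] by blast
        have "((y, c) \<^bold>\<in> ?C) w"
          using w(2) mem_lower[OF u(2) order_trans[OF w(1) v]] by (simp add: mem_fibre_count f_and_iff)
        with w(1) show "\<exists>w\<le>v. \<exists>n. ((y, n) \<^bold>\<in> ?C) w" by blast
      qed
    next
      fix u y m n assume "((y, m) \<^bold>\<in> ?C) u" "((y, n) \<^bold>\<in> ?C) u"
      then have "m = n" using has_card_unique by (auto simp: mem_fibre_count f_and_iff)
      then show "(m \<^bold>= n) u" by simp
    qed
    \<comment> \<open>The bound on the fibres holds at every point, including those with an empty
      fibre, so the comparison set is all of \<open>Y\<close>.\<close>
    have "(Y \<^bold>\<subseteq> rel_set Y (\<le>) ?C h) t"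
    proof (rule subsetI)
      fix u y assume u: "u \<le> t" "(y \<^bold>\<in> Y) u"
      have "\<exists>w\<le>v. \<exists>m n. ((y, m) \<^bold>\<in> ?C) w \<and> ((y, n) \<^bold>\<in> h) w \<and> m \<le> n" if v: "v \<le> u" for v
      proof -
        obtain w c m where w: "w \<le> v" "has_card (fibre g A y) c w" "((y, m) \<^bold>\<in> h) w" "c \<le> m"
          using A order_trans[OF v u(1)] mem_lower[OF u(2) v] by blast
        have "((y, c) \<^bold>\<in> ?C) w"
          using w(2) mem_lower[OF u(2) order_trans[OF w(1) v]] by (simp add: mem_fibre_count f_and_iff)
        with w show ?thesis by blast
      qed
      with u(2) show "(y \<^bold>\<in> rel_set Y (\<le>) ?C h) u" by (simp add: rel_set_iff)
    qed
    then have "(rel_set Y (\<le>) ?C h \<^bold>\<in> ?W) t"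
      using ultrafilter_up[OF ultrafilter_lower[OF W t_le_p] ultrafilter_space[OF ultrafilter_lower[OF W t_le_p]]
          _ rel_set_sub] by blast
    moreover have "power_fun Y h t" by (rule stable_mono[OF stable_power_fun r(2) tr])
    ultimately have "ult_le Y ?W (ult_class Y ?W ?C) c t"
      unfolding ult_le_iff using C eq_lower[OF r(3) tr]
      by (intro f_exI[of _ ?C] f_exI[of _ h] f_andI) simp_all
    with t(2) fib have "(?\<Phi> c A) t" by (intro f_andI)
    then have "(\<^bold>\<exists>A. ?\<Phi> c A) t" by (rule f_exI) simp
    with mem_lower[OF c(1) order_trans[OF tr r(1)]] have "(c \<^bold>\<in> ?L) t"
      unfolding mem_L by (rule f_andI)
    then have "(c \<^bold>\<in> L) t" using eqv_mem_iff[OF L t_le_p] by blast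
    with f_notE[OF c(2) order_trans[OF tr r(1)]] show False by blast
  qed
  have "(S \<^bold>= const_classes Y \<V>) p"
    using S_sub const by (auto simp: f_eq_setn_iff subset_iff)
  with cut have "standard_cut Y \<V> S L p" by (simp add: standard_cut_def f_and_iff)
  with p_V ctbl_V show ?thesis by (intro f_andI)
qed

lemma stable_dedekind_cut [simp]: "stable (dedekind_cut Y \<V> S L)"
  by (simp add: dedekind_cut_def)

theorem theorem1p9:
  shows "\<^bold>\<tturnstile> (\<^bold>\<forall>\<U>\<^sub>1 :: nat list setn setn.
    ramsey_for_R1 \<U>\<^sub>1 \<^bold>\<and> generated_by \<U>\<^sub>1 generic \<^bold>\<longrightarrow>
    (\<^bold>\<forall>(X :: 'a::names setn) \<Y> (Y :: 'b::names setn) g \<V> S L.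
       p_point X \<Y> \<^bold>\<and> tukey_equiv \<Y> \<U>\<^sub>1 \<^bold>\<and> func g X Y \<^bold>\<and> \<V> \<^bold>= image_filter g Y \<Y> \<^bold>\<and>
       associated_cut g Y \<Y> S L \<^bold>\<and> proper_cut Y \<V> S L \<^bold>\<longrightarrow>
       p_ultrafilter Y \<V> \<^bold>\<and> (\<^bold>\<exists>D. D \<^bold>\<in> \<V> \<^bold>\<and> ctbl D) \<^bold>\<and> standard_cut Y \<V> S L))"
proof -
  \<comment> \<open>\<open>f_impI\<close> reads a forced implication as an implication at all
    stronger conditions, which is correct for stable sentences.\<close>
  have [simp]: "stable (ramsey_for_R1 \<U>)" "stable (p_point X \<Y>)" "stable (tukey_equiv \<Y> \<U>)"
    "stable (associated_cut g Y \<Y> S L)" "stable (proper_cut Y \<V> S L)" "stable (standard_cut Y \<V> S L)"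
    for \<U> :: "nat list setn setn" and X :: "'a setn" and \<Y> and Y :: "'b setn" and g \<V> S L
    by (simp_all add: ramsey_for_R1_def p_point_def tukey_equiv_def tukey_le_def associated_cut_def
        proper_cut_def standard_cut_def)
  show ?thesis
    unfolding valid_def
  proof (intro allI, rule f_all_iff[THEN iffD2], intro allI, rule f_impI)
    fix p q and \<U>\<^sub>1 :: "nat list setn setn"
    assume "(ramsey_for_R1 \<U>\<^sub>1 \<^bold>\<and> generated_by \<U>\<^sub>1 generic) q"
    then have gen: "generated_by \<U>\<^sub>1 generic q" by (simp add: f_and_iff)
    show "(\<^bold>\<forall>(X :: 'a::names setn) \<Y> (Y :: 'b::names setn) g \<V> S L.
       p_point X \<Y> \<^bold>\<and> tukey_equiv \<Y> \<U>\<^sub>1 \<^bold>\<and> func g X Y \<^bold>\<and> \<V> \<^bold>= image_filter g Y \<Y> \<^bold>\<and>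
       associated_cut g Y \<Y> S L \<^bold>\<and> proper_cut Y \<V> S L \<^bold>\<longrightarrow>
       p_ultrafilter Y \<V> \<^bold>\<and> (\<^bold>\<exists>D. D \<^bold>\<in> \<V> \<^bold>\<and> ctbl D) \<^bold>\<and> standard_cut Y \<V> S L) q"
      unfolding f_all_iff
    proof (intro allI, rule f_impI)
      fix X :: "'a setn" and \<Y> and Y :: "'b setn" and g \<V> S L r
      assume r: "r \<le> q" and "(p_point X \<Y> \<^bold>\<and> tukey_equiv \<Y> \<U>\<^sub>1 \<^bold>\<and> func g X Y \<^bold>\<and>
        \<V> \<^bold>= image_filter g Y \<Y> \<^bold>\<and> associated_cut g Y \<Y> S L \<^bold>\<and> proper_cut Y \<V> S L) r"
      then show "(p_ultrafilter Y \<V> \<^bold>\<and> (\<^bold>\<exists>D. D \<^bold>\<in> \<V> \<^bold>\<and> ctbl D) \<^bold>\<and> standard_cut Y \<V> S L) r"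
        using stable_mono[OF stable_generated_by gen r]
        by (intro standard_cut_at[where g = g and X = X and \<Y> = \<Y> and \<U> = \<U>\<^sub>1])
           (simp_all add: f_and_iff)
    qed simp_all
  qed simp_all
qed

end
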